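(* Let $(T,\Sigma,\mu)$ be a complete $\sigma$-finite measure space, let $Z$ be a separable reflexive Banach space, let $1\le p<\infty$ with conjugate exponent $q$, and let $S:T\rightrightarrows Z$ be a measurable multifunction with nonempty closed values. Let $F:L^p(T,Z)\to\mathbb R$ be locally Lipschitz and let $\overline x\in\mathsf{Sel}_p(S)$ be a local solution of the problem of minimizing $F(x)$ subject to $x\in\mathsf{Sel}_p(S)$. Then $$0\in\widehat\partial F(\overline x)+\{\xi\in L^q(T,Z^* ):\xi(t)\in\widehat{\mathbf N}_{S(t)}(\overline x(t))\text{ a.e.}\}.$$
   Context: $L^p(T,Z)$ is the Lebesgue--Bochner space; $q=\infty$ if $p=1$ and $1/p+1/q=1$ otherwise. Since $Z$ is reflexive, $[L^p(T,Z)]^*$ is identified with $L^q(T,Z^* )$ via $\langle\xi,v\rangle=\int_T\langle\xi(t),v(t)\rangle\,d\mu(t)$. A multifunction $S:T\rightrightarrows Z$ with nonempty closed values is measurable if $\{t: S(t)\cap U\neq\emptyset\}\in\Sigma$ for every open $U\subset Z$. $\mathsf{Sel}_p(S):=\{z\in L^p(T,Z): z(t)\in S(t)\text{ a.e.}\}$. Clarke tangent cone: for a Banach space $X$ with closed unit ball $\overline{\mathbf B}_X$, $C\subset X$ closed and $x\in C$, $\widehat{\mathbf T}_C(x)$ is the set of all $v\in X$ such that for every $\varepsilon>0$ there exist $\delta>0$, $\lambda>0$ such that $C\cap[y+\eta(v+\varepsilon\overline{\mathbf B}_X)]\ne\emptyset$ for every $y\in C\cap(x+\delta\overline{\mathbf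 B}_X)$ and every $\eta\in[0,\lambda]$. Clarke normal cone: $\widehat{\mathbf N}_C(x):=\{\xi\in X^*:\langle\xi,v\rangle\le0\ \forall v\in\widehat{\mathbf T}_C(x)\}$. $\widehat\partial F$ is the Clarke subdifferential of the locally Lipschitz function $F$. *)

theory Defs
  imports "HOL-Analysis.Analysis" "HOL-Library.Set_Algebras" "HOL-Library.Function_Algebras"
begin

definition reflexive_space :: "'z::real_normed_vector itself \<Rightarrow> bool" where
  "reflexive_space _ \<longleftrightarrow>
     (\<forall>\<phi> :: ('z \<Rightarrow>\<^sub>L real) \<Rightarrow>\<^sub>L real. \<exists>z::'z. \<forall>f. blinfun_apply \<phi> f = blinfun_apply f z)"

definition clarke_tangent_cone :: "'z::real_normed_vector set \<Rightarrow> 'z \<Rightarrow> 'z set" where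
  "clarke_tangent_cone C x =
     {v. \<forall>\<epsilon>>0. \<exists>\<delta>>0. \<exists>l>0. \<forall>y \<in> C \<inter> cball x \<delta>. \<forall>\<eta>\<in>{0..l}.
        C \<inter> (\<lambda>b. y + \<eta> *\<^sub>R (v + \<epsilon> *\<^sub>R b)) ` cball 0 1 \<noteq> {}}"

definition clarke_normal_cone :: "'z::real_normed_vector set \<Rightarrow> 'z \<Rightarrow> ('z \<Rightarrow>\<^sub>L real) set" where
  "clarke_normal_cone C x = {\<xi>. \<forall>v \<in> clarke_tangent_cone C x. blinfun_apply \<xi> v \<le> 0}"

text \<open>
  A type cannot depend on the measure, so elements of \<open>L\<^sup>p(M, Z)\<close> are represented by functions
  rather than by classes modulo equality almost everywhere, and \<open>Lp_norm\<close> is a seminorm that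
  vanishes exactly on the members of \<open>Lp M p\<close> that are zero almost everywhere. Everything below is stable
  under change of representative; in particular, a functional that is locally Lipschitz in the
  sense of \<open>locally_lipschitz_Lp\<close> takes equal values at almost everywhere equal functions.

  Borel measurability agrees with strong measurability when the values lie in a separable space.
  This covers \<open>Z\<close> separable, and the dual of \<open>Z\<close> when \<open>Z\<close> is in addition reflexive.
\<close>

definition Lp :: "'t measure \<Rightarrow> ennreal \<Rightarrow> ('t \<Rightarrow> 'z::real_normed_vector) set" where
  "Lp M p = {f \<in> borel_measurable M.
     if p = \<infinity> then \<exists>C. AE t in M. norm (f t) \<le> C
     else integrable M (\<lambda>t. norm (f t) powr enn2real p)}"

definition Lp_norm :: "'t measure \<Rightarrow> ennreal \<Rightarrow> ('t \<Rightarrow> 'z::real_normed_vector) \<Rightarrow> real" where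
  "Lp_norm M p f =
     (if p = \<infinity> then Inf {C. 0 \<le> C \<and> (AE t in M. norm (f t) \<le> C)}
      else (\<integral>t. norm (f t) powr enn2real p \<partial>M) powr (1 / enn2real p))"

definition Lp_dist :: "'t measure \<Rightarrow> ennreal \<Rightarrow> ('t \<Rightarrow> 'z::real_normed_vector) \<Rightarrow> ('t \<Rightarrow> 'z) \<Rightarrow> real" where
  "Lp_dist M p f g = Lp_norm M p (\<lambda>t. f t - g t)"

definition Lp_nhds :: "'t measure \<Rightarrow> ennreal \<Rightarrow> ('t \<Rightarrow> 'z::real_normed_vector) \<Rightarrow> ('t \<Rightarrow> 'z) filter" where
  "Lp_nhds M p x = (INF r\<in>{0<..}. principal {y \<in> Lp M p. Lp_dist M p y x < r})"

text \<open>
  Functionals are set to 0 outside \<open>Lp M p\<close>, so that equality, zero and sums of elements of the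
  dual are those of the ambient function type.
\<close>

definition Lp_dual :: "'t measure \<Rightarrow> ennreal \<Rightarrow> (('t \<Rightarrow> 'z::real_normed_vector) \<Rightarrow> real) set" where
  "Lp_dual M p = {\<phi>.
     (\<forall>v. v \<notin> Lp M p \<longrightarrow> \<phi> v = 0) \<and>
     (\<forall>v \<in> Lp M p. \<forall>w \<in> Lp M p. \<phi> (\<lambda>t. v t + w t) = \<phi> v + \<phi> w) \<and>
     (\<forall>v \<in> Lp M p. \<forall>c. \<phi> (\<lambda>t. c *\<^sub>R v t) = c * \<phi> v) \<and>
     (\<exists>K. \<forall>v \<in> Lp M p. \<bar>\<phi> v\<bar> \<le> K * Lp_norm M p v)}"

text \<open>
  The functional on \<open>Lp M p\<close> identified with a function \<open>\<xi>\<close> in \<open>L\<^sup>q\<close> with values in the dual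
  of \<open>Z\<close>.
\<close>

definition Lp_pairing ::
  "'t measure \<Rightarrow> ennreal \<Rightarrow> ('t \<Rightarrow> 'z::real_normed_vector \<Rightarrow>\<^sub>L real) \<Rightarrow> ('t \<Rightarrow> 'z) \<Rightarrow> real" where
  "Lp_pairing M p \<xi> = (\<lambda>v. if v \<in> Lp M p then \<integral>t. blinfun_apply (\<xi> t) (v t) \<partial>M else 0)"

definition locally_lipschitz_Lp ::
  "'t measure \<Rightarrow> ennreal \<Rightarrow> (('t \<Rightarrow> 'z::real_normed_vector) \<Rightarrow> real) \<Rightarrow> bool" where
  "locally_lipschitz_Lp M p F \<longleftrightarrow>
     (\<forall>x \<in> Lp M p. \<exists>r>0. \<exists>K. \<forall>y \<in> Lp M p. \<forall>z \<in> Lp M p.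
        Lp_dist M p y x < r \<longrightarrow> Lp_dist M p z x < r \<longrightarrow> \<bar>F y - F z\<bar> \<le> K * Lp_dist M p y z)"

definition clarke_derivative ::
  "'t measure \<Rightarrow> ennreal \<Rightarrow> (('t \<Rightarrow> 'z::real_normed_vector) \<Rightarrow> real) \<Rightarrow> ('t \<Rightarrow> 'z) \<Rightarrow> ('t \<Rightarrow> 'z) \<Rightarrow> ereal"
where
  "clarke_derivative M p F x v =
     Limsup (Lp_nhds M p x \<times>\<^sub>F at_right 0)
       (\<lambda>(y, \<eta>). ereal ((F (\<lambda>t. y t + \<eta> *\<^sub>R v t) - F y) / \<eta>))"

definition clarke_subdifferential ::
  "'t measure \<Rightarrow> ennreal \<Rightarrow> (('t \<Rightarrow> 'z::real_normed_vector) \<Rightarrow> real) \<Rightarrow> ('t \<Rightarrow> 'z)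
    \<Rightarrow> (('t \<Rightarrow> 'z) \<Rightarrow> real) set" where
  "clarke_subdifferential M p F x =
     {\<phi> \<in> Lp_dual M p. \<forall>v \<in> Lp M p. ereal (\<phi> v) \<le> clarke_derivative M p F x v}"

definition measurable_multifunction :: "'t measure \<Rightarrow> ('t \<Rightarrow> 'z::topological_space set) \<Rightarrow> bool" where
  "measurable_multifunction M S \<longleftrightarrow>
     (\<forall>U. open U \<longrightarrow> {t \<in> space M. S t \<inter> U \<noteq> {}} \<in> sets M)"

definition Sel :: "'t measure \<Rightarrow> ennreal \<Rightarrow> ('t \<Rightarrow> 'z::real_normed_vector set) \<Rightarrow> ('t \<Rightarrow> 'z) set" where
  "Sel M p S = {z \<in> Lp M p. AE t in M. z t \<in> S t}"

definition local_minimizer_Lp ::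
  "'t measure \<Rightarrow> ennreal \<Rightarrow> (('t \<Rightarrow> 'z::real_normed_vector) \<Rightarrow> real) \<Rightarrow> ('t \<Rightarrow> 'z) set \<Rightarrow> ('t \<Rightarrow> 'z) \<Rightarrow> bool"
where
  "local_minimizer_Lp M p F A x \<longleftrightarrow>
     x \<in> A \<and> (\<exists>r>0. \<forall>y \<in> A. Lp_dist M p y x < r \<longrightarrow> F x \<le> F y)"

end

theory Submission
  imports Defs
begin

text \<open>
  Let \<open>H(v)(t)\<close> be the positive part of the Clarke directional derivative at \<open>xbar t\<close> of the distance to
  \<open>S t\<close>, in the direction \<open>v t\<close>. If \<open>F\<close> has Lipschitz constant \<open>K\<close> near \<open>xbar\<close>, then moving from
  \<open>xbar + \<eta> v\<close> to a measurable selection of almost nearest points of \<open>S\<close> gives, by dominated convergence,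
  \<open>F\<degree>(xbar; v) + K \<parallel>H(v)\<parallel> \<ge> 0\<close>. One application of the Hahn--Banach theorem on \<open>L\<^sup>p(Z) \<times> L\<^sup>p(\<real>)\<close>
  then yields \<open>\<phi> \<le> F\<degree>(xbar; \<sqdot>)\<close> and a positive bounded functional \<open>\<omega>\<close> with \<open>- \<phi>(v) \<le> \<omega>(H(v))\<close>. By
  Radon--Nikodym \<open>\<omega>\<close> has a density \<open>w\<close> in \<open>L\<^sup>q\<close>. The bound by \<open>\<omega> \<circ> H\<close> makes \<open>- \<phi>\<close> an integral functional with a
  density \<open>\<xi>\<close> satisfying \<open>\<xi>(t) z \<le> w(t) H(z)(t)\<close>, and \<open>H(z)(t) = 0\<close> for tangent directions \<open>z\<close>, so
  \<open>\<xi>(t)\<close> is normal. Selecting from the tangent cones is never needed. Reflexivity enters only through the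
  separability of the dual of \<open>Z\<close>, which makes \<open>\<xi>\<close> Borel measurable.
\<close>

section \<open>Hahn--Banach for sublinear functionals\<close>

text \<open>Separating the penalized inequality directly would give only
  \<open>- \<phi>(v) \<le> K \<parallel>H(v)\<parallel>\<close>, a bound that is not additive over
  disjoint sets when p > 1. The second variable f in L^p of the reals, constrained by
  \<open>f \<ge> H(v)\<close>, turns the norm into a linear functional at the moment of separation.
  A bound by \<open>\<omega>(H(v))\<close> is an integral, so it localizes to almost every t for
  countably many z, and continuity in z extends it to all z. Where \<open>xbar t\<close> lies in
  \<open>S t\<close>, the derivative of the distance is nonnegative already. The positive part
  settles the remaining null set, so that constraints on H(v) can be imposed at every t. Elements of
  L^p are functions and not classes, so their norm is a seminorm on a subspace of a function space.
  Separation and directional derivatives are therefore developed for subspaces of a real vector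
  space, with no topology on the type.\<close>

instantiation "fun" :: (type, real_vector) real_vector
begin

definition scaleR_fun :: "real \<Rightarrow> ('a \<Rightarrow> 'b) \<Rightarrow> 'a \<Rightarrow> 'b" where
  "scaleR_fun c f = (\<lambda>x. c *\<^sub>R f x)"

instance
  by standard (simp_all add: scaleR_fun_def fun_eq_iff scaleR_add_right scaleR_add_left)

end

lemma scaleR_fun_apply [simp]: "(c *\<^sub>R f) x = c *\<^sub>R f x"
  by (simp add: scaleR_fun_def)

definition sublinear_on :: "'a::real_vector set \<Rightarrow> ('a \<Rightarrow> real) \<Rightarrow> bool" where
  "sublinear_on V p \<longleftrightarrow>
     (\<forall>u\<in>V. \<forall>v\<in>V. p (u + v) \<le> p u + p v) \<and> (\<forall>u\<in>V. \<forall>c\<ge>0. p (c *\<^sub>R u) = c * p u)"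

definition linear_functional_on :: "'a::real_vector set \<Rightarrow> ('a \<Rightarrow> real) \<Rightarrow> bool" where
  "linear_functional_on V f \<longleftrightarrow>
     (\<forall>u\<in>V. \<forall>v\<in>V. f (u + v) = f u + f v) \<and> (\<forall>u\<in>V. \<forall>c. f (c *\<^sub>R u) = c * f u)"

lemma sublinear_onD:
  assumes "sublinear_on V p"
  shows "u \<in> V \<Longrightarrow> v \<in> V \<Longrightarrow> p (u + v) \<le> p u + p v"
    and "u \<in> V \<Longrightarrow> 0 \<le> c \<Longrightarrow> p (c *\<^sub>R u) = c * p u"
  using assms by (auto simp: sublinear_on_def)

text \<open>One inequality is enough for homogeneity: applied to \<open>c *\<^sub>R u\<close> with
  the factor \<open>inverse c\<close>, it yields the reverse one.\<close>

lemma sublinear_onI: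
  assumes "\<And>u v. u \<in> V \<Longrightarrow> v \<in> V \<Longrightarrow> p (u + v) \<le> p u + p v"
    and "p 0 = 0"
    and "\<And>u c. u \<in> V \<Longrightarrow> c > 0 \<Longrightarrow> p (c *\<^sub>R u) \<le> c * p u"
    and V: "\<And>u c. u \<in> V \<Longrightarrow> c *\<^sub>R u \<in> V"
  shows "sublinear_on V p"
  unfolding sublinear_on_def
proof (intro conjI ballI allI impI)
  fix u c assume u: "u \<in> V" and c: "(0::real) \<le> c"
  show "p (c *\<^sub>R u) = c * p u"
  proof (cases "c = 0")
    case False
    with c have c: "c > 0" by simp
    have "p (inverse c *\<^sub>R (c *\<^sub>R u)) \<le> inverse c * p (c *\<^sub>R u)"
      using V[OF u] c by (intro assms(3)) auto
    then have "c * p u \<le> p (c *\<^sub>R u)" using c by (simp add: field_simps)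
    with assms(3)[OF u c] show ?thesis by simp
  qed (simp add: assms(2))
qed (use assms in auto)

lemma linear_functional_onD:
  assumes "linear_functional_on V f"
  shows "u \<in> V \<Longrightarrow> v \<in> V \<Longrightarrow> f (u + v) = f u + f v"
    and "u \<in> V \<Longrightarrow> f (c *\<^sub>R u) = c * f u"
  using assms by (auto simp: linear_functional_on_def)

lemma linear_functional_on_minus:
  assumes "linear_functional_on V f" "u \<in> V"
  shows "f (- u) = - f u"
  using linear_functional_onD(2)[OF assms, of "-1"] by simp

lemma linear_functional_on_diff:
  assumes "linear_functional_on V f" "subspace V" "u \<in> V" "v \<in> V"
  shows "f (u - v) = f u - f v"
  using linear_functional_onD(1)[OF assms(1), of u "- v"] linear_functional_on_minus[OF assms(1), of v]
    assms by (simp add: subspace_neg)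

lemma sublinear_on_ge:
  assumes "sublinear_on V p" "subspace V" "v \<in> V"
  shows "- p (- v) \<le> p v"
proof -
  have "p 0 = 0" using sublinear_onD(2)[OF assms(1,3), of 0] by simp
  then show ?thesis
    using sublinear_onD(1)[OF assms(1,3), of "- v"] assms by (simp add: subspace_neg)
qed

text \<open>\<open>W\<close> is a convex cone of constraints \<open>(u, a)\<close>, and
  \<open>nn\<close> says that \<open>p\<close> is compatible with each of them. The cone property
  makes the infimum sublinear, and compatibility keeps it finite.\<close>

lemma sublinear_on_infconv:
  assumes p: "sublinear_on V p" and V: "subspace V"
    and W: "\<And>u a. (u, a) \<in> W \<Longrightarrow> u \<in> V" "(0, 0) \<in> W"
      "\<And>u a v b. (u, a) \<in> W \<Longrightarrow> (v, b) \<in> W \<Longrightarrow> (u + v, a + b) \<in> W"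
      "\<And>u a c. (u, a) \<in> W \<Longrightarrow> c > 0 \<Longrightarrow> (c *\<^sub>R u, c * a) \<in> W"
    and nn: "\<And>u a. (u, a) \<in> W \<Longrightarrow> 0 \<le> p u + a"
  obtains q where "sublinear_on V q"
    and "\<And>v u a. v \<in> V \<Longrightarrow> (u, a) \<in> W \<Longrightarrow> q v \<le> p (v + u) + (a::real)"
proof
  define q where "q = (\<lambda>v. INF (u, a)\<in>W. p (v + u) + a)"
  have bdd: "bdd_below ((\<lambda>(u, a). p (v + u) + a) ` W)" if v: "v \<in> V" for v
  proof (rule bdd_belowI2)
    fix ua assume ua: "ua \<in> W"
    obtain u a where [simp]: "ua = (u, a)" by force
    \<comment> \<open>Writing \<open>u\<close> as \<open>(v + u) - v\<close> turns \<open>nn\<close>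
      into the lower bound \<open>- p (- v)\<close>, which does not depend on the
      constraint.\<close>
    have "u \<in> V" using ua W(1) by auto
    then have "p u \<le> p (v + u) + p (- v)"
      using sublinear_onD(1)[OF p, of "v + u" "- v"] V v by (simp add: subspace_add subspace_neg)
    then show "- p (- v) \<le> (case ua of (u, a) \<Rightarrow> p (v + u) + a)"
      using nn[of u a] ua by simp
  qed
  show le: "q v \<le> p (v + u) + a" if "v \<in> V" "(u, a) \<in> W" for v u a
    unfolding q_def using cINF_lower[OF bdd[OF that(1)] that(2)] by simp
  have ge: "c \<le> q v" if "\<And>u a. (u, a) \<in> W \<Longrightarrow> c \<le> p (v + u) + a" for c v
    unfolding q_def by (rule cINF_greatest) (use W(2) that in auto)
  have p0: "p 0 = 0" using sublinear_onD(2)[OF p, of 0 0] V by (simp add: subspace_0)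
  show "sublinear_on V q"
  proof (rule sublinear_onI)
    fix u v assume uv: "u \<in> V" "v \<in> V"
    have "q (u + v) - (p (v + w) + a) \<le> q u" if w: "(w, a) \<in> W" for w a
    proof (rule ge)
      fix w' b assume w': "(w', b) \<in> W"
      have "q (u + v) \<le> p ((u + v) + (w' + w)) + (b + a)"
        using uv V w w' by (intro le W(3)) (auto simp: subspace_add)
      also have "(u + v) + (w' + w) = (u + w') + (v + w)" by simp
      also have "p \<dots> \<le> p (u + w') + p (v + w)"
        using uv w w' V W(1) by (intro sublinear_onD[OF p]) (auto simp: subspace_add)
      finally show "q (u + v) - (p (v + w) + a) \<le> p (u + w') + b" by simp
    qed
    then have "q (u + v) - q u \<le> q v" by (intro ge) (simp add: algebra_simps)
    then show "q (u + v) \<le> q u + q v" by simp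
  next
    show "q 0 = 0"
      using le[of 0 0 0] W(2) V p0 nn by (intro antisym ge) (auto simp: subspace_0)
  next
    fix u and c :: real assume u: "u \<in> V" and c: "c > 0"
    have "q (c *\<^sub>R u) / c \<le> q u"
    proof (rule ge)
      fix w a assume w: "(w, a) \<in> W"
      have "q (c *\<^sub>R u) \<le> p (c *\<^sub>R u + c *\<^sub>R w) + c * a"
        using u w c V by (intro le W(4)) (auto simp: subspace_mul)
      also have "p (c *\<^sub>R u + c *\<^sub>R w) = c * p (u + w)"
        using sublinear_onD(2)[OF p, of "u + w" c] u w W(1) c V
        by (simp add: subspace_add scaleR_add_right)
      finally show "q (c *\<^sub>R u) / c \<le> p (u + w) + a" using c by (simp add: field_simps)
    qed
    then show "q (c *\<^sub>R u) \<le> c * q u" using c by (simp add: field_simps)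
  qed (use V in \<open>auto simp: subspace_mul\<close>)
qed

text \<open>A minimal sublinear functional is linear: for fixed \<open>y\<close> the infimal convolution
  \<open>\<lambda>x. inf {p (x + t *\<^sub>R y) - t * p y |t. t \<ge> 0}\<close> is sublinear and lies below \<open>p\<close>.\<close>

lemma Hahn_Banach_sublinear:
  assumes p: "sublinear_on V p" and V: "subspace V"
  obtains f where "linear_functional_on V f" "\<And>v. v \<in> V \<Longrightarrow> f v \<le> p v"
proof -
  \<comment> \<open>Values off \<open>V\<close> are fixed at 0, since the order on functions
    compares all points while minimality concerns \<open>V\<close> only.\<close>
  define A where "A = {q. sublinear_on V q \<and> (\<forall>v\<in>V. q v \<le> p v) \<and> (\<forall>v. v \<notin> V \<longrightarrow> q v = 0)}"
  have V_simps [simp]: "0 \<in> V" "\<And>u v. u \<in> V \<Longrightarrow> v \<in> V \<Longrightarrow> u + v \<in> V" "\<And>u. u \<in> V \<Longrightarrow> - u \<in> V"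
    "\<And>u c. u \<in> V \<Longrightarrow> c *\<^sub>R u \<in> V"
    using V by (auto simp: subspace_0 subspace_add subspace_neg subspace_mul)
  have trunc: "(\<lambda>v. if v \<in> V then q v else 0) \<in> A" if "sublinear_on V q" "\<And>v. v \<in> V \<Longrightarrow> q v \<le> p v" for q
    using that unfolding A_def sublinear_on_def by auto
  \<comment> \<open>Zorn's lemma is used for the reversed order, so a chain is bounded by its
    pointwise infimum. This is finite because every member satisfies
    \<open>- p (- v) \<le> q v\<close>.\<close>
  have "\<exists>m\<in>A. \<forall>a\<in>A. a \<le> m \<longrightarrow> a = m"
  proof (rule predicate_Zorn[where P = "\<lambda>q r. r \<le> q"])
    show "partial_order_on A (relation_of (\<lambda>q r. r \<le> q) A)"
      by (rule partial_order_on_relation_ofI) auto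
    fix C assume C: "C \<in> Chains (relation_of (\<lambda>q r. r \<le> q) A)"
    then have CA: "C \<subseteq> A" and chain: "\<And>q r. q \<in> C \<Longrightarrow> r \<in> C \<Longrightarrow> q \<le> r \<or> r \<le> q"
      unfolding Chains_def relation_of_def by auto
    show "\<exists>u\<in>A. \<forall>a\<in>C. u \<le> a"
    proof (cases "C = {}")
      case True
      with trunc[OF p] show ?thesis by auto
    next
      case False
      define u where "u = (\<lambda>v. INF q\<in>C. q v)"
      have sub: "sublinear_on V q" and qp: "\<And>v. v \<in> V \<Longrightarrow> q v \<le> p v" if "q \<in> C" for q
        using that CA unfolding A_def by auto
      have bdd: "bdd_below ((\<lambda>q. q v) ` C)" if v: "v \<in> V" for v
      proof (rule bdd_belowI2)
        fix q assume q: "q \<in> C"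
        show "- p (- v) \<le> q v"
          using sublinear_on_ge[OF sub[OF q] V v] qp[OF q, of "- v"] v by simp
      qed
      have le: "u v \<le> q v" if "v \<in> V" "q \<in> C" for v q
        unfolding u_def using cINF_lower[OF bdd[OF that(1)] that(2)] .
      have ge: "c \<le> u v" if "\<And>q. q \<in> C \<Longrightarrow> c \<le> q v" for c v
        unfolding u_def using False that by (rule cINF_greatest)
      have "sublinear_on V u"
      proof (rule sublinear_onI)
        fix v w assume vw: "v \<in> V" "w \<in> V"
        have "u (v + w) - r w \<le> u v" if r: "r \<in> C" for r
        proof (rule ge)
          fix q assume q: "q \<in> C"
          \<comment> \<open>Two infima have to be bounded through a single member: the chain
            property supplies one below both \<open>q\<close> and \<open>r\<close>.\<close>
          obtain s where s: "s \<in> C" "s \<le> q" "s \<le> r" using chain[OF q r] q r by auto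
          have "u (v + w) \<le> s (v + w)" using vw s by (intro le) auto
          also have "\<dots> \<le> s v + s w" using sublinear_onD(1)[OF sub[OF s(1)] vw] .
          also have "\<dots> \<le> q v + r w" using s by (auto simp: le_fun_def intro: add_mono)
          finally show "u (v + w) - r w \<le> q v" by simp
        qed
        then have "u (v + w) - u v \<le> u w" by (intro ge) (simp add: algebra_simps)
        then show "u (v + w) \<le> u v + u w" by simp
      next
        have "q 0 = 0" if "q \<in> C" for q
          using sublinear_onD(2)[OF sub[OF that], of 0 0] by simp
        then have "(\<lambda>q. q 0) ` C = {0}" using False by force
        then show "u 0 = 0" unfolding u_def by simp
      next
        fix v and c :: real assume v: "v \<in> V" and c: "c > 0"
        have "u (c *\<^sub>R v) / c \<le> u v"
        proof (rule ge)
          fix q assume q: "q \<in> C"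
          have "u (c *\<^sub>R v) \<le> c * q v"
            using le[of "c *\<^sub>R v" q] q v c sublinear_onD(2)[OF sub[OF q] v, of c] by simp
          then show "u (c *\<^sub>R v) / c \<le> q v" using c by (simp add: field_simps)
        qed
        then show "u (c *\<^sub>R v) \<le> c * u v" using c by (simp add: field_simps)
      qed auto
      moreover have "u v \<le> p v" if "v \<in> V" for v
        using le[OF that] qp[OF _ that] False by (meson all_not_in_conv order_trans)
      ultimately have "(\<lambda>v. if v \<in> V then u v else 0) \<in> A" by (rule trunc)
      moreover have "(\<lambda>v. if v \<in> V then u v else 0) \<le> q" if "q \<in> C" for q
        using le[OF _ that] that CA unfolding A_def le_fun_def by auto
      ultimately show ?thesis by blast
    qed
  qed
  then obtain m where mA: "m \<in> A" and min: "\<And>a. a \<in> A \<Longrightarrow> a \<le> m \<Longrightarrow> a = m" by auto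
  have m: "sublinear_on V m" and mp: "\<And>v. v \<in> V \<Longrightarrow> m v \<le> p v" and m0: "\<And>v. v \<notin> V \<Longrightarrow> m v = 0"
    using mA unfolding A_def by auto
  have add: "m (x + y) = m x + m y" if x: "x \<in> V" and y: "y \<in> V" for x y
  proof -
    define W where "W = (\<lambda>t. (t *\<^sub>R y, - t * m y)) ` {0..}"
    obtain q where q: "sublinear_on V q"
      and qle: "\<And>v u a. v \<in> V \<Longrightarrow> (u, a) \<in> W \<Longrightarrow> q v \<le> m (v + u) + a"
    proof (rule sublinear_on_infconv[OF m V, where W = W])
      fix u a v b assume "(u, a) \<in> W" "(v, b) \<in> W"
      then obtain s t where st: "s \<ge> 0" "t \<ge> 0" "u = s *\<^sub>R y" "a = - s * m y" "v = t *\<^sub>R y" "b = - t * m y"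
        unfolding W_def by auto
      show "(u + v, a + b) \<in> W"
        unfolding W_def by (rule image_eqI[of _ _ "s + t"]) (use st in \<open>auto simp: algebra_simps\<close>)
    next
      fix u a and c :: real assume "(u, a) \<in> W" "c > 0"
      then obtain s where st: "s \<ge> 0" "u = s *\<^sub>R y" "a = - s * m y" "c > 0"
        unfolding W_def by auto
      show "(c *\<^sub>R u, c * a) \<in> W"
        unfolding W_def by (rule image_eqI[of _ _ "c * s"]) (use st in \<open>auto simp: algebra_simps\<close>)
    next
      fix u a assume "(u, a) \<in> W"
      then show "0 \<le> m u + a"
        unfolding W_def using sublinear_onD(2)[OF m y] by auto
    qed (use y in \<open>auto simp: W_def intro!: image_eqI[of _ _ 0]\<close>)
    have W0: "(0, 0) \<in> W" unfolding W_def by (rule image_eqI[of _ _ 0]) auto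
    have W1: "(y, - m y) \<in> W" unfolding W_def by (rule image_eqI[of _ _ 1]) auto
    have qm: "q v \<le> m v" if "v \<in> V" for v using qle[OF that W0] by simp
    \<comment> \<open>The parameter 0 gives \<open>q \<le> m\<close>, hence equality by minimality;
      the parameter 1 then gives \<open>m x + m y \<le> m (x + y)\<close>.\<close>
    have "(\<lambda>v. if v \<in> V then q v else 0) = m"
      using qm mp m0 by (intro min trunc q) (auto simp: le_fun_def intro: order_trans)
    then have "q x = m x" using x by meson
    then have "m x \<le> m (x + y) - m y" using qle[OF x W1] by simp
    with sublinear_onD(1)[OF m x y] show ?thesis by simp
  qed
  have neg: "m (- v) = - m v" if "v \<in> V" for v
    using add[of v "- v"] that sublinear_onD(2)[OF m that, of 0] by simp
  have scale: "m (c *\<^sub>R v) = c * m v" if v: "v \<in> V" for c v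
  proof (cases "c \<ge> 0")
    case False
    then have "m ((- c) *\<^sub>R v) = - c * m v" by (intro sublinear_onD(2)[OF m v]) simp
    then show ?thesis using neg[of "c *\<^sub>R v"] v by simp
  qed (use sublinear_onD(2)[OF m v] in simp)
  show ?thesis
    by (rule that[of m]) (auto simp: linear_functional_on_def add scale mp)
qed

text \<open>A linear functional below the infimal convolution \<open>q\<close> is below
  \<open>p\<close> by the trivial constraint. At \<open>- u\<close> the constraint
  \<open>(u, a)\<close> gives \<open>q (- u) \<le> p 0 + a = a\<close>, which is
  \<open>0 \<le> f u + a\<close>.\<close>

lemma Hahn_Banach_cone:
  assumes p: "sublinear_on V p" and V: "subspace V"
    and W: "\<And>u a. (u, a) \<in> W \<Longrightarrow> u \<in> V" "(0, 0) \<in> W"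
      "\<And>u a v b. (u, a) \<in> W \<Longrightarrow> (v, b) \<in> W \<Longrightarrow> (u + v, a + b) \<in> W"
      "\<And>u a c. (u, a) \<in> W \<Longrightarrow> c > 0 \<Longrightarrow> (c *\<^sub>R u, c * a) \<in> W"
    and nn: "\<And>u a. (u, a) \<in> W \<Longrightarrow> 0 \<le> p u + a"
  obtains f where "linear_functional_on V f" "\<And>v. v \<in> V \<Longrightarrow> f v \<le> p v"
    and "\<And>u a. (u, a) \<in> W \<Longrightarrow> 0 \<le> f u + (a::real)"
proof -
  obtain q where q: "sublinear_on V q"
    and qle: "\<And>v u a. v \<in> V \<Longrightarrow> (u, a) \<in> W \<Longrightarrow> q v \<le> p (v + u) + a"
    by (rule sublinear_on_infconv[OF p V, where W = W]) (use W nn in blast)+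
  obtain f where f: "linear_functional_on V f" "\<And>v. v \<in> V \<Longrightarrow> f v \<le> q v"
    using Hahn_Banach_sublinear[OF q V] by blast
  have p0: "p 0 = 0" using sublinear_onD(2)[OF p, of 0 0] V by (simp add: subspace_0)
  show ?thesis
  proof
    show "f v \<le> p v" if "v \<in> V" for v
      using f(2)[OF that] qle[OF that W(2)] by simp
    show "0 \<le> f u + a" if "(u, a) \<in> W" for u a
    proof -
      have u: "u \<in> V" using W(1) that .
      then have "- f u \<le> q (- u)"
        using f(2)[of "- u"] linear_functional_on_minus[OF f(1) u] V by (simp add: subspace_neg)
      also have "\<dots> \<le> a" using qle[OF _ that, of "- u"] V u p0 by (simp add: subspace_neg)
      finally show ?thesis by simp
    qed
  qed (rule f(1))
qed

text \<open>The constraint ray through \<open>(y, - p y)\<close> asks for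
  \<open>f y \<ge> p y\<close>, the converse of the domination.\<close>

lemma Hahn_Banach_point:
  assumes p: "sublinear_on V p" and V: "subspace V" and y: "y \<in> V"
  obtains f where "linear_functional_on V f" "\<And>v. v \<in> V \<Longrightarrow> f v \<le> p v" "f y = p y"
proof -
  define W where "W = (\<lambda>t. (t *\<^sub>R y, - t * p y)) ` {0..}"
  obtain f where f: "linear_functional_on V f" "\<And>v. v \<in> V \<Longrightarrow> f v \<le> p v"
    and fW: "\<And>u a. (u, a) \<in> W \<Longrightarrow> 0 \<le> f u + a"
  proof (rule Hahn_Banach_cone[OF p V, where W = W])
    fix u a v b assume "(u, a) \<in> W" "(v, b) \<in> W"
    then obtain s t where st: "s \<ge> 0" "t \<ge> 0" "u = s *\<^sub>R y" "a = - s * p y" "v = t *\<^sub>R y" "b = - t * p y"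
      unfolding W_def by auto
    show "(u + v, a + b) \<in> W"
      unfolding W_def by (rule image_eqI[of _ _ "s + t"]) (use st in \<open>auto simp: algebra_simps\<close>)
  next
    fix u a and c :: real assume "(u, a) \<in> W" "c > 0"
    then obtain s where st: "s \<ge> 0" "u = s *\<^sub>R y" "a = - s * p y" "c > 0"
      unfolding W_def by auto
    show "(c *\<^sub>R u, c * a) \<in> W"
      unfolding W_def by (rule image_eqI[of _ _ "c * s"]) (use st in \<open>auto simp: algebra_simps\<close>)
  next
    fix u a assume "(u, a) \<in> W"
    then show "0 \<le> p u + a"
      unfolding W_def using sublinear_onD(2)[OF p y] by auto
  qed (use y V in \<open>auto simp: W_def subspace_mul intro!: image_eqI[of _ _ 0]\<close>)
  have "(y, - p y) \<in> W" unfolding W_def by (rule image_eqI[of _ _ 1]) auto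
  with fW f(2)[OF y] have "f y = p y" by force
  with f that show ?thesis by blast
qed

section \<open>Clarke directional derivatives\<close>

text \<open>Serves twice: with \<open>norm\<close> on all of the value space, for distance
  functions, and with \<open>Lp_norm\<close>, which is only a seminorm on functions.\<close>

locale seminorm_on =
  fixes V :: "'a::real_vector set" and N :: "'a \<Rightarrow> real"
  assumes V: "subspace V"
    and N_add: "u \<in> V \<Longrightarrow> v \<in> V \<Longrightarrow> N (u + v) \<le> N u + N v"
    and N_scale: "u \<in> V \<Longrightarrow> N (c *\<^sub>R u) = \<bar>c\<bar> * N u"
begin

lemma V_simps [simp]:
  "0 \<in> V" "u \<in> V \<Longrightarrow> v \<in> V \<Longrightarrow> u + v \<in> V" "u \<in> V \<Longrightarrow> - u \<in> V" "u \<in> V \<Longrightarrow> c *\<^sub>R u \<in> V"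
  "u \<in> V \<Longrightarrow> v \<in> V \<Longrightarrow> u - v \<in> V"
  using V by (auto simp: subspace_0 subspace_add subspace_neg subspace_mul subspace_diff)

lemma N_0 [simp]: "N 0 = 0"
  using N_scale[of 0 0] by simp

lemma N_minus: "u \<in> V \<Longrightarrow> N (- u) = N u"
  using N_scale[of u "-1"] by simp

lemma N_nonneg: "u \<in> V \<Longrightarrow> 0 \<le> N u"
  using N_add[of u "- u"] by (simp add: N_minus)

end

text \<open>The upper limit of the difference quotients, written as the infimum of their eventual
  upper bounds. This keeps the value real and avoids filters on a seminormed set; the factor
  \<open>\<eta>\<close> on the right replaces a division.\<close>

definition clarke_dd :: "'a::real_vector set \<Rightarrow> ('a \<Rightarrow> real) \<Rightarrow> ('a \<Rightarrow> real) \<Rightarrow> 'a \<Rightarrow> 'a \<Rightarrow> real" where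
  "clarke_dd V N f x v = Inf {c. \<exists>r>0. \<forall>y\<in>V. \<forall>\<eta>>0. N (y - x) < r \<longrightarrow> \<eta> < r \<longrightarrow>
     f (y + \<eta> *\<^sub>R v) - f y \<le> c * \<eta>}"

locale lipschitz_near = seminorm_on V N
  for V :: "'a::real_vector set" and N :: "'a \<Rightarrow> real" +
  fixes f :: "'a \<Rightarrow> real" and x :: 'a and r0 K :: real
  assumes x: "x \<in> V" and r0: "r0 > 0"
    and lipschitz: "y \<in> V \<Longrightarrow> z \<in> V \<Longrightarrow> N (y - x) < r0 \<Longrightarrow> N (z - x) < r0 \<Longrightarrow>
      \<bar>f y - f z\<bar> \<le> K * N (y - z)"
begin

lemma near_step:
  assumes v: "v \<in> V" and "R > 0"
  obtains r where "r > 0" "\<And>y \<eta>. y \<in> V \<Longrightarrow> N (y - x) < r \<Longrightarrow> 0 \<le> \<eta> \<Longrightarrow> \<eta> < r \<Longrightarrow> N (y + \<eta> *\<^sub>R v - x) < R"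
proof
  \<comment> \<open>Each of the two displacements takes at most half of \<open>R\<close>; the
    summand 1 covers directions with \<open>N v = 0\<close>.\<close>
  define r where "r = min (R / 2) (R / (2 * (N v + 1)))"
  have nv: "N v \<ge> 0" using N_nonneg v by simp
  show "r > 0" unfolding r_def using assms nv by simp
  fix y and \<eta> :: real assume y: "y \<in> V" "N (y - x) < r" and \<eta>: "0 \<le> \<eta>" "\<eta> < r"
  have "N (y + \<eta> *\<^sub>R v - x) \<le> N (y - x) + \<eta> * N v"
    using N_add[of "y - x" "\<eta> *\<^sub>R v"] N_scale[OF v, of \<eta>] y v x \<eta> by (simp add: algebra_simps)
  also have "\<eta> * N v \<le> R / (2 * (N v + 1)) * (N v + 1)"
    using \<eta> nv by (intro mult_mono) (auto simp: r_def)
  also have "\<dots> = R / 2" using nv by (simp add: field_simps)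
  finally show "N (y + \<eta> *\<^sub>R v - x) < R" using y(2) unfolding r_def by linarith
qed

text \<open>Testing at \<open>y = x\<close> bounds every admissible slope from below through the
  Lipschitz constant, so the infimum in \<open>clarke_dd\<close> is over a set bounded
  below.\<close>

lemma clarke_dd_lower:
  assumes v: "v \<in> V" and "r > 0"
    and c: "\<And>y \<eta>. y \<in> V \<Longrightarrow> \<eta> > 0 \<Longrightarrow> N (y - x) < r \<Longrightarrow> \<eta> < r \<Longrightarrow> f (y + \<eta> *\<^sub>R v) - f y \<le> c * \<eta>"
  shows "- K * N v \<le> c"
proof -
  obtain s where s: "s > 0" "\<And>y \<eta>. y \<in> V \<Longrightarrow> N (y - x) < s \<Longrightarrow> 0 \<le> \<eta> \<Longrightarrow> \<eta> < s \<Longrightarrow> N (y + \<eta> *\<^sub>R v - x) < r0"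
    using near_step[OF v r0] by blast
  define \<eta> where "\<eta> = min s r / 2"
  have \<eta>: "0 < \<eta>" "\<eta> < s" "\<eta> < r" unfolding \<eta>_def using s \<open>r > 0\<close> by auto
  have "\<bar>f (x + \<eta> *\<^sub>R v) - f x\<bar> \<le> K * N (x + \<eta> *\<^sub>R v - x)"
    using s(2)[of x \<eta>] x v \<eta> s(1) r0 by (intro lipschitz) auto
  also have "\<dots> = \<eta> * (K * N v)" using N_scale[OF v, of \<eta>] \<eta> by simp
  finally have "- (\<eta> * (K * N v)) \<le> c * \<eta>"
    using c[of x \<eta>] x \<eta> \<open>r > 0\<close> by simp
  then have "\<eta> * (- K * N v) \<le> \<eta> * c" by (simp add: algebra_simps)
  then show ?thesis using \<eta>(1) by (rule mult_left_le_imp_le)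
qed

lemma clarke_dd_le:
  assumes v: "v \<in> V" and "r > 0"
    and c: "\<And>y \<eta>. y \<in> V \<Longrightarrow> \<eta> > 0 \<Longrightarrow> N (y - x) < r \<Longrightarrow> \<eta> < r \<Longrightarrow> f (y + \<eta> *\<^sub>R v) - f y \<le> c * \<eta>"
  shows "clarke_dd V N f x v \<le> c"
  unfolding clarke_dd_def
proof (rule cInf_lower)
  show "bdd_below {c. \<exists>r>0. \<forall>y\<in>V. \<forall>\<eta>>0. N (y - x) < r \<longrightarrow> \<eta> < r \<longrightarrow> f (y + \<eta> *\<^sub>R v) - f y \<le> c * \<eta>}"
    by (rule bdd_belowI[of _ "- K * N v"]) (use clarke_dd_lower[OF v] in blast)
qed (use assms in blast)

lemma clarke_dd_bound:
  assumes v: "v \<in> V"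
  obtains r where "r > 0" "\<And>y \<eta>. y \<in> V \<Longrightarrow> \<eta> > 0 \<Longrightarrow> N (y - x) < r \<Longrightarrow> \<eta> < r \<Longrightarrow>
    f (y + \<eta> *\<^sub>R v) - f y \<le> (K * N v) * \<eta>"
proof -
  obtain s where s: "s > 0" "\<And>y \<eta>. y \<in> V \<Longrightarrow> N (y - x) < s \<Longrightarrow> 0 \<le> \<eta> \<Longrightarrow> \<eta> < s \<Longrightarrow> N (y + \<eta> *\<^sub>R v - x) < r0"
    using near_step[OF v r0] by blast
  show ?thesis
  proof (rule that[of "min s r0"])
    fix y and \<eta> :: real
    assume y: "y \<in> V" "\<eta> > 0" "N (y - x) < min s r0" "\<eta> < min s r0"
    have "\<bar>f (y + \<eta> *\<^sub>R v) - f y\<bar> \<le> K * N (y + \<eta> *\<^sub>R v - y)"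
      using s(2)[of y \<eta>] y v by (intro lipschitz) auto
    also have "\<dots> = (K * N v) * \<eta>" using N_scale[OF v, of \<eta>] y by simp
    finally show "f (y + \<eta> *\<^sub>R v) - f y \<le> (K * N v) * \<eta>" by simp
  qed (use s r0 in auto)
qed

lemma clarke_dd_lessD:
  assumes v: "v \<in> V" and less: "clarke_dd V N f x v < c"
  obtains r where "r > 0" "\<And>y \<eta>. y \<in> V \<Longrightarrow> \<eta> > 0 \<Longrightarrow> N (y - x) < r \<Longrightarrow> \<eta> < r \<Longrightarrow>
    f (y + \<eta> *\<^sub>R v) - f y \<le> c * \<eta>"
proof -
  let ?A = "{c. \<exists>r>0. \<forall>y\<in>V. \<forall>\<eta>>0. N (y - x) < r \<longrightarrow> \<eta> < r \<longrightarrow> f (y + \<eta> *\<^sub>R v) - f y \<le> c * \<eta>}"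
  obtain r where "r > 0" "\<And>y \<eta>. y \<in> V \<Longrightarrow> \<eta> > 0 \<Longrightarrow> N (y - x) < r \<Longrightarrow> \<eta> < r \<Longrightarrow>
    f (y + \<eta> *\<^sub>R v) - f y \<le> (K * N v) * \<eta>" using clarke_dd_bound[OF v] by blast
  then have "K * N v \<in> ?A" by blast
  then obtain c' where "c' \<in> ?A" "c' < c"
    using cInf_lessD[of ?A c] less unfolding clarke_dd_def by blast
  then obtain r where r: "r > 0" "\<And>y \<eta>. y \<in> V \<Longrightarrow> \<eta> > 0 \<Longrightarrow> N (y - x) < r \<Longrightarrow> \<eta> < r \<Longrightarrow>
    f (y + \<eta> *\<^sub>R v) - f y \<le> c' * \<eta>" by blast
  show ?thesis
  proof (rule that[OF r(1)])
    fix y and \<eta> :: real assume *: "y \<in> V" "\<eta> > 0" "N (y - x) < r" "\<eta> < r"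
    have "c' * \<eta> \<le> c * \<eta>" using * \<open>c' < c\<close> by simp
    with r(2)[OF *] show "f (y + \<eta> *\<^sub>R v) - f y \<le> c * \<eta>" by linarith
  qed
qed

lemma clarke_dd_le_norm: "v \<in> V \<Longrightarrow> clarke_dd V N f x v \<le> K * N v"
  by (rule clarke_dd_bound[of v]) (auto intro: clarke_dd_le)

text \<open>Subadditivity passes through the intermediate point
  \<open>y + \<eta> *\<^sub>R v\<close>. Since the base point varies in the definition, the
  increment along \<open>u\<close> may start there; a one-sided derivative at the fixed point
  \<open>x\<close> would not allow this.\<close>

lemma sublinear_on_clarke_dd: "sublinear_on V (clarke_dd V N f x)"
proof (rule sublinear_onI)
  fix u v assume uv: "u \<in> V" "v \<in> V"
  show "clarke_dd V N f x (u + v) \<le> clarke_dd V N f x u + clarke_dd V N f x v"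
  proof (rule field_le_epsilon)
    fix e :: real assume "e > 0"
    define a where "a = clarke_dd V N f x u + e / 2"
    define b where "b = clarke_dd V N f x v + e / 2"
    obtain r where r: "r > 0" "\<And>y \<eta>. y \<in> V \<Longrightarrow> \<eta> > 0 \<Longrightarrow> N (y - x) < r \<Longrightarrow> \<eta> < r \<Longrightarrow>
        f (y + \<eta> *\<^sub>R u) - f y \<le> a * \<eta>"
      using clarke_dd_lessD[OF uv(1), of a] \<open>e > 0\<close> unfolding a_def by auto
    obtain s where s: "s > 0" "\<And>y \<eta>. y \<in> V \<Longrightarrow> \<eta> > 0 \<Longrightarrow> N (y - x) < s \<Longrightarrow> \<eta> < s \<Longrightarrow>
        f (y + \<eta> *\<^sub>R v) - f y \<le> b * \<eta>"
      using clarke_dd_lessD[OF uv(2), of b] \<open>e > 0\<close> unfolding b_def by auto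
    obtain t where t: "t > 0" "\<And>y \<eta>. y \<in> V \<Longrightarrow> N (y - x) < t \<Longrightarrow> 0 \<le> \<eta> \<Longrightarrow> \<eta> < t \<Longrightarrow> N (y + \<eta> *\<^sub>R v - x) < r"
      using near_step[OF uv(2) r(1)] by blast
    have "clarke_dd V N f x (u + v) \<le> a + b"
    proof (rule clarke_dd_le)
      show "0 < min r (min s t)" using r s t by simp
      fix y and \<eta> :: real
      assume *: "y \<in> V" "\<eta> > 0" "N (y - x) < min r (min s t)" "\<eta> < min r (min s t)"
      have "f ((y + \<eta> *\<^sub>R v) + \<eta> *\<^sub>R u) - f (y + \<eta> *\<^sub>R v) \<le> a * \<eta>"
        using * uv t(2)[of y \<eta>] by (intro r) auto
      moreover have "f (y + \<eta> *\<^sub>R v) - f y \<le> b * \<eta>" using * by (intro s) auto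
      moreover have "(y + \<eta> *\<^sub>R v) + \<eta> *\<^sub>R u = y + \<eta> *\<^sub>R (u + v)"
        by (simp add: scaleR_add_right add_ac)
      ultimately show "f (y + \<eta> *\<^sub>R (u + v)) - f y \<le> (a + b) * \<eta>"
        by (simp add: distrib_right)
    qed (use uv in simp)
    then show "clarke_dd V N f x (u + v) \<le> clarke_dd V N f x u + clarke_dd V N f x v + e"
      unfolding a_def b_def by simp
  qed
next
  have "clarke_dd V N f x 0 \<le> 0" using clarke_dd_le_norm[of 0] by simp
  moreover have "0 \<le> c" if c: "clarke_dd V N f x 0 < c" for c
  proof -
    obtain r where "r > 0" "\<And>y \<eta>. y \<in> V \<Longrightarrow> \<eta> > 0 \<Longrightarrow> N (y - x) < r \<Longrightarrow> \<eta> < r \<Longrightarrow>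
        f (y + \<eta> *\<^sub>R 0) - f y \<le> c * \<eta>"
      using clarke_dd_lessD[OF _ c] by (metis V_simps(1))
    then show ?thesis using clarke_dd_lower[of 0 r c] by simp
  qed
  ultimately show "clarke_dd V N f x 0 = 0"
    by (meson dense_le antisym leI less_le_not_le dense)
next
  fix v and k :: real assume v: "v \<in> V" and k: "k > 0"
  show "clarke_dd V N f x (k *\<^sub>R v) \<le> k * clarke_dd V N f x v"
  proof (rule dense_ge)
    fix c assume "k * clarke_dd V N f x v < c"
    then have "clarke_dd V N f x v < c / k" using k by (simp add: field_simps)
    then obtain r where r: "r > 0" "\<And>y \<eta>. y \<in> V \<Longrightarrow> \<eta> > 0 \<Longrightarrow> N (y - x) < r \<Longrightarrow> \<eta> < r \<Longrightarrow>
        f (y + \<eta> *\<^sub>R v) - f y \<le> c / k * \<eta>" using clarke_dd_lessD[OF v] by blast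
    show "clarke_dd V N f x (k *\<^sub>R v) \<le> c"
    proof (rule clarke_dd_le)
      show "0 < min r (r / k)" using r k by simp
      fix y and \<eta> :: real
      assume *: "y \<in> V" "\<eta> > 0" "N (y - x) < min r (r / k)" "\<eta> < min r (r / k)"
      have "f (y + (\<eta> * k) *\<^sub>R v) - f y \<le> c / k * (\<eta> * k)"
        using * k by (intro r) (auto simp: field_simps)
      then show "f (y + \<eta> *\<^sub>R k *\<^sub>R v) - f y \<le> c * \<eta>" using k by simp
    qed (use v in simp)
  qed
qed auto

end

section \<open>Distance functions: directional derivatives, tangent directions,
  measurability\<close>

definition dist_dd :: "'z::real_normed_vector set \<Rightarrow> 'z \<Rightarrow> 'z \<Rightarrow> real" where
  "dist_dd C x = clarke_dd UNIV norm (\<lambda>y. infdist y C) x"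

interpretation dist_dd: lipschitz_near UNIV norm "\<lambda>y. infdist y C" x 1 1
  for C :: "'z::real_normed_vector set" and x
  by standard (auto simp: norm_triangle_ineq dist_norm[symmetric] infdist_triangle_abs)

lemma sublinear_on_dist_dd: "sublinear_on UNIV (dist_dd C x)"
  unfolding dist_dd_def by (rule dist_dd.sublinear_on_clarke_dd)

lemma dist_dd_le_norm: "dist_dd C x v \<le> norm v"
  unfolding dist_dd_def using dist_dd.clarke_dd_le_norm[of v C x] by simp

lemma infdist_less_iff:
  assumes "C \<noteq> {}"
  shows "infdist z C < a \<longleftrightarrow> (\<exists>s\<in>C. dist z s < a)"
proof
  assume "infdist z C < a"
  then show "\<exists>s\<in>C. dist z s < a"
    using assms cInf_lessD[of "dist z ` C" a] by (auto simp: infdist_notempty)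
qed (meson infdist_le le_less_trans)

text \<open>A point \<open>y\<close> near \<open>x\<close> need not lie in \<open>C\<close>, so the
  tangent condition is applied at a nearly nearest point \<open>c\<close> of \<open>C\<close>.
  Moving \<open>c\<close> along \<open>v\<close> costs at most \<open>\<eta> * e / 2\<close>, and
  the choice of \<open>c\<close> costs the other half.\<close>

lemma clarke_tangent_cone_dist_dd:
  fixes C :: "'z::real_normed_vector set"
  assumes x: "x \<in> C" and v: "v \<in> clarke_tangent_cone C x"
  shows "dist_dd C x v \<le> 0"
proof (rule field_le_epsilon)
  fix e :: real assume e: "e > 0"
  obtain \<delta> l where \<delta>: "\<delta> > 0" and l: "l > 0" and
    tan: "\<And>y \<eta>. y \<in> C \<Longrightarrow> dist x y \<le> \<delta> \<Longrightarrow> 0 \<le> \<eta> \<Longrightarrow> \<eta> \<le> l \<Longrightarrow>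
      C \<inter> (\<lambda>b. y + \<eta> *\<^sub>R (v + (e / 2) *\<^sub>R b)) ` cball 0 1 \<noteq> {}"
    using v e unfolding clarke_tangent_cone_def
    by (auto dest!: spec[of _ "e / 2"])
  have "clarke_dd UNIV norm (\<lambda>y. infdist y C) x v \<le> e"
  proof (rule dist_dd.clarke_dd_le)
    \<comment> \<open>As \<open>x\<close> lies in \<open>C\<close>, the distance from
      \<open>x\<close> to \<open>c\<close> is at most \<open>2 * dist x y + \<eta> * e\<close>; this
      radius keeps it within \<open>\<delta>\<close>.\<close>
    show "0 < min l (\<delta> / (2 + e))" using l \<delta> e by simp
    fix y and \<eta> :: real
    assume *: "\<eta> > 0" "norm (y - x) < min l (\<delta> / (2 + e))" "\<eta> < min l (\<delta> / (2 + e))"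
    have "infdist y C < infdist y C + \<eta> * e / 2" using * e by simp
    then obtain c where c: "c \<in> C" "dist y c < infdist y C + \<eta> * e / 2"
      using infdist_less_iff[of C y] x by blast
    have "dist x c \<le> dist x y + dist y c" by (rule dist_triangle)
    also have "\<dots> \<le> 2 * dist x y + \<eta> * e"
      using c(2) infdist_le[OF x, of y] mult_pos_pos[OF *(1) e] by (simp add: dist_commute)
    also have "\<dots> \<le> 2 * (\<delta> / (2 + e)) + (\<delta> / (2 + e)) * e"
      using * e by (intro add_mono mult_mono) (auto simp: dist_norm norm_minus_commute)
    also have "\<dots> = (2 + e) * (\<delta> / (2 + e))" by (simp only: distrib_right mult.commute)
    also have "\<dots> = \<delta>" using e by simp
    finally obtain b where b: "norm b \<le> 1" "c + \<eta> *\<^sub>R (v + (e / 2) *\<^sub>R b) \<in> C"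
      using tan[OF c(1), of \<eta>] * by auto
    have "infdist (y + \<eta> *\<^sub>R v) C \<le> norm ((y - c) - (\<eta> * (e / 2)) *\<^sub>R b)"
      using infdist_le[OF b(2), of "y + \<eta> *\<^sub>R v"] by (simp add: dist_norm algebra_simps)
    also have "\<dots> \<le> dist y c + (\<eta> * (e / 2)) * norm b"
      using norm_triangle_ineq4[of "y - c" "(\<eta> * (e / 2)) *\<^sub>R b"] * e by (simp add: dist_norm)
    also have "(\<eta> * (e / 2)) * norm b \<le> \<eta> * (e / 2) * 1" using b * e by (intro mult_left_mono) auto
    finally show "infdist (y + \<eta> *\<^sub>R v) C - infdist y C \<le> e * \<eta>" using c(2) by (simp add: mult.commute)
  qed simp
  then show "dist_dd C x v \<le> 0 + e" by (simp add: dist_dd_def)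
qed

text \<open>For a fixed point the sublevel sets are those where \<open>S t\<close> meets a ball. A
  moving point is reduced to countably many fixed ones, since the distance is 1-Lipschitz.\<close>

lemma borel_measurable_infdist:
  fixes S :: "'t \<Rightarrow> 'z::{real_normed_vector, second_countable_topology} set"
  assumes S: "measurable_multifunction M S" and ne: "\<And>t. t \<in> space M \<Longrightarrow> S t \<noteq> {}"
    and u [measurable]: "u \<in> borel_measurable M"
  shows "(\<lambda>t. infdist (u t) (S t)) \<in> borel_measurable M"
proof -
  have const [measurable]: "(\<lambda>t. infdist z (S t)) \<in> borel_measurable M" for z
  proof (rule borel_measurableI_less)
    fix a
    have "{t \<in> space M. infdist z (S t) < a} = {t \<in> space M. S t \<inter> ball z a \<noteq> {}}"
      by (rule Collect_cong) (auto simp: infdist_less_iff[OF ne] disjoint_iff)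
    with S show "{t \<in> space M. infdist z (S t) < a} \<in> sets M"
      unfolding measurable_multifunction_def by auto
  qed
  obtain D :: "'z set" where D: "countable D" "\<And>X. open X \<Longrightarrow> X \<noteq> {} \<Longrightarrow> \<exists>d\<in>D. d \<in> X"
    using countable_dense_setE by blast
  show ?thesis
  proof (rule borel_measurableI_less)
    fix a
    have "(infdist (u t) (S t) < a) \<longleftrightarrow> (\<exists>k\<in>D. infdist k (S t) + dist k (u t) < a)" for t
    proof
      assume *: "infdist (u t) (S t) < a"
      then obtain k where k: "k \<in> D" "dist (u t) k < (a - infdist (u t) (S t)) / 2"
        using D(2)[of "ball (u t) ((a - infdist (u t) (S t)) / 2)"] by auto
      have "infdist k (S t) \<le> infdist (u t) (S t) + dist k (u t)" by (rule infdist_triangle)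
      with k show "\<exists>k\<in>D. infdist k (S t) + dist k (u t) < a"
        by (intro bexI[of _ k]) (auto simp: dist_commute field_simps)
    next
      assume "\<exists>k\<in>D. infdist k (S t) + dist k (u t) < a"
      then show "infdist (u t) (S t) < a"
        using infdist_triangle[of "u t" "S t"] by (metis dist_commute le_less_trans)
    qed
    then have "{t \<in> space M. infdist (u t) (S t) < a} =
        (\<Union>k\<in>D. {t \<in> space M. infdist k (S t) + dist k (u t) < a})" by auto
    also have "\<dots> \<in> sets M" by (intro sets.countable_UN'' D) measurable
    finally show "{t \<in> space M. infdist (u t) (S t) < a} \<in> sets M" .
  qed
qed

text \<open>For a fixed slope \<open>q\<close> the bound is a closed condition in
  \<open>(w, \<eta>)\<close>, so it may be tested on a dense set; rational \<open>q < a\<close> and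
  the radii \<open>1 / Suc n\<close> make the other quantifiers countable. The shift
  \<open>w = y - x\<close> keeps \<open>D\<close> independent of the base point.\<close>

lemma dist_dd_less_iff:
  assumes D: "\<And>X. open X \<Longrightarrow> X \<noteq> {} \<Longrightarrow> \<exists>d\<in>D. d \<in> X"
  shows "dist_dd C x v < a \<longleftrightarrow> (\<exists>q\<in>\<rat>. q < a \<and> (\<exists>n. \<forall>(w, \<eta>)\<in>D. norm w < 1 / Suc n \<longrightarrow> 0 < \<eta> \<longrightarrow> \<eta> < 1 / Suc n \<longrightarrow>
    infdist (x + w + \<eta> *\<^sub>R v) C - infdist (x + w) C \<le> q * \<eta>))" (is "_ \<longleftrightarrow> ?R")
proof
  assume "dist_dd C x v < a"
  then obtain q where q: "q \<in> \<rat>" "dist_dd C x v < q" "q < a" using Rats_dense_in_real by blast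
  obtain r where r: "r > 0" "\<And>y \<eta>. \<eta> > 0 \<Longrightarrow> norm (y - x) < r \<Longrightarrow> \<eta> < r \<Longrightarrow>
      infdist (y + \<eta> *\<^sub>R v) C - infdist y C \<le> q * \<eta>"
    using dist_dd.clarke_dd_lessD[of v C x q] q(2) unfolding dist_dd_def by auto
  obtain n where "1 / Suc n < r" using nat_approx_posE[OF r(1)] by blast
  with r(2)[of _ "x + _"] q show ?R by (intro bexI[of _ q] conjI exI[of _ n]) auto
next
  assume ?R
  then obtain q n where q: "q < a" and n: "\<And>w \<eta>. (w, \<eta>) \<in> D \<Longrightarrow> norm w < 1 / Suc n \<Longrightarrow> 0 < \<eta> \<Longrightarrow>
    \<eta> < 1 / Suc n \<Longrightarrow> infdist (x + w + \<eta> *\<^sub>R v) C - infdist (x + w) C \<le> q * \<eta>" by blast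
  have "dist_dd C x v \<le> q"
    unfolding dist_dd_def
  proof (rule dist_dd.clarke_dd_le)
    show "0 < 1 / real (Suc n)" by simp
    fix y and \<eta> :: real assume y: "0 < \<eta>" "norm (y - x) < 1 / Suc n" "\<eta> < 1 / Suc n"
    show "infdist (y + \<eta> *\<^sub>R v) C - infdist y C \<le> q * \<eta>"
    proof (rule ccontr)
      assume *: "\<not> ?thesis"
      \<comment> \<open>The points of the open region where the bound fails form an open set, which
        would have to meet \<open>D\<close>.\<close>
      define X where "X = (ball 0 (1 / Suc n) \<times> {0<..<1 / Suc n}) \<inter>
        {wh. infdist (x + fst wh + snd wh *\<^sub>R v) C - infdist (x + fst wh) C > q * snd wh}"
      have "open X" unfolding X_def
        by (intro open_Int open_Times open_Collect_less continuous_intros) auto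
      moreover have "(y - x, \<eta>) \<in> X" using * y by (auto simp: X_def dist_norm norm_minus_commute)
      ultimately obtain w h where "(w, h) \<in> D" "(w, h) \<in> X" using D[of X] by fastforce
      with n[of w h] show False by (auto simp: X_def)
    qed
  qed simp
  with q show "dist_dd C x v < a" by simp
qed

lemma borel_measurable_dist_dd:
  fixes S :: "'t \<Rightarrow> 'z::{real_normed_vector, second_countable_topology} set"
  assumes S: "measurable_multifunction M S" and ne: "\<And>t. t \<in> space M \<Longrightarrow> S t \<noteq> {}"
    and [measurable]: "u \<in> borel_measurable M" "v \<in> borel_measurable M"
  shows "(\<lambda>t. dist_dd (S t) (u t) (v t)) \<in> borel_measurable M"
proof (rule borel_measurableI_less)
  fix a
  note borel_measurable_infdist[OF S ne, measurable]
  obtain D :: "('z \<times> real) set" where D: "countable D" "\<And>X. open X \<Longrightarrow> X \<noteq> {} \<Longrightarrow> \<exists>d\<in>D. d \<in> X"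
    using countable_dense_setE by blast
  have "{t \<in> space M. dist_dd (S t) (u t) (v t) < a} = {t \<in> space M.
    \<exists>q\<in>\<rat>. q < a \<and> (\<exists>n. \<forall>wh\<in>D. norm (fst wh) < 1 / Suc n \<longrightarrow> 0 < snd wh \<longrightarrow> snd wh < 1 / Suc n \<longrightarrow>
    infdist (u t + fst wh + snd wh *\<^sub>R v t) (S t) - infdist (u t + fst wh) (S t) \<le> q * snd wh)}"
    by (subst dist_dd_less_iff[OF D(2)]) (auto simp: case_prod_unfold)
  also have "\<dots> \<in> sets M"
    using D(1) countable_rat by measurable
  finally show "{t \<in> space M. dist_dd (S t) (u t) (v t) < a} \<in> sets M" .
qed

section \<open>Measurable selections and Lebesgue--Bochner spaces\<close>

text \<open>Values come from a countable dense set, and the least suitable index is measurable in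
  \<open>t\<close>. A suitable one exists because a point of \<open>S t\<close> within
  \<open>r t\<close> of \<open>u t\<close> can be approximated so closely that both tolerances
  hold.\<close>

lemma measurable_selection_step:
  fixes S :: "'t \<Rightarrow> 'z::{real_normed_vector, second_countable_topology} set"
  assumes S: "measurable_multifunction M S" and ne: "\<And>t. t \<in> space M \<Longrightarrow> S t \<noteq> {}"
    and [measurable]: "u \<in> borel_measurable M" "r \<in> borel_measurable M" "\<delta> \<in> borel_measurable M"
    and r: "\<And>t. t \<in> space M \<Longrightarrow> infdist (u t) (S t) < r t"
    and \<delta>: "\<And>t. t \<in> space M \<Longrightarrow> 0 < \<delta> t"
  obtains u' where "u' \<in> borel_measurable M"
    and "\<And>t. t \<in> space M \<Longrightarrow> infdist (u' t) (S t) < \<delta> t"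
    and "\<And>t. t \<in> space M \<Longrightarrow> dist (u t) (u' t) < r t"
proof -
  note borel_measurable_infdist[OF S ne, measurable]
  obtain D :: "'z set" where D: "countable D" "\<And>X. open X \<Longrightarrow> X \<noteq> {} \<Longrightarrow> \<exists>d\<in>D. d \<in> X"
    using countable_dense_setE by blast
  have "D \<noteq> {}" using D(2)[of UNIV] by auto
  then have range: "range (from_nat_into D) = D" using D(1) by (simp add: range_from_nat_into)
  define P where "P = (\<lambda>k t. infdist (from_nat_into D k) (S t) < \<delta> t \<and> dist (u t) (from_nat_into D k) < r t)"
  have [measurable]: "Measurable.pred M (P k)" for k unfolding P_def by measurable
  define K where "K = (\<lambda>t. LEAST k. P k t)"
  have [measurable]: "K \<in> measurable M (count_space UNIV)" unfolding K_def by measurable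
  have K: "P (K t) t" if t: "t \<in> space M" for t
  proof -
    obtain s where s: "s \<in> S t" "dist (u t) s < r t" using r[OF t] infdist_less_iff[OF ne[OF t]] by blast
    define e where "e = min (\<delta> t) (r t - dist (u t) s)"
    have "e > 0" unfolding e_def using \<delta>[OF t] s by simp
    then obtain d where d: "d \<in> D" "dist s d < e" using D(2)[of "ball s e"] by auto
    then obtain k where k: "d = from_nat_into D k" using range by blast
    have "infdist d (S t) \<le> dist d s" by (rule infdist_le[OF s(1)])
    moreover have "dist (u t) d \<le> dist (u t) s + dist s d" by (rule dist_triangle)
    ultimately have "P k t" unfolding P_def using d(2) k e_def by (auto simp: dist_commute)
    then show ?thesis unfolding K_def by (rule LeastI)
  qed
  show ?thesis
    by (rule that[of "\<lambda>t. from_nat_into D (K t)"]) (use K in \<open>auto simp: P_def\<close>)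
qed

text \<open>Successive approximations as in the Kuratowski--Ryll-Nardzewski theorem.\<close>

lemma measurable_selection_near:
  fixes S :: "'t \<Rightarrow> 'z::{banach, second_countable_topology} set"
  assumes S: "measurable_multifunction M S" and ne: "\<And>t. t \<in> space M \<Longrightarrow> S t \<noteq> {}"
    and cl: "\<And>t. t \<in> space M \<Longrightarrow> closed (S t)"
    and [measurable]: "u \<in> borel_measurable M" "\<epsilon> \<in> borel_measurable M"
    and \<epsilon>: "\<And>t. t \<in> space M \<Longrightarrow> 0 < \<epsilon> t"
  obtains y where "y \<in> borel_measurable M" "\<And>t. t \<in> space M \<Longrightarrow> y t \<in> S t"
    and "\<And>t. t \<in> space M \<Longrightarrow> norm (u t - y t) \<le> infdist (u t) (S t) + \<epsilon> t"
proof -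
  note borel_measurable_infdist[OF S ne, measurable]
  \<comment> \<open>These tolerances sum to \<open>\<epsilon> t / 2\<close>; the other half is spent
    on the first approximation \<open>w\<close>.\<close>
  define e where "e = (\<lambda>n t. \<epsilon> t / 4 * (1 / 2) ^ n)"
  have [measurable]: "e n \<in> borel_measurable M" for n unfolding e_def by measurable
  have e: "0 < e n t" if "t \<in> space M" for n t unfolding e_def using \<epsilon>[OF that] by simp
  obtain w where w: "w \<in> borel_measurable M" "\<And>t. t \<in> space M \<Longrightarrow> infdist (w t) (S t) < e 0 t"
    "\<And>t. t \<in> space M \<Longrightarrow> dist (u t) (w t) < infdist (u t) (S t) + \<epsilon> t / 2"
    by (rule measurable_selection_step[OF S ne, where u = u and \<delta> = "e 0"
          and r = "\<lambda>t. infdist (u t) (S t) + \<epsilon> t / 2"]) (use e \<epsilon> in auto)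
  \<comment> \<open>The clause for \<open>n = 0\<close> records the starting function, whose
    distance to \<open>u\<close> is controlled separately.\<close>
  have "\<exists>a. \<forall>n. (a n \<in> borel_measurable M \<and> (\<forall>t\<in>space M. infdist (a n t) (S t) < e n t) \<and> (n = 0 \<longrightarrow> a n = w)) \<and>
      (\<forall>t\<in>space M. dist (a n t) (a (Suc n) t) < e n t)"
  proof (rule dependent_nat_choice)
    show "\<exists>a. a \<in> borel_measurable M \<and> (\<forall>t\<in>space M. infdist (a t) (S t) < e 0 t) \<and> (0 = 0 \<longrightarrow> a = w)"
      for n :: nat using w by auto
    fix a n
    assume "a \<in> borel_measurable M \<and> (\<forall>t\<in>space M. infdist (a t) (S t) < e n t) \<and> (n = 0 \<longrightarrow> a = w)"
    then have a: "a \<in> borel_measurable M" "\<And>t. t \<in> space M \<Longrightarrow> infdist (a t) (S t) < e n t" by auto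
    obtain b where "b \<in> borel_measurable M" "\<And>t. t \<in> space M \<Longrightarrow> infdist (b t) (S t) < e (Suc n) t"
      "\<And>t. t \<in> space M \<Longrightarrow> dist (a t) (b t) < e n t"
      by (rule measurable_selection_step[OF S ne a(1), where r = "e n" and \<delta> = "e (Suc n)"])
        (use a e in auto)
    then show "\<exists>b. (b \<in> borel_measurable M \<and> (\<forall>t\<in>space M. infdist (b t) (S t) < e (Suc n) t) \<and> (Suc n = 0 \<longrightarrow> b = w)) \<and>
      (\<forall>t\<in>space M. dist (a t) (b t) < e n t)" by blast
  qed
  then obtain a where a [measurable]: "\<And>n. a n \<in> borel_measurable M"
    and a_inf: "\<And>n t. t \<in> space M \<Longrightarrow> infdist (a n t) (S t) < e n t"
    and a0: "a 0 = w"
    and a_step: "\<And>n t. t \<in> space M \<Longrightarrow> dist (a n t) (a (Suc n) t) < e n t" by metis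
  have lim: "(\<lambda>n. a n t) \<longlonglongrightarrow> lim (\<lambda>n. a n t)" (is ?L)
    and near: "norm (w t - lim (\<lambda>n. a n t)) \<le> \<epsilon> t / 2" (is ?N) if t: "t \<in> space M" for t
  proof -
    define b where "b = (\<lambda>n. a (Suc n) t - a n t)"
    have nb: "norm (b n) \<le> e n t" for n
      using a_step[OF t, of n] unfolding b_def by (simp add: dist_norm norm_minus_commute)
    have e_sums: "(\<lambda>n. e n t) sums (\<epsilon> t / 4 * (1 / (1 - 1 / 2)))"
      unfolding e_def by (intro sums_mult geometric_sums) simp
    then have e_summable: "summable (\<lambda>n. e n t)" by (simp add: sums_iff)
    have nsum: "summable (\<lambda>n. norm (b n))"
      by (rule summable_comparison_test[OF _ e_summable]) (use nb in auto)
    then have "summable b" by (rule summable_norm_cancel)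
    then have "(\<lambda>n. (\<Sum>i<n. b i) + a 0 t) \<longlonglongrightarrow> suminf b + a 0 t"
      by (intro tendsto_add summable_LIMSEQ tendsto_const)
    moreover have "(\<Sum>i<n. b i) + a 0 t = a n t" for n
      unfolding b_def by (subst sum_lessThan_telescope) simp
    ultimately have L: "(\<lambda>n. a n t) \<longlonglongrightarrow> suminf b + a 0 t" by simp
    then show ?L by (simp add: limI)
    have "norm (suminf b) \<le> (\<Sum>n. norm (b n))" by (rule summable_norm[OF nsum])
    also have "\<dots> \<le> (\<Sum>n. e n t)" by (rule suminf_le[OF nb nsum e_summable])
    also have "\<dots> = \<epsilon> t / 2" using e_sums by (simp add: sums_iff)
    finally show ?N using limI[OF L] a0 by simp
  qed
  show ?thesis
  proof (rule that[of "\<lambda>t. lim (\<lambda>n. a n t)"])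
    fix t assume t: "t \<in> space M"
    have "(\<lambda>n. e n t) \<longlonglongrightarrow> \<epsilon> t / 4 * 0"
      unfolding e_def by (intro tendsto_mult tendsto_const LIMSEQ_power_zero) simp
    then have "infdist (lim (\<lambda>n. a n t)) (S t) \<le> 0"
      by (intro LIMSEQ_le[OF tendsto_infdist[OF lim[OF t]]]) (use a_inf[OF t] in \<open>auto intro: less_imp_le\<close>)
    then have "infdist (lim (\<lambda>n. a n t)) (S t) = 0" using infdist_nonneg by (rule antisym)
    then show "lim (\<lambda>n. a n t) \<in> S t"
      using in_closed_iff_infdist_zero[OF cl[OF t] ne[OF t]] by simp
    have "norm (u t - lim (\<lambda>n. a n t)) \<le> norm (u t - w t) + norm (w t - lim (\<lambda>n. a n t))"
      using norm_triangle_ineq[of "u t - w t" "w t - lim (\<lambda>n. a n t)"] by simp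
    then show "norm (u t - lim (\<lambda>n. a n t)) \<le> infdist (u t) (S t) + \<epsilon> t"
      using w(3)[OF t] near[OF t] by (simp add: dist_norm)
  qed measurable
qed

section \<open>The seminorm of the Lebesgue-Bochner space\<close>

lemma powr_convex_nonneg:
  fixes a b s t r :: real
  assumes "0 \<le> a" "0 \<le> b" "0 < s" "0 < t" "s + t = 1" "1 \<le> r"
  shows "(s * a + t * b) powr r \<le> s * a powr r + t * b powr r"
proof -
  have scale: "(c * x) powr r \<le> c * x powr r" if "0 < c" "c \<le> 1" "0 \<le> x" for c x :: real
  proof -
    have "c powr r \<le> c powr 1" using that \<open>1 \<le> r\<close> by (intro powr_mono') auto
    then show ?thesis using that by (simp add: powr_mult mult_right_mono)
  qed
  consider "a = 0" | "b = 0" | "0 < a" "0 < b" using assms by linarith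
  then show ?thesis
  proof cases
    case 1
    then show ?thesis using scale[of t b] assms by simp
  next
    case 2
    then show ?thesis using scale[of s a] assms by simp
  next
    case 3
    then show ?thesis
      using convex_onD[OF powr_convex[OF \<open>1 \<le> r\<close>], of t a b] assms by (simp add: eq_diff_eq[symmetric])
  qed
qed

locale Lp_exponent = sigma_finite_measure M for M :: "'t measure" +
  fixes p :: ennreal
  assumes p_ge_1: "1 \<le> p" and p_finite: "p < \<infinity>"
begin

definition r :: real where "r = enn2real p"

lemma r_ge_1: "1 \<le> r"
  unfolding r_def using enn2real_mono[of 1 p] p_ge_1 p_finite by simp

lemma r_pos: "0 < r" and r_nonzero [simp]: "r \<noteq> 0"
  using r_ge_1 by auto

lemma mem_Lp: "f \<in> Lp M p \<longleftrightarrow> f \<in> borel_measurable M \<and> integrable M (\<lambda>t. norm (f t) powr r)"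
  using p_finite by (auto simp: Lp_def r_def)

lemma Lp_measurable [measurable_dest]: "f \<in> Lp M p \<Longrightarrow> f \<in> borel_measurable M"
  and Lp_integrable: "f \<in> Lp M p \<Longrightarrow> integrable M (\<lambda>t. norm (f t) powr r)"
  by (auto simp: mem_Lp)

lemma Lp_norm_eq: "Lp_norm M p f = (\<integral>t. norm (f t) powr r \<partial>M) powr (1 / r)"
  using p_finite by (auto simp: Lp_norm_def r_def)

lemma Lp_norm_nonneg [simp]: "0 \<le> Lp_norm M p f"
  by (simp add: Lp_norm_eq)

lemma Lp_norm_powr: "Lp_norm M p f powr r = (\<integral>t. norm (f t) powr r \<partial>M)"
  unfolding Lp_norm_eq by (simp add: powr_powr Bochner_Integration.integral_nonneg)

lemma Lp_norm_leI:
  assumes "0 \<le> c" "(\<integral>t. norm (f t) powr r \<partial>M) \<le> c powr r"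
  shows "Lp_norm M p f \<le> c"
proof -
  have "Lp_norm M p f \<le> (c powr r) powr (1 / r)"
    unfolding Lp_norm_eq using assms r_pos by (intro powr_mono2) auto
  also have "\<dots> = c" using assms by (simp add: powr_powr)
  finally show ?thesis .
qed

lemma Lp_dominated:
  fixes f :: "'t \<Rightarrow> 'z::real_normed_vector" and g :: "'t \<Rightarrow> 'y::real_normed_vector"
  assumes "f \<in> borel_measurable M" "g \<in> Lp M p" "AE t in M. norm (f t) \<le> norm (g t)"
  shows "f \<in> Lp M p" "Lp_norm M p f \<le> Lp_norm M p g"
proof -
  have *: "AE t in M. norm (f t) powr r \<le> norm (g t) powr r"
    using assms(3) by eventually_elim (use r_pos in \<open>auto intro!: powr_mono2\<close>)
  have "integrable M (\<lambda>t. norm (f t) powr r)"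
    by (rule Bochner_Integration.integrable_bound[OF Lp_integrable[OF assms(2)]])
      (use * assms(1) in auto)
  with assms(1) show "f \<in> Lp M p" by (simp add: mem_Lp)
  show "Lp_norm M p f \<le> Lp_norm M p g"
    unfolding Lp_norm_eq using * r_pos
    by (intro powr_mono2 integral_mono_AE Lp_integrable \<open>f \<in> Lp M p\<close> assms(2)) (auto intro: integral_nonneg_AE)
qed

lemma Lp_norm_scale: "Lp_norm M p (c *\<^sub>R f) = \<bar>c\<bar> * Lp_norm M p f"
proof -
  have "(\<integral>t. norm ((c *\<^sub>R f) t) powr r \<partial>M) = \<bar>c\<bar> powr r * (\<integral>t. norm (f t) powr r \<partial>M)"
    by (simp add: powr_mult)
  then show ?thesis
    by (simp add: Lp_norm_eq powr_mult powr_powr)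
qed

lemma Lp_scale: "f \<in> Lp M p \<Longrightarrow> c *\<^sub>R f \<in> Lp M p"
  by (auto simp: mem_Lp powr_mult scaleR_fun_def)

text \<open>Minkowski's inequality by convexity of the power: the sum is \<open>A + B\<close> times
  the convex combination of \<open>f / A\<close> and \<open>g / B\<close> with weights
  \<open>A / (A + B)\<close> and \<open>B / (A + B)\<close>. Strict upper bounds in place of the
  norms avoid division by zero.\<close>

lemma Lp_add_norm_less:
  fixes f g :: "'t \<Rightarrow> 'z::{real_normed_vector, second_countable_topology}"
  assumes f: "f \<in> Lp M p" and g: "g \<in> Lp M p" and A: "Lp_norm M p f < A" and B: "Lp_norm M p g < B"
  shows "f + g \<in> Lp M p" "Lp_norm M p (f + g) \<le> A + B"
proof -
  have A0: "0 < A" and B0: "0 < B"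
    using A B by (auto intro: le_less_trans[OF Lp_norm_nonneg])
  note [measurable] = Lp_measurable[OF f] Lp_measurable[OF g]
  let ?h = "\<lambda>t. (A + B) powr r * (A / (A + B) * (norm (f t) powr r / A powr r) + B / (A + B) * (norm (g t) powr r / B powr r))"
  have bound: "norm ((f + g) t) powr r \<le> ?h t" for t
  proof -
    have "norm ((f + g) t) \<le> (A + B) * (A / (A + B) * (norm (f t) / A) + B / (A + B) * (norm (g t) / B))"
      using A0 B0 norm_triangle_ineq[of "f t" "g t"] by (simp add: distrib_left)
    then have "norm ((f + g) t) powr r \<le> ((A + B) * (A / (A + B) * (norm (f t) / A) + B / (A + B) * (norm (g t) / B))) powr r"
      using r_pos by (intro powr_mono2) auto
    also have "\<dots> = (A + B) powr r * (A / (A + B) * (norm (f t) / A) + B / (A + B) * (norm (g t) / B)) powr r"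
      by (rule powr_mult)
    also have "(A / (A + B) * (norm (f t) / A) + B / (A + B) * (norm (g t) / B)) powr r \<le>
        A / (A + B) * (norm (f t) / A) powr r + B / (A + B) * (norm (g t) / B) powr r"
      using A0 B0 r_ge_1 by (intro powr_convex_nonneg) (auto simp: add_divide_distrib[symmetric])
    finally show ?thesis
      using A0 B0 by (simp add: powr_divide mult_left_mono)
  qed
  have int: "integrable M ?h"
    using Lp_integrable[OF f] Lp_integrable[OF g] by (intro integrable_mult_right integrable_add integrable_divide) auto
  have int': "integrable M (\<lambda>t. norm ((f + g) t) powr r)"
    by (rule Bochner_Integration.integrable_bound[OF int]) (use bound in \<open>auto intro: order_trans[OF _ abs_ge_self]\<close>)
  then show "f + g \<in> Lp M p" by (simp add: mem_Lp plus_fun_def)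
  have le1: "(\<integral>t. norm (k t) powr r \<partial>M) / C powr r \<le> 1" if "Lp_norm M p k < C"
    for k :: "'t \<Rightarrow> 'z" and C
  proof -
    have "(\<integral>t. norm (k t) powr r \<partial>M) \<le> C powr r"
      unfolding Lp_norm_powr[symmetric] using that r_pos by (intro powr_mono2) auto
    then show ?thesis using le_less_trans[OF Lp_norm_nonneg that] by (simp add: divide_le_eq)
  qed
  have "(\<integral>t. norm ((f + g) t) powr r \<partial>M) \<le> (\<integral>t. ?h t \<partial>M)"
    using int' int bound by (intro integral_mono) auto
  also have "\<dots> = (A + B) powr r * (A / (A + B) * ((\<integral>t. norm (f t) powr r \<partial>M) / A powr r)
      + B / (A + B) * ((\<integral>t. norm (g t) powr r \<partial>M) / B powr r))"
    using Lp_integrable[OF f] Lp_integrable[OF g] by simp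
  also have "\<dots> \<le> (A + B) powr r * (A / (A + B) * 1 + B / (A + B) * 1)"
    using A0 B0 A B by (intro mult_left_mono add_mono le1) auto
  also have "\<dots> = (A + B) powr r" using A0 B0 by (simp add: add_divide_distrib[symmetric])
  finally show "Lp_norm M p (f + g) \<le> A + B" using A0 B0 by (intro Lp_norm_leI) auto
qed

lemma seminorm_on_Lp:
  "seminorm_on (Lp M p :: ('t \<Rightarrow> 'z::{real_normed_vector, second_countable_topology}) set) (Lp_norm M p)"
proof
  have add: "f + g \<in> Lp M p" if "f \<in> Lp M p" "g \<in> Lp M p" for f g :: "'t \<Rightarrow> 'z"
    using Lp_add_norm_less(1)[OF that, of "Lp_norm M p f + 1" "Lp_norm M p g + 1"] by simp
  have zero: "(0 :: 't \<Rightarrow> 'z) \<in> Lp M p" by (simp add: mem_Lp zero_fun_def)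
  show "subspace (Lp M p :: ('t \<Rightarrow> 'z) set)"
    unfolding subspace_def using add Lp_scale zero by blast
  show "Lp_norm M p (f + g) \<le> Lp_norm M p f + Lp_norm M p g"
    if "f \<in> Lp M p" "g \<in> Lp M p" for f g :: "'t \<Rightarrow> 'z"
  proof (rule field_le_epsilon)
    fix e :: real assume "e > 0"
    then show "Lp_norm M p (f + g) \<le> Lp_norm M p f + Lp_norm M p g + e"
      using Lp_add_norm_less(2)[OF that, of "Lp_norm M p f + e / 2" "Lp_norm M p g + e / 2"] by simp
  qed
qed (rule Lp_norm_scale)

sublocale Lp: seminorm_on
  "Lp M p :: ('t \<Rightarrow> 'z::{real_normed_vector, second_countable_topology}) set" "Lp_norm M p"
  by (rule seminorm_on_Lp)

lemma Lp_norm_tendsto_0: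
  fixes f :: "nat \<Rightarrow> 't \<Rightarrow> 'z::real_normed_vector" and g :: "'t \<Rightarrow> 'y::real_normed_vector"
  assumes f: "\<And>n. f n \<in> borel_measurable M" and g: "g \<in> Lp M p"
    and bound: "\<And>n. AE t in M. norm (f n t) \<le> norm (g t)"
    and lim: "AE t in M. (\<lambda>n. f n t) \<longlonglongrightarrow> 0"
  shows "(\<lambda>n. Lp_norm M p (f n)) \<longlonglongrightarrow> 0"
proof -
  have "(\<lambda>n. \<integral>t. norm (f n t) powr r \<partial>M) \<longlonglongrightarrow> (\<integral>t. 0 \<partial>M)"
  proof (rule integral_dominated_convergence[OF _ _ Lp_integrable[OF g]])
    show "AE t in M. (\<lambda>n. norm (f n t) powr r) \<longlonglongrightarrow> 0"
      using lim
    proof eventually_elim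
      case (elim t)
      then have "(\<lambda>n. norm (f n t)) \<longlonglongrightarrow> 0" by (rule tendsto_norm_zero)
      then have "(\<lambda>n. norm (f n t) powr r) \<longlonglongrightarrow> 0 powr r"
        by (rule tendsto_powr2) (use r_pos in auto)
      then show ?case by simp
    qed
    show "AE t in M. norm (norm (f n t) powr r) \<le> norm (g t) powr r" for n
      using bound[of n] by eventually_elim (use r_pos in \<open>auto intro!: powr_mono2\<close>)
  qed (use f in auto)
  then have "(\<lambda>n. (\<integral>t. norm (f n t) powr r \<partial>M) powr (1 / r)) \<longlonglongrightarrow> 0 powr (1 / r)"
    by (intro tendsto_powr2) (use r_pos in \<open>auto intro: integral_nonneg_AE\<close>)
  then show ?thesis by (simp add: Lp_norm_eq)
qed

text \<open>On a sigma-finite space nonzero constants need not belong to L^p. This function replaces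
  them: as an error tolerance, as a weight on sets, and as a test function when cut down to a given
  set.\<close>

lemma obtain_positive_Lp_function:
  obtains \<rho> :: "'t \<Rightarrow> real" where "\<rho> \<in> borel_measurable M" "\<And>t. 0 < \<rho> t" "\<rho> \<in> Lp M p"
proof -
  obtain h :: "'t \<Rightarrow> real" where h: "h \<in> borel_measurable M" "\<And>t. 0 < h t" "\<And>t. h t \<le> 1" "integrable M h"
    by (rule obtain_positive_integrable_function) (rule that)
  show ?thesis
  proof (rule that[of "\<lambda>t. h t powr (1 / r)"])
    have "(h t powr (1 / r)) powr r = h t" for t using h(2)[of t] by (simp add: powr_powr)
    then show "(\<lambda>t. h t powr (1 / r)) \<in> Lp M p" using h by (simp add: mem_Lp)
  qed (use h in \<open>auto simp: less_imp_neq[symmetric]\<close>)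
qed

section \<open>Comparison with the Clarke derivative on L^p, and exact penalization\<close>

lemma clarke_dd_le_clarke_derivative:
  fixes F :: "('t \<Rightarrow> 'z::{real_normed_vector, second_countable_topology}) \<Rightarrow> real"
  assumes "lipschitz_near (Lp M p) (Lp_norm M p) F x r0 K" and v: "v \<in> Lp M p"
  shows "ereal (clarke_dd (Lp M p) (Lp_norm M p) F x v) \<le> clarke_derivative M p F x v"
proof -
  interpret lipschitz_near "Lp M p" "Lp_norm M p" F x r0 K by fact
  let ?G = "\<lambda>(y, \<eta>). ereal ((F (\<lambda>t. y t + \<eta> *\<^sub>R v t) - F y) / \<eta>)"
  show ?thesis
    unfolding clarke_derivative_def
  proof (rule dense_ge)
    fix c assume "Limsup (Lp_nhds M p x \<times>\<^sub>F at_right 0) ?G < c"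
    then have "eventually (\<lambda>z. ?G z < c) (Lp_nhds M p x \<times>\<^sub>F at_right 0)" by (rule Limsup_lessD)
    then obtain P Q where P: "eventually P (Lp_nhds M p x)" and Q: "eventually Q (at_right (0::real))"
      and PQ: "\<And>y \<eta>. P y \<Longrightarrow> Q \<eta> \<Longrightarrow> ?G (y, \<eta>) < c"
      unfolding eventually_prod_filter by blast
    have "\<exists>s\<in>{0<..}. eventually P (principal {y \<in> Lp M p. Lp_dist M p y x < s})"
      using P unfolding Lp_nhds_def
    proof (subst (asm) eventually_INF_base)
      fix a b :: real assume "a \<in> {0<..}" "b \<in> {0<..}"
      then show "\<exists>s\<in>{0<..}. principal {y \<in> Lp M p. Lp_dist M p y x < s} \<le>
          inf (principal {y \<in> Lp M p. Lp_dist M p y x < a}) (principal {y \<in> Lp M p. Lp_dist M p y x < b})"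
        by (intro bexI[of _ "min a b"]) auto
    qed auto
    then obtain s where s: "s > 0" "\<And>y. y \<in> Lp M p \<Longrightarrow> Lp_norm M p (y - x) < s \<Longrightarrow> P y"
      by (auto simp: eventually_principal Lp_dist_def fun_diff_def)
    obtain b where b: "b > 0" "\<And>\<eta>. 0 < \<eta> \<Longrightarrow> \<eta> < b \<Longrightarrow> Q \<eta>"
      using Q by (auto simp: eventually_at_right_field)
    have step: "ereal ((F (y + \<eta> *\<^sub>R v) - F y) / \<eta>) < c"
      if "y \<in> Lp M p" "0 < \<eta>" "Lp_norm M p (y - x) < min s b" "\<eta> < min s b" for y \<eta>
      using PQ[OF s(2)[of y] b(2)[of \<eta>]] that by (simp add: plus_fun_def scaleR_fun_def)
    show "ereal (clarke_dd (Lp M p) (Lp_norm M p) F x v) \<le> c"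
    proof (cases c)
      case (real c')
      have "clarke_dd (Lp M p) (Lp_norm M p) F x v \<le> c'"
      proof (rule clarke_dd_le[OF v])
        show "0 < min s b" using s b by simp
        show "F (y + \<eta> *\<^sub>R v) - F y \<le> c' * \<eta>"
          if "y \<in> Lp M p" "0 < \<eta>" "Lp_norm M p (y - x) < min s b" "\<eta> < min s b" for y \<eta>
          using step[OF that] that(2) real by (simp add: field_simps)
      qed
      with real show ?thesis by simp
    next
      \<comment> \<open>The difference quotient at \<open>x\<close> is a real number and cannot lie
        below minus infinity.\<close>
      case MInf
      obtain \<eta> where "0 < \<eta>" "\<eta> < min s b" using dense[of 0 "min s b"] s(1) b(1) by auto
      with MInf show ?thesis using step[of x \<eta>] s(1) b(1) x by simp
    qed simp
  qed
qed

text \<open>\<open>h\<close> is an arbitrary majorant because the later separation ranges over all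
  of them. The selections \<open>y n\<close> are feasible, so minimality bounds
  \<open>F (y n)\<close> from below, and the Lipschitz constant pays for their distance from
  \<open>u n\<close>.\<close>

lemma clarke_derivative_penalized_nonneg:
  fixes S :: "'t \<Rightarrow> 'z::{banach, second_countable_topology} set"
  assumes S: "measurable_multifunction M S" and ne: "\<And>t. t \<in> space M \<Longrightarrow> S t \<noteq> {}"
    and cl: "\<And>t. t \<in> space M \<Longrightarrow> closed (S t)"
    and F: "lipschitz_near (Lp M p) (Lp_norm M p) F x r0 K" and K: "0 \<le> K"
    and xS: "x \<in> Sel M p S" and min: "local_minimizer_Lp M p F (Sel M p S) x"
    and v: "v \<in> Lp M p" and h: "h \<in> Lp M p"
    and le_h: "\<And>t. max 0 (dist_dd (S t) (x t) (v t)) \<le> h t"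
  shows "0 \<le> clarke_dd (Lp M p) (Lp_norm M p) F x v + K * Lp_norm M p h"
proof -
  interpret lipschitz_near "Lp M p" "Lp_norm M p" F x r0 K by fact
  note borel_measurable_infdist[OF S ne, measurable]
  obtain \<rho> :: "'t \<Rightarrow> real" where \<rho>: "\<And>t. 0 < \<rho> t" "\<rho> \<in> Lp M p"
    using obtain_positive_Lp_function by blast
  note [measurable] = Lp_measurable[OF v] Lp_measurable[OF h] Lp_measurable[OF x] Lp_measurable[OF \<rho>(2)]
  obtain r1 where r1: "r1 > 0" "\<And>y. y \<in> Sel M p S \<Longrightarrow> Lp_norm M p (y - x) < r1 \<Longrightarrow> F x \<le> F y"
    using min unfolding local_minimizer_Lp_def Lp_dist_def by (auto simp: fun_diff_def)
  define \<eta> where "\<eta> = (\<lambda>n. 1 / real (Suc n))"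
  have \<eta>: "0 < \<eta> n" for n unfolding \<eta>_def by simp
  have \<eta>_lim: "\<eta> \<longlonglongrightarrow> 0" unfolding \<eta>_def by (rule LIMSEQ_inverse_real_of_nat[unfolded inverse_eq_divide])
  define u where "u = (\<lambda>n. x + \<eta> n *\<^sub>R v)"
  have u: "u n \<in> Lp M p" for n unfolding u_def using x v by simp
  note [measurable] = Lp_measurable[OF u]
  define d where "d = (\<lambda>n t. infdist (u n t) (S t) / \<eta> n)"
  have [measurable]: "d n \<in> borel_measurable M" for n unfolding d_def by measurable
  have d_nonneg: "0 \<le> d n t" for n t unfolding d_def using \<eta>[of n] by (simp add: infdist_nonneg)
  \<comment> \<open>The selection tolerance \<open>\<eta> n * \<eta> n * \<rho> t\<close> still
    tends to 0 after division by the step \<open>\<eta> n\<close>.\<close>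
  have "\<exists>y. y \<in> borel_measurable M \<and> (\<forall>t\<in>space M. y t \<in> S t \<and> norm (u n t - y t) \<le> \<eta> n * (d n t + \<eta> n * \<rho> t))" for n
  proof -
    obtain y where "y \<in> borel_measurable M" "\<And>t. t \<in> space M \<Longrightarrow> y t \<in> S t"
      "\<And>t. t \<in> space M \<Longrightarrow> norm (u n t - y t) \<le> infdist (u n t) (S t) + \<eta> n * \<eta> n * \<rho> t"
      by (rule measurable_selection_near[OF S ne cl, where u = "u n" and \<epsilon> = "\<lambda>t. \<eta> n * \<eta> n * \<rho> t"])
        (use \<eta>[of n] \<rho> in auto)
    moreover have "\<eta> n * (d n t + \<eta> n * \<rho> t) = infdist (u n t) (S t) + \<eta> n * \<eta> n * \<rho> t" for t
      unfolding d_def using \<eta>[of n] by (simp add: field_simps)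
    ultimately show ?thesis by auto
  qed
  then obtain y where y_meas [measurable]: "\<And>n. y n \<in> borel_measurable M"
    and yS: "\<And>n t. t \<in> space M \<Longrightarrow> y n t \<in> S t"
    and uy: "\<And>n t. t \<in> space M \<Longrightarrow> norm (u n t - y n t) \<le> \<eta> n * (d n t + \<eta> n * \<rho> t)" by metis
  \<comment> \<open>The part of the scaled distance \<open>d n\<close> that \<open>h\<close> does
    not cover, plus the scaled selection error.\<close>
  define k where "k = (\<lambda>n t. max (d n t - h t) 0 + \<eta> n * \<rho> t)"
  have [measurable]: "k n \<in> borel_measurable M" for n unfolding k_def by measurable
  have AE_x: "AE t in M. x t \<in> S t" using xS unfolding Sel_def by auto
  have h_nonneg: "0 \<le> h t" for t using le_h[of t] by simp
  have k_bound: "AE t in M. norm (k n t) \<le> norm (norm (v t) + \<rho> t)" for n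
    using AE_x
  proof eventually_elim
    case (elim t)
    \<comment> \<open>As \<open>x t\<close> lies in \<open>S t\<close>, the distance is at most the
      length of the step; this is the source of the integrable majorant.\<close>
    have "infdist (u n t) (S t) \<le> \<eta> n * norm (v t)"
      using infdist_le[OF elim, of "u n t"] \<eta>[of n] unfolding u_def by (simp add: dist_norm)
    then have "d n t \<le> norm (v t)" unfolding d_def using \<eta>[of n] by (simp add: field_simps)
    moreover have "\<eta> n * \<rho> t \<le> \<rho> t" using mult_right_mono[of "\<eta> n" 1 "\<rho> t"] \<rho>(1)[of t] by (simp add: \<eta>_def)
    moreover have "0 \<le> \<eta> n * \<rho> t" using \<rho>(1)[of t] \<eta>[of n] by simp
    ultimately show ?case
      using h_nonneg[of t] \<rho>(1)[of t] norm_ge_zero[of "v t"] unfolding k_def real_norm_def by linarith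
  qed
  have "(\<lambda>t. norm (v t)) \<in> Lp M p" by (rule Lp_dominated(1)[OF _ v]) auto
  then have "(\<lambda>t. norm (v t)) + \<rho> \<in> Lp M p" using \<rho>(2) by simp
  then have v\<rho>: "(\<lambda>t. norm (v t) + \<rho> t) \<in> Lp M p" by (simp add: plus_fun_def)
  have k_Lp: "k n \<in> Lp M p" for n by (rule Lp_dominated(1)[OF _ v\<rho> k_bound]) measurable
  have k_lim: "(\<lambda>n. Lp_norm M p (k n)) \<longlonglongrightarrow> 0"
  proof (rule Lp_norm_tendsto_0[OF _ v\<rho> k_bound])
    show "AE t in M. (\<lambda>n. k n t) \<longlonglongrightarrow> 0"
      using AE_x
    proof eventually_elim
      case (elim t)
      have "(\<lambda>n. max (d n t - h t) 0) \<longlonglongrightarrow> 0"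
      proof (rule LIMSEQ_I)
        fix e :: real assume "e > 0"
        then have "dist_dd (S t) (x t) (v t) < h t + e / 2" using le_h[of t] by simp
        \<comment> \<open>Taken at the base point \<open>x t\<close>, where the distance is 0, the
          slope bound says that \<open>d n t\<close> is eventually at most
          \<open>h t + e / 2\<close>.\<close>
        then obtain R where R: "R > 0" "\<And>y \<eta>. \<eta> > 0 \<Longrightarrow> norm (y - x t) < R \<Longrightarrow> \<eta> < R \<Longrightarrow>
            infdist (y + \<eta> *\<^sub>R v t) (S t) - infdist y (S t) \<le> (h t + e / 2) * \<eta>"
          using dist_dd.clarke_dd_lessD[of "v t" "S t" "x t"] unfolding dist_dd_def by auto
        obtain N where N: "\<And>n. n \<ge> N \<Longrightarrow> \<eta> n < R"
          using order_tendstoD(2)[OF \<eta>_lim R(1)] unfolding eventually_sequentially by auto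
        have "norm (max (d n t - h t) 0 - 0) < e" if "n \<ge> N" for n
        proof -
          have "infdist (u n t) (S t) \<le> (h t + e / 2) * \<eta> n"
            using R(2)[of "\<eta> n" "x t"] N[OF that] \<eta>[of n] R(1) elim unfolding u_def by simp
          then have "d n t \<le> h t + e / 2" unfolding d_def using \<eta>[of n] by (simp add: field_simps)
          then show ?thesis using \<open>e > 0\<close> by (auto simp: max_def)
        qed
        then show "\<exists>N. \<forall>n\<ge>N. norm (max (d n t - h t) 0 - 0) < e" by blast
      qed
      moreover have "(\<lambda>n. \<eta> n * \<rho> t) \<longlonglongrightarrow> 0 * \<rho> t" by (intro tendsto_mult \<eta>_lim tendsto_const)
      ultimately have "(\<lambda>n. k n t) \<longlonglongrightarrow> 0 + 0 * \<rho> t" unfolding k_def by (rule tendsto_add)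
      then show ?case by simp
    qed
  qed measurable
  define B where "B = (\<lambda>n. Lp_norm M p h + Lp_norm M p (k n))"
  have B: "B \<longlonglongrightarrow> Lp_norm M p h + 0" unfolding B_def by (intro tendsto_add tendsto_const k_lim)
  have uy_le: "AE t in M. norm ((u n - y n) t) \<le> norm ((\<eta> n *\<^sub>R (h + k n)) t)" for n
  proof (rule AE_I2)
    fix t assume t: "t \<in> space M"
    have "d n t + \<eta> n * \<rho> t \<le> h t + k n t" unfolding k_def by simp
    then have "\<eta> n * (d n t + \<eta> n * \<rho> t) \<le> \<eta> n * (h t + k n t)" using \<eta>[of n] by simp
    also have "\<dots> \<le> norm (\<eta> n * (h t + k n t))" by simp
    finally show "norm ((u n - y n) t) \<le> norm ((\<eta> n *\<^sub>R (h + k n)) t)" using uy[OF t, of n] by simp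
  qed
  have hk: "\<eta> n *\<^sub>R (h + k n) \<in> Lp M p" for n using h k_Lp by simp
  have uy_Lp: "u n - y n \<in> Lp M p" for n
    by (rule Lp_dominated(1)[OF _ hk uy_le]) (simp add: fun_diff_def)
  have uy_norm: "Lp_norm M p (u n - y n) \<le> \<eta> n * B n" for n
  proof -
    have "Lp_norm M p (u n - y n) \<le> Lp_norm M p (\<eta> n *\<^sub>R (h + k n))"
      by (rule Lp_dominated(2)[OF _ hk uy_le]) (simp add: fun_diff_def)
    also have "\<dots> \<le> \<eta> n * B n"
      unfolding Lp_norm_scale B_def using \<eta>[of n] Lp.N_add[OF h k_Lp] by (simp add: mult_left_mono)
    finally show ?thesis .
  qed
  have y_Lp: "y n \<in> Lp M p" for n
    using Lp.V_simps(5)[OF u[of n] uy_Lp[of n]] by simp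
  have ySel: "y n \<in> Sel M p S" for n
    unfolding Sel_def using y_Lp yS by auto
  show ?thesis
  proof (rule field_le_epsilon)
    fix e :: real assume "e > 0"
    define c where "c = clarke_dd (Lp M p) (Lp_norm M p) F x v + e"
    obtain R where R: "R > 0" "\<And>y \<eta>. y \<in> Lp M p \<Longrightarrow> \<eta> > 0 \<Longrightarrow> Lp_norm M p (y - x) < R \<Longrightarrow> \<eta> < R \<Longrightarrow>
        F (y + \<eta> *\<^sub>R v) - F y \<le> c * \<eta>"
      using clarke_dd_lessD[OF v, of c] \<open>e > 0\<close> unfolding c_def by auto
    have ux: "Lp_norm M p (u n - x) = \<eta> n * Lp_norm M p v" for n
      unfolding u_def using Lp_norm_scale[of "\<eta> n" v] \<eta>[of n] by simp
    have yx: "Lp_norm M p (y n - x) \<le> \<eta> n * (B n + Lp_norm M p v)" for n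
    proof -
      have "Lp_norm M p (y n - x) \<le> Lp_norm M p (y n - u n) + Lp_norm M p (u n - x)"
        using Lp.N_add[of "y n - u n" "u n - x"] y_Lp u x by simp
      moreover have "Lp_norm M p (y n - u n) = Lp_norm M p (u n - y n)"
        using Lp.N_minus[OF uy_Lp[of n]] by simp
      ultimately show ?thesis using uy_norm[of n] ux[of n] by (simp add: distrib_left)
    qed
    have "(\<lambda>n. \<eta> n * (B n + Lp_norm M p v)) \<longlonglongrightarrow> 0 * (Lp_norm M p h + 0 + Lp_norm M p v)"
      by (intro tendsto_mult tendsto_add \<eta>_lim B tendsto_const)
    moreover have "0 < min r0 r1" using r0 r1 by simp
    ultimately have ev1: "\<forall>\<^sub>F n in sequentially. \<eta> n * (B n + Lp_norm M p v) < min r0 r1"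
      by (intro order_tendstoD(2)) auto
    have ev2: "\<forall>\<^sub>F n in sequentially. \<eta> n < R" using order_tendstoD(2)[OF \<eta>_lim R(1)] .
    have "\<forall>\<^sub>F n in sequentially. 0 \<le> c + K * B n"
      using ev1 ev2
    proof eventually_elim
      case (elim n)
      have Bn: "0 \<le> B n" unfolding B_def by simp
      have "Lp_norm M p (u n - x) \<le> \<eta> n * (B n + Lp_norm M p v)"
        unfolding ux using \<eta>[of n] Bn by (intro mult_left_mono) auto
      then have "\<bar>F (y n) - F (u n)\<bar> \<le> K * Lp_norm M p (y n - u n)"
        using elim yx[of n] by (intro lipschitz y_Lp u) auto
      also have "\<dots> \<le> K * (\<eta> n * B n)"
        using Lp.N_minus[OF uy_Lp[of n]] uy_norm[of n] K by (intro mult_left_mono) auto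
      finally have "F (y n) \<le> F (u n) + K * (\<eta> n * B n)" by simp
      \<comment> \<open>With minimality \<open>F x\<close> cancels, and what remains can be divided
        by \<open>\<eta> n\<close>.\<close>
      moreover have "F x \<le> F (y n)" using yx[of n] elim by (intro r1 ySel) auto
      moreover have "F (u n) - F x \<le> c * \<eta> n"
        unfolding u_def using R(2)[of x "\<eta> n"] x \<eta>[of n] elim R(1) by simp
      ultimately have "0 \<le> c * \<eta> n + K * (\<eta> n * B n)" by simp
      also have "\<dots> = \<eta> n * (c + K * B n)" by (simp add: algebra_simps)
      finally show ?case using \<eta>[of n] by (simp add: zero_le_mult_iff)
    qed
    moreover have "(\<lambda>n. c + K * B n) \<longlonglongrightarrow> c + K * (Lp_norm M p h + 0)"
      by (intro tendsto_add tendsto_mult tendsto_const B)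
    ultimately have "0 \<le> c + K * (Lp_norm M p h + 0)"
      by (intro tendsto_lowerbound[where F = sequentially]) auto
    then show "0 \<le> clarke_dd (Lp M p) (Lp_norm M p) F x v + K * Lp_norm M p h + e"
      unfolding c_def by simp
  qed
qed

end

section \<open>Densities of positive functionals\<close>

context Lp_exponent
begin

text \<open>The weight makes the set function \<open>m\<close> defined and finite on all measurable
  sets, also on those of infinite measure. The norm bound gives continuity at the empty set, hence
  countable additivity, and sends null sets to null sets, so Radon-Nikodym applies.\<close>

lemma positive_functional_finite_measure:
  fixes \<Lambda> :: "('t \<Rightarrow> real) \<Rightarrow> real" and \<rho> :: "'t \<Rightarrow> real"
  assumes \<Lambda>: "linear_functional_on (Lp M p) \<Lambda>"
    and pos: "\<And>f. f \<in> Lp M p \<Longrightarrow> (\<And>t. 0 \<le> f t) \<Longrightarrow> 0 \<le> \<Lambda> f"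
    and bound: "\<And>f. f \<in> Lp M p \<Longrightarrow> \<Lambda> f \<le> C * Lp_norm M p f"
    and \<rho>: "\<And>t. 0 \<le> \<rho> t" "\<rho> \<in> Lp M p"
  obtains D where "D \<in> borel_measurable M" "\<And>t. 0 \<le> D t"
    and "\<And>A. A \<in> sets M \<Longrightarrow> integrable M (\<lambda>t. D t * indicator A t)"
    and "\<And>A. A \<in> sets M \<Longrightarrow> \<Lambda> (\<lambda>t. \<rho> t * indicator A t) = (\<integral>t. D t * indicator A t \<partial>M)"
proof -
  note [measurable] = Lp_measurable[OF \<rho>(2)]
  define m where "m = (\<lambda>A. \<Lambda> (\<lambda>t. \<rho> t * indicator A t))"
  have ind: "(\<lambda>t. \<rho> t * indicator A t) \<in> Lp M p" if [measurable]: "A \<in> sets M" for A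
    by (rule Lp_dominated(1)[OF _ \<rho>(2)]) (auto simp: indicator_def)
  have m_nonneg: "0 \<le> m A" if "A \<in> sets M" for A
    unfolding m_def using \<rho>(1) by (intro pos ind that) auto
  have m_add: "m (A \<union> B) = m A + m B" if "A \<in> sets M" "B \<in> sets M" "A \<inter> B = {}" for A B
  proof -
    have "(\<lambda>t. \<rho> t * indicator (A \<union> B) t) = (\<lambda>t. \<rho> t * indicator A t) + (\<lambda>t. \<rho> t * indicator B t)"
      using that(3) by (auto simp: plus_fun_def indicator_def fun_eq_iff)
    then show ?thesis
      unfolding m_def using linear_functional_onD(1)[OF \<Lambda> ind[OF that(1)] ind[OF that(2)]] by simp
  qed
  have m_cont: "(\<lambda>n. m (A n)) \<longlonglongrightarrow> 0" if A: "range A \<subseteq> sets M" "decseq A" "(\<Inter>i. A i) = {}" for A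
  proof -
    have [measurable]: "A n \<in> sets M" for n using A(1) by auto
    have "(\<lambda>n. Lp_norm M p (\<lambda>t. \<rho> t * indicator (A n) t)) \<longlonglongrightarrow> 0"
    proof (rule Lp_norm_tendsto_0[OF _ \<rho>(2)])
      show "AE t in M. (\<lambda>n. \<rho> t * indicator (A n) t) \<longlonglongrightarrow> 0"
      proof (rule AE_I2)
        fix t
        have "(\<lambda>n. indicator (A n) t :: real) \<longlonglongrightarrow> indicator (\<Inter>i. A i) t"
          using LIMSEQ_indicator_decseq[OF A(2)] .
        then have "(\<lambda>n. \<rho> t * indicator (A n) t) \<longlonglongrightarrow> \<rho> t * 0"
          unfolding A(3) by (intro tendsto_mult tendsto_const) simp
        then show "(\<lambda>n. \<rho> t * indicator (A n) t) \<longlonglongrightarrow> 0" by simp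
      qed
    qed (auto simp: indicator_def)
    then have "(\<lambda>n. C * Lp_norm M p (\<lambda>t. \<rho> t * indicator (A n) t)) \<longlonglongrightarrow> 0"
      by (rule tendsto_mult_right_zero)
    moreover have "m (A n) \<le> C * Lp_norm M p (\<lambda>t. \<rho> t * indicator (A n) t)" for n
      unfolding m_def by (rule bound[OF ind]) simp
    ultimately show ?thesis
      by (intro tendsto_sandwich[where f = "\<lambda>_. 0" and g = "\<lambda>n. m (A n)"] tendsto_const)
        (auto intro!: always_eventually m_nonneg)
  qed
  define N where "N = measure_of (space M) (sets M) (\<lambda>A. ennreal (m A))"
  have sets_N [simp]: "sets N = sets M" unfolding N_def by simp
  have m_empty: "m {} = 0" using m_add[of "{}" "{}"] by simp
  have posi: "positive (sets M) (\<lambda>A. ennreal (m A))" by (simp add: positive_def m_empty)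
  have ca: "countably_additive (sets M) (\<lambda>A. ennreal (m A))"
  proof (rule sets.empty_continuous_imp_countably_additive[OF posi])
    show "additive (sets M) (\<lambda>A. ennreal (m A))"
      unfolding additive_def using m_add m_nonneg by (auto simp: ennreal_plus)
    show "(\<lambda>i. ennreal (m (A i))) \<longlonglongrightarrow> 0" if "range A \<subseteq> sets M" "decseq A" "(\<Inter>i. A i) = {}" for A
      using tendsto_ennrealI[OF m_cont[OF that]] by simp
  qed simp
  have N: "emeasure N A = ennreal (m A)" if "A \<in> sets M" for A
    unfolding N_def using that by (intro emeasure_measure_of_sigma posi ca sets.sigma_algebra_axioms)
  have fin: "finite_measure N"
    by (rule finite_measureI) (simp add: N sets_eq_imp_space_eq[OF sets_N])
  have ac: "absolutely_continuous M N"
  proof (unfold absolutely_continuous_def, rule subsetI)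
    fix A assume A: "A \<in> null_sets M"
    then have AM: "A \<in> sets M" by auto
    have "Lp_norm M p (\<lambda>t. \<rho> t * indicator A t) \<le> Lp_norm M p (0 :: 't \<Rightarrow> real)"
      using AE_not_in[OF A] AM by (intro Lp_dominated(2)) (auto elim!: eventually_mono)
    then have "Lp_norm M p (\<lambda>t. \<rho> t * indicator A t) = 0"
      using Lp_norm_nonneg[of "\<lambda>t. \<rho> t * indicator A t"] by simp
    then have "m A \<le> 0" unfolding m_def using bound[OF ind[OF AM]] by simp
    then show "A \<in> null_sets N" using AM N[OF AM] by (simp add: null_sets_def ennreal_eq_0_iff)
  qed
  obtain D where D [measurable]: "D \<in> borel_measurable M" and RN: "AE t in M. RN_deriv M N t = ennreal (D t)"
    and D0: "\<And>t. 0 \<le> D t"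
    using real_RN_deriv[OF fin ac sets_N] by blast
  have emeasure_eq: "(\<integral>\<^sup>+t. ennreal (D t * indicator A t) \<partial>M) = ennreal (m A)" if [measurable]: "A \<in> sets M" for A
  proof -
    have "ennreal (m A) = emeasure (density M (RN_deriv M N)) A"
      using N[OF that] density_RN_deriv[OF ac sets_N] by simp
    also have "\<dots> = (\<integral>\<^sup>+t. RN_deriv M N t * indicator A t \<partial>M)" by (intro emeasure_density) auto
    also have "\<dots> = (\<integral>\<^sup>+t. ennreal (D t * indicator A t) \<partial>M)"
      using RN by (intro nn_integral_cong_AE) (auto elim!: eventually_mono simp: indicator_def)
    finally show ?thesis by simp
  qed
  show ?thesis
  proof (rule that[OF D D0])
    fix A assume [measurable]: "A \<in> sets M"
    have "has_bochner_integral M (\<lambda>t. D t * indicator A t) (m A)"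
      using emeasure_eq[of A] m_nonneg[of A] D0 by (intro has_bochner_integral_nn_integral) auto
    then show "integrable M (\<lambda>t. D t * indicator A t)"
      "\<Lambda> (\<lambda>t. \<rho> t * indicator A t) = (\<integral>t. D t * indicator A t \<partial>M)"
      by (auto simp: has_bochner_integral_iff m_def)
  qed
qed

text \<open>The density is \<open>D / \<rho>\<close>. The identity moves from indicators to
  nonnegative functions by monotone approximation, along which \<open>\<Lambda>\<close> is
  continuous, and then to all functions by positive and negative parts.\<close>

lemma positive_functional_density:
  fixes \<Lambda> :: "('t \<Rightarrow> real) \<Rightarrow> real"
  assumes \<Lambda>: "linear_functional_on (Lp M p) \<Lambda>"
    and pos: "\<And>f. f \<in> Lp M p \<Longrightarrow> (\<And>t. 0 \<le> f t) \<Longrightarrow> 0 \<le> \<Lambda> f"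
    and bound: "\<And>f. f \<in> Lp M p \<Longrightarrow> \<Lambda> f \<le> C * Lp_norm M p f"
  obtains g where "g \<in> borel_measurable M" "\<And>t. 0 \<le> g t"
    and "\<And>f. f \<in> Lp M p \<Longrightarrow> integrable M (\<lambda>t. g t * f t)"
    and "\<And>f. f \<in> Lp M p \<Longrightarrow> \<Lambda> f = (\<integral>t. g t * f t \<partial>M)"
proof -
  obtain \<rho> :: "'t \<Rightarrow> real" where \<rho>: "\<And>t. 0 < \<rho> t" "\<rho> \<in> Lp M p"
    using obtain_positive_Lp_function by blast
  note [measurable] = Lp_measurable[OF \<rho>(2)]
  obtain D where D [measurable]: "D \<in> borel_measurable M" and D0: "\<And>t. 0 \<le> D t"
    and Dint: "\<And>A. A \<in> sets M \<Longrightarrow> integrable M (\<lambda>t. D t * indicator A t)"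
    and Deq: "\<And>A. A \<in> sets M \<Longrightarrow> \<Lambda> (\<lambda>t. \<rho> t * indicator A t) = (\<integral>t. D t * indicator A t \<partial>M)"
    by (rule positive_functional_finite_measure[OF \<Lambda> pos bound less_imp_le[OF \<rho>(1)] \<rho>(2)])
      (assumption | rule that)+
  have weight_mono: "\<bar>\<rho> t * a\<bar> \<le> \<bar>\<rho> t * b\<bar>" if "0 \<le> a" "a \<le> b" for t a b
    using that less_imp_le[OF \<rho>(1)[of t]] by (simp add: mult_left_mono)
  \<comment> \<open>Membership in L^p stays a premise inside the induction; domination hands it down
    to summands and approximants.\<close>
  have weighted: "(\<lambda>t. \<rho> t * h t) \<in> Lp M p \<longrightarrow>
      integrable M (\<lambda>t. D t * h t) \<and> \<Lambda> (\<lambda>t. \<rho> t * h t) = (\<integral>t. D t * h t \<partial>M)"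
    if "h \<in> borel_measurable M" "\<And>t. 0 \<le> h t" for h
    using that
  proof (induction h rule: borel_measurable_induct_real)
    case (set A)
    then show ?case using Dint Deq by simp
  next
    case (mult h c)
    show ?case
    proof (cases "c = 0")
      \<comment> \<open>For \<open>c = 0\<close> the premise says nothing about
        \<open>\<rho> t * h t\<close>, so the induction hypothesis is out of reach.\<close>
      case True
      have "\<Lambda> 0 = 0" using linear_functional_onD(2)[OF \<Lambda>, of 0 0] by simp
      with True show ?thesis by (simp add: zero_fun_def)
    next
      case False
      show ?thesis
      proof
        assume "(\<lambda>t. \<rho> t * (c * h t)) \<in> Lp M p"
        then have "inverse c *\<^sub>R (\<lambda>t. \<rho> t * (c * h t)) \<in> Lp M p" by simp
        moreover have "inverse c *\<^sub>R (\<lambda>t. \<rho> t * (c * h t)) = (\<lambda>t. \<rho> t * h t)"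
          using False by (simp add: scaleR_fun_def fun_eq_iff)
        ultimately have *: "(\<lambda>t. \<rho> t * h t) \<in> Lp M p" by simp
        have "\<Lambda> (c *\<^sub>R (\<lambda>t. \<rho> t * h t)) = c * \<Lambda> (\<lambda>t. \<rho> t * h t)" by (rule linear_functional_onD(2)[OF \<Lambda> *])
        then show "integrable M (\<lambda>t. D t * (c * h t)) \<and> \<Lambda> (\<lambda>t. \<rho> t * (c * h t)) = (\<integral>t. D t * (c * h t) \<partial>M)"
          using mult * by (simp add: scaleR_fun_def mult.left_commute)
      qed
    qed
  next
    case (add h k)
    show ?case
    proof
      assume L: "(\<lambda>t. \<rho> t * (k t + h t)) \<in> Lp M p"
      have h: "(\<lambda>t. \<rho> t * h t) \<in> Lp M p" and k: "(\<lambda>t. \<rho> t * k t) \<in> Lp M p"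
        by (rule Lp_dominated(1)[OF _ L]; use add in \<open>auto intro!: weight_mono\<close>)+
      have "\<Lambda> ((\<lambda>t. \<rho> t * k t) + (\<lambda>t. \<rho> t * h t)) = \<Lambda> (\<lambda>t. \<rho> t * k t) + \<Lambda> (\<lambda>t. \<rho> t * h t)"
        by (rule linear_functional_onD(1)[OF \<Lambda> k h])
      then show "integrable M (\<lambda>t. D t * (k t + h t)) \<and> \<Lambda> (\<lambda>t. \<rho> t * (k t + h t)) = (\<integral>t. D t * (k t + h t) \<partial>M)"
        using add h k by (simp add: plus_fun_def distrib_left)
    qed
  next
    case (seq U)
    note [measurable] = seq.hyps(1)
    have h [measurable]: "h \<in> borel_measurable M" by (rule that)
    have U_le: "U i t \<le> h t" if "t \<in> space M" for i t
      using incseq_le[of "\<lambda>i. U i t" "h t" i] seq.hyps(3) seq.hyps(4)[OF that] by (auto simp: incseq_def le_fun_def)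
    show ?case
    proof
      assume L: "(\<lambda>t. \<rho> t * h t) \<in> Lp M p"
      have Ui: "(\<lambda>t. \<rho> t * U i t) \<in> Lp M p" for i
        by (rule Lp_dominated(1)[OF _ L]) (use U_le seq.hyps(2) that(2) in \<open>auto intro!: weight_mono\<close>)
      have diff: "(\<lambda>t. \<rho> t * h t) - (\<lambda>t. \<rho> t * U i t) = (\<lambda>t. \<rho> t * (h t - U i t))" for i
        by (simp add: fun_diff_def right_diff_distrib)
      have diff_L: "(\<lambda>t. \<rho> t * (h t - U i t)) \<in> Lp M p" for i
        using Lp.V_simps(5)[OF L Ui[of i]] diff by simp
      have diff_bound: "AE t in M. norm (\<rho> t * (h t - U i t)) \<le> norm (\<rho> t * h t)" for i
        by (rule AE_I2) (use U_le seq.hyps(2) that(2) in \<open>auto intro!: weight_mono\<close>)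
      have "(\<lambda>i. Lp_norm M p (\<lambda>t. \<rho> t * (h t - U i t))) \<longlonglongrightarrow> 0"
      proof (rule Lp_norm_tendsto_0[OF _ L diff_bound])
        show "AE t in M. (\<lambda>i. \<rho> t * (h t - U i t)) \<longlonglongrightarrow> 0"
        proof (rule AE_I2)
          fix t assume "t \<in> space M"
          then have "(\<lambda>i. \<rho> t * (h t - U i t)) \<longlonglongrightarrow> \<rho> t * (h t - h t)"
            by (intro tendsto_mult tendsto_diff tendsto_const seq.hyps(4))
          then show "(\<lambda>i. \<rho> t * (h t - U i t)) \<longlonglongrightarrow> 0" by simp
        qed
      qed measurable
      then have "(\<lambda>i. C * Lp_norm M p (\<lambda>t. \<rho> t * (h t - U i t))) \<longlonglongrightarrow> 0"
        by (rule tendsto_mult_right_zero)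
      moreover have "norm (\<Lambda> (\<lambda>t. \<rho> t * U i t) - \<Lambda> (\<lambda>t. \<rho> t * h t)) \<le> C * Lp_norm M p (\<lambda>t. \<rho> t * (h t - U i t))" for i
      proof -
        have "\<Lambda> (\<lambda>t. \<rho> t * h t) - \<Lambda> (\<lambda>t. \<rho> t * U i t) = \<Lambda> (\<lambda>t. \<rho> t * (h t - U i t))"
          using linear_functional_on_diff[OF \<Lambda> Lp.V L Ui] diff by simp
        moreover have "\<bar>\<Lambda> f\<bar> \<le> C * Lp_norm M p f" if f: "f \<in> Lp M p" for f
          using bound[OF f] bound[of "- f"] f linear_functional_on_minus[OF \<Lambda> f] Lp.N_minus[OF f] by simp
        ultimately show ?thesis using diff_L[of i] by (metis abs_minus_commute real_norm_def)
      qed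
      ultimately have "(\<lambda>i. \<Lambda> (\<lambda>t. \<rho> t * U i t) - \<Lambda> (\<lambda>t. \<rho> t * h t)) \<longlonglongrightarrow> 0"
        by (rule Lim_null_comparison[OF always_eventually[OF allI], rotated])
      then have lim: "(\<lambda>i. \<Lambda> (\<lambda>t. \<rho> t * U i t)) \<longlonglongrightarrow> \<Lambda> (\<lambda>t. \<rho> t * h t)" by (simp add: LIM_zero_iff)
      have conv: "integrable M (\<lambda>t. D t * U i t)" "\<Lambda> (\<lambda>t. \<rho> t * U i t) = (\<integral>t. D t * U i t \<partial>M)" for i
        using seq.IH[of i] Ui by auto
      have mono: "AE t in M. mono (\<lambda>i. D t * U i t)"
        using seq.hyps(3) D0 by (auto simp: incseq_def le_fun_def mono_def intro!: mult_left_mono)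
      have nn: "AE t in M. 0 \<le> D t * U i t" for i using D0 seq.hyps(2) by simp
      have pw: "AE t in M. (\<lambda>i. D t * U i t) \<longlonglongrightarrow> D t * h t"
        by (intro AE_I2 tendsto_mult tendsto_const seq.hyps(4))
      have Dh: "(\<lambda>t. D t * h t) \<in> borel_measurable M" by measurable
      \<comment> \<open>The limit of the integrals is known from the continuity of
        \<open>\<Lambda>\<close>, so monotone convergence yields integrability and the value
        together.\<close>
      note mc = integral_monotone_convergence_nonneg[OF conv(1) mono nn pw lim[unfolded conv(2)] Dh]
      show "integrable M (\<lambda>t. D t * h t) \<and> \<Lambda> (\<lambda>t. \<rho> t * h t) = (\<integral>t. D t * h t \<partial>M)"
        using mc by simp
    qed
  qed
  define g where "g = (\<lambda>t. D t / \<rho> t)"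
  have g [measurable]: "g \<in> borel_measurable M" unfolding g_def by measurable
  have nonneg: "integrable M (\<lambda>t. g t * f t) \<and> \<Lambda> f = (\<integral>t. g t * f t \<partial>M)"
    if f: "f \<in> Lp M p" and f0: "\<And>t. 0 \<le> f t" for f
  proof -
    note [measurable] = Lp_measurable[OF f]
    have "\<rho> t * (f t / \<rho> t) = f t" "D t * (f t / \<rho> t) = g t * f t" for t
      using \<rho>(1)[of t] by (auto simp: g_def)
    then show ?thesis
      using weighted[of "\<lambda>t. f t / \<rho> t"] f f0 less_imp_le[OF \<rho>(1)] by simp
  qed
  have gen: "integrable M (\<lambda>t. g t * f t) \<and> \<Lambda> f = (\<integral>t. g t * f t \<partial>M)" if f: "f \<in> Lp M p" for f
  proof -
    note [measurable] = Lp_measurable[OF f]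
    have P: "(\<lambda>t. max (f t) 0) \<in> Lp M p" and N: "(\<lambda>t. max (- f t) 0) \<in> Lp M p"
      by (auto intro!: Lp_dominated(1)[OF _ f])
    have "f = (\<lambda>t. max (f t) 0) - (\<lambda>t. max (- f t) 0)"
      by (auto simp: fun_diff_def fun_eq_iff max_def)
    then have "\<Lambda> f = \<Lambda> (\<lambda>t. max (f t) 0) - \<Lambda> (\<lambda>t. max (- f t) 0)"
      using linear_functional_on_diff[OF \<Lambda> Lp.V P N] by simp
    moreover have "g t * f t = g t * max (f t) 0 - g t * max (- f t) 0" for t
      by (simp add: max_def)
    ultimately show ?thesis using nonneg[OF P] nonneg[OF N] by simp
  qed
  show ?thesis
    by (rule that[of g]) (use g gen D0 less_imp_le[OF \<rho>(1)] in \<open>auto simp: g_def\<close>)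
qed

text \<open>The classical test functions for the dual norm: for \<open>p = 1\<close> a weight living
  where \<open>g\<close> exceeds \<open>C\<close>; otherwise the power \<open>s - 1\<close> of
  truncations of \<open>g\<close>, with \<open>s\<close> the real conjugate exponent. The
  truncations guarantee that the test functions lie in L^p.\<close>

lemma density_in_conjugate_Lp:
  fixes g :: "'t \<Rightarrow> real"
  assumes q: "if p = 1 then q = \<infinity> else 1 / p + 1 / q = 1"
    and g [measurable]: "g \<in> borel_measurable M" and g0: "\<And>t. 0 \<le> g t"
    and int: "\<And>f. f \<in> Lp M p \<Longrightarrow> integrable M (\<lambda>t. g t * f t)"
    and bound: "\<And>f. f \<in> Lp M p \<Longrightarrow> (\<integral>t. g t * f t \<partial>M) \<le> C * Lp_norm M p f"
  shows "g \<in> Lp M q"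
proof (cases "p = 1")
  case True
  then have r: "r = 1" unfolding r_def by simp
  obtain \<rho> :: "'t \<Rightarrow> real" where \<rho>: "\<And>t. 0 < \<rho> t" "\<rho> \<in> Lp M p"
    using obtain_positive_Lp_function by blast
  note [measurable] = Lp_measurable[OF \<rho>(2)]
  define f where "f = (\<lambda>t. if g t > C then \<rho> t else 0)"
  have f: "f \<in> Lp M p" unfolding f_def by (rule Lp_dominated(1)[OF _ \<rho>(2)]) auto
  note [measurable] = Lp_measurable[OF f]
  have f0: "0 \<le> f t" for t unfolding f_def using less_imp_le[OF \<rho>(1)] by simp
  have fint: "integrable M f" using Lp_integrable[OF f] f0 by (simp add: r)
  have "(\<integral>t. g t * f t \<partial>M) \<le> C * (\<integral>t. f t \<partial>M)"
    using bound[OF f] f0 by (simp add: Lp_norm_eq r integral_nonneg_AE)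
  then have "(\<integral>t. (g t - C) * f t \<partial>M) \<le> 0"
    using int[OF f] fint by (simp add: left_diff_distrib)
  moreover have nn: "AE t in M. 0 \<le> (g t - C) * f t" unfolding f_def using less_imp_le[OF \<rho>(1)] by simp
  ultimately have "(\<integral>t. (g t - C) * f t \<partial>M) = 0" using integral_nonneg_AE[OF nn] by simp
  moreover have "integrable M (\<lambda>t. (g t - C) * f t)"
    using int[OF f] fint by (simp add: left_diff_distrib)
  ultimately have "AE t in M. (g t - C) * f t = 0"
    using integral_nonneg_eq_0_iff_AE[OF _ nn] by simp
  then have "AE t in M. norm (g t) \<le> C"
    by eventually_elim (use g0 less_imp_neq[OF \<rho>(1)] in \<open>auto simp: f_def split: if_splits\<close>)
  then show ?thesis using True q g by (auto simp: Lp_def)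
next
  case False
  then have pq: "1 / p + 1 / q = 1" using q by simp
  have p_eq: "p = ennreal r" unfolding r_def using p_finite by simp
  have r1: "r > 1"
    using r_ge_1 False p_eq by (cases "r = 1") auto
  have q_fin: "q \<noteq> \<infinity>"
  proof
    assume "q = \<infinity>"
    with pq have "1 / ennreal r = ennreal 1" using p_eq by simp
    then have "ennreal (1 / r) = ennreal 1" using divide_ennreal[of 1 r] r_pos by simp
    then show False using r1 by (simp add: ennreal_eq_1)
  qed
  have q_pos: "q \<noteq> 0" using pq by (intro notI) simp
  define s where "s = enn2real q"
  have q_eq: "q = ennreal s" unfolding s_def using q_fin by (cases q) auto
  have "s \<noteq> 0" using q_eq q_pos by auto
  then have s_pos: "s > 0" using enn2real_nonneg[of q] s_def by linarith
  have "1 / p = ennreal (1 / r)"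
    using divide_ennreal[of 1 r] r_pos arg_cong[OF p_eq, of "\<lambda>x. 1 / x"] by simp
  moreover have "1 / q = ennreal (1 / s)"
    using divide_ennreal[of 1 s] s_pos arg_cong[OF q_eq, of "\<lambda>x. 1 / x"] by simp
  ultimately have "ennreal (1 / r) + ennreal (1 / s) = 1" using pq by simp
  then have "ennreal (1 / r + 1 / s) = 1" using r_pos s_pos by (subst ennreal_plus) auto
  then have conj: "1 / r + 1 / s = 1" by (simp add: ennreal_eq_1)
  have sr: "(s - 1) * r = s"
  proof -
    have "s + r = r * s" using conj r_pos s_pos by (simp add: field_simps)
    moreover have "(s - 1) * r = r * s - r" by (simp add: left_diff_distrib)
    ultimately show ?thesis by linarith
  qed
  obtain h :: "'t \<Rightarrow> real" where h [measurable]: "h \<in> borel_measurable M" and h0: "\<And>t. 0 < h t"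
    and "\<And>t. h t \<le> 1" and hint: "integrable M h"
    by (rule obtain_positive_integrable_function) (rule that)
  \<comment> \<open>Cutting \<open>g\<close> at a multiple of \<open>h t powr (1 / s)\<close> bounds
    the power \<open>s\<close> by a multiple of the integrable \<open>h\<close>. Since
    \<open>h\<close> is positive, the truncations reach \<open>g\<close> at each point.\<close>
  define G where "G = (\<lambda>n t. min (g t) (real n * h t powr (1 / s)))"
  have [measurable]: "G n \<in> borel_measurable M" for n unfolding G_def by measurable
  have G0: "0 \<le> G n t" for n t unfolding G_def using g0 h0[of t] by simp
  have Gs_int: "integrable M (\<lambda>t. G n t powr s)" for n
  proof (rule Bochner_Integration.integrable_bound)
    show "integrable M (\<lambda>t. real n powr s * h t)" using hint by simp
    show "AE t in M. norm (G n t powr s) \<le> norm (real n powr s * h t)"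
    proof (rule AE_I2)
      fix t
      have "G n t powr s \<le> (real n * h t powr (1 / s)) powr s"
        using G0[of n t] s_pos unfolding G_def by (intro powr_mono2) auto
      also have "\<dots> = real n powr s * h t"
        using h0[of t] s_pos by (simp add: powr_mult powr_powr)
      finally show "norm (G n t powr s) \<le> norm (real n powr s * h t)" using h0[of t] by simp
    qed
  qed simp
  define I where "I = (\<lambda>n. \<integral>t. G n t powr s \<partial>M)"
  have I0: "0 \<le> I n" for n unfolding I_def by simp
  have I_bound: "I n \<le> \<bar>C\<bar> powr s" for n
  proof -
    \<comment> \<open>By \<open>(s - 1) * r = s\<close> this gives
      \<open>I n \<le> \<bar>C\<bar> * I n powr (1 / r)\<close>; dividing leaves the exponent
      \<open>1 / s\<close>.\<close>
    define f where "f = (\<lambda>t. G n t powr (s - 1))"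
    have f_powr: "norm (f t) powr r = G n t powr s" for t unfolding f_def by (simp add: powr_powr sr)
    have f: "f \<in> Lp M p" unfolding mem_Lp f_powr by (simp add: f_def Gs_int)
    have "I n \<le> (\<integral>t. g t * f t \<partial>M)"
      unfolding I_def
    proof (rule integral_mono[OF Gs_int int[OF f]])
      fix t
      have "G n t powr s = G n t * f t"
        unfolding f_def using G0[of n t] by (cases "G n t = 0") (auto simp: powr_diff)
      also have "\<dots> \<le> g t * f t" by (rule mult_right_mono) (auto simp: G_def f_def)
      finally show "G n t powr s \<le> g t * f t" .
    qed
    also have "\<dots> \<le> C * Lp_norm M p f" by (rule bound[OF f])
    also have "\<dots> \<le> \<bar>C\<bar> * I n powr (1 / r)"
      unfolding Lp_norm_eq f_powr I_def by (intro mult_right_mono) auto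
    finally have le: "I n \<le> \<bar>C\<bar> * I n powr (1 / r)" .
    show ?thesis
    proof (cases "I n = 0")
      case False
      then have Ipos: "0 < I n" using I0[of n] by simp
      have "I n powr (1 / s) * I n powr (1 / r) = I n"
        using Ipos conj by (simp add: powr_add[symmetric] add.commute)
      then have "I n powr (1 / s) * I n powr (1 / r) \<le> \<bar>C\<bar> * I n powr (1 / r)" using le by simp
      then have "I n powr (1 / s) \<le> \<bar>C\<bar>" using Ipos by simp
      then have "(I n powr (1 / s)) powr s \<le> \<bar>C\<bar> powr s" using s_pos by (intro powr_mono2) auto
      then show ?thesis using Ipos s_pos by (simp add: powr_powr)
    qed simp
  qed
  have Gmono: "G m t powr s \<le> G n t powr s" if "m \<le> n" for m n t
    using that G0 s_pos h0[of t] unfolding G_def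
    by (intro powr_mono2 min.mono mult_right_mono) (auto simp: g0 less_imp_le)
  have "incseq I"
    unfolding I_def by (intro incseq_SucI integral_mono Gs_int Gmono) simp
  then obtain L where L: "I \<longlonglongrightarrow> L" using incseq_convergent[of I "\<bar>C\<bar> powr s"] I_bound by blast
  have pw: "(\<lambda>n. G n t powr s) \<longlonglongrightarrow> g t powr s" for t
  proof (rule tendsto_eventually)
    obtain N where N: "g t / h t powr (1 / s) \<le> real N" using real_arch_simple by blast
    show "\<forall>\<^sub>F n in sequentially. G n t powr s = g t powr s"
      unfolding eventually_sequentially
    proof (intro exI allI impI)
      fix n assume "N \<le> n"
      then have "g t / h t powr (1 / s) \<le> real n" using N by linarith
      then have "g t \<le> real n * h t powr (1 / s)" using h0[of t] by (simp add: pos_divide_le_eq)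
      then show "G n t powr s = g t powr s" unfolding G_def by (simp add: min_def)
    qed
  qed
  have "integrable M (\<lambda>t. g t powr s)"
    by (rule integral_monotone_convergence_nonneg(1)[OF Gs_int, where x = L])
      (use L pw Gmono in \<open>auto simp: mono_def I_def\<close>)
  then show ?thesis
    using q_fin g0 g unfolding Lp_def s_def by simp
qed

end

section \<open>Separable duals\<close>

lemma closure_eq_UNIV_iff_meets_open:
  "closure D = UNIV \<longleftrightarrow> (\<forall>X. open X \<longrightarrow> X \<noteq> {} \<longrightarrow> (\<exists>d\<in>D. d \<in> X))"
proof
  assume D: "closure D = UNIV"
  show "\<forall>X. open X \<longrightarrow> X \<noteq> {} \<longrightarrow> (\<exists>d\<in>D. d \<in> X)"
  proof (intro allI impI)
    fix X :: "'a set" assume "open X" "X \<noteq> {}"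
    then show "\<exists>d\<in>D. d \<in> X" using open_Int_closure_eq_empty[of X D] D by auto
  qed
next
  assume D: "\<forall>X. open X \<longrightarrow> X \<noteq> {} \<longrightarrow> (\<exists>d\<in>D. d \<in> X)"
  have "- closure D = {}"
    using D[rule_format, of "- closure D"] closure_subset[of D] by auto
  then show "closure D = UNIV" by auto
qed

lemma dense_closed_UNIV:
  assumes "closure D = UNIV" "closed {x. P x}" "\<And>x. x \<in> D \<Longrightarrow> P x"
  shows "P x"
  using closure_minimal[of D "{x. P x}"] assms by auto

text \<open>A subgroup suffices where a rational subspace might be expected: real multiples are
  recovered later by density and continuity.\<close>

lemma countable_additive_subgroup:
  fixes A :: "'a::ab_group_add set"
  assumes "countable A"
  obtains G where "countable G" "A \<subseteq> G" "0 \<in> G"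
    and "\<And>x y. x \<in> G \<Longrightarrow> y \<in> G \<Longrightarrow> x + y \<in> G" "\<And>x. x \<in> G \<Longrightarrow> - x \<in> G"
proof
  let ?B = "A \<union> uminus ` A"
  show "countable (sum_list ` lists ?B)" using assms by (intro countable_image countable_lists) auto
  show "A \<subseteq> sum_list ` lists ?B"
  proof
    fix a assume "a \<in> A"
    then show "a \<in> sum_list ` lists ?B" by (intro image_eqI[of _ _ "[a]"]) auto
  qed
  show "0 \<in> sum_list ` lists ?B" by (intro image_eqI[of _ _ "[]"]) auto
  fix x assume x: "x \<in> sum_list ` lists ?B"
  then obtain xs where xs: "x = sum_list xs" "set xs \<subseteq> ?B" by (auto simp: in_lists_conv_set)
  have "- x = sum_list (map uminus xs)" unfolding xs(1) by (induction xs) auto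
  moreover have "map uminus xs \<in> lists ?B" using xs(2) by (auto simp: in_lists_conv_set)
  ultimately show "- x \<in> sum_list ` lists ?B" by blast
  fix y assume "y \<in> sum_list ` lists ?B"
  then obtain ys where ys: "y = sum_list ys" "ys \<in> lists ?B" by auto
  with xs show "x + y \<in> sum_list ` lists ?B"
    by (intro image_eqI[of _ _ "xs @ ys"]) (auto simp: in_lists_conv_set)
qed

lemma countable_dense_subgroup:
  obtains D :: "'z::{real_normed_vector, second_countable_topology} set"
  where "countable D" "closure D = UNIV" "0 \<in> D"
    and "\<And>x y. x \<in> D \<Longrightarrow> y \<in> D \<Longrightarrow> x + y \<in> D" "\<And>x. x \<in> D \<Longrightarrow> - x \<in> D"
proof -
  obtain A :: "'z set" where A: "countable A" "\<And>X. open X \<Longrightarrow> X \<noteq> {} \<Longrightarrow> \<exists>d\<in>A. d \<in> X"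
    by (rule countable_dense_setE) (rule that)
  obtain G where G: "countable G" "A \<subseteq> G" "0 \<in> G"
    "\<And>x y. x \<in> G \<Longrightarrow> y \<in> G \<Longrightarrow> x + y \<in> G" "\<And>x. x \<in> G \<Longrightarrow> - x \<in> G"
    by (rule countable_additive_subgroup[OF A(1)]) (rule that)
  have "closure A = UNIV" using A(2) by (simp add: closure_eq_UNIV_iff_meets_open)
  then have "closure G = UNIV" using closure_mono[OF G(2)] by auto
  with G that show ?thesis by blast
qed

lemma linear_functional_on_blinfun:
  assumes f: "linear_functional_on UNIV f" and le: "\<And>v. f v \<le> C * norm v"
  obtains b :: "'z::real_normed_vector \<Rightarrow>\<^sub>L real" where "\<And>v. blinfun_apply b v = f v"
proof -
  have "bounded_linear f"
  proof (rule bounded_linear_intro)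
    show "f (x + y) = f x + f y" "f (c *\<^sub>R x) = c *\<^sub>R f x" for x y c
      using linear_functional_onD[OF f] by auto
    show "norm (f x) \<le> norm x * C" for x
      using le[of x] le[of "- x"] linear_functional_on_minus[OF f, of x] by (simp add: mult.commute)
  qed
  then show ?thesis using that[of "Blinfun f"] by (simp add: bounded_linear_Blinfun_apply)
qed

lemma norming_functional:
  fixes z :: "'z::real_normed_vector"
  obtains b :: "'z \<Rightarrow>\<^sub>L real" where "norm b \<le> 1" "blinfun_apply b z = norm z"
proof -
  have norm: "sublinear_on UNIV (norm :: 'z \<Rightarrow> real)"
    by (rule sublinear_onI) (auto simp: norm_triangle_ineq)
  obtain f where f: "linear_functional_on UNIV f" "\<And>v. f v \<le> norm v" "f z = norm z"
    using Hahn_Banach_point[OF norm subspace_UNIV, of z] by auto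
  obtain b where b: "\<And>v. blinfun_apply b v = f v"
    using linear_functional_on_blinfun[OF f(1), of 1] f(2) by auto
  have "\<bar>f v\<bar> \<le> norm v" for v
    using f(2)[of v] f(2)[of "- v"] linear_functional_on_minus[OF f(1), of v] by simp
  then have "norm b \<le> 1" by (intro norm_blinfun_bound) (auto simp: b)
  with b f(3) that show ?thesis by metis
qed

lemma sublinear_on_infdist_subspace:
  assumes Y: "subspace Y"
  shows "sublinear_on UNIV (\<lambda>x::'z::real_normed_vector. infdist x Y)"
proof (rule sublinear_onI)
  have ne: "Y \<noteq> {}" using subspace_0[OF Y] by auto
  fix x y :: 'z
  show "infdist (x + y) Y \<le> infdist x Y + infdist y Y"
  proof (rule field_le_epsilon)
    fix e :: real assume "e > 0"
    obtain a where a: "a \<in> Y" "dist x a < infdist x Y + e / 2"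
      using infdist_less_iff[OF ne, of x "infdist x Y + e / 2"] \<open>e > 0\<close> by auto
    obtain b where b: "b \<in> Y" "dist y b < infdist y Y + e / 2"
      using infdist_less_iff[OF ne, of y "infdist y Y + e / 2"] \<open>e > 0\<close> by auto
    have "infdist (x + y) Y \<le> dist (x + y) (a + b)" by (intro infdist_le subspace_add Y a b)
    also have "\<dots> \<le> dist x a + dist y b" by (rule dist_triangle_add)
    finally show "infdist (x + y) Y \<le> infdist x Y + infdist y Y + e" using a b by simp
  qed
next
  show "infdist 0 Y = 0" using subspace_0[OF Y] by simp
next
  fix x :: 'z and c :: real assume c: "c > 0"
  have ne: "Y \<noteq> {}" using subspace_0[OF Y] by auto
  show "infdist (c *\<^sub>R x) Y \<le> c * infdist x Y"
  proof (rule dense_ge)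
    fix a assume "c * infdist x Y < a"
    then have "infdist x Y < a / c" using c by (simp add: field_simps)
    then obtain b where b: "b \<in> Y" "dist x b < a / c" using infdist_less_iff[OF ne] by auto
    have "infdist (c *\<^sub>R x) Y \<le> dist (c *\<^sub>R x) (c *\<^sub>R b)" by (intro infdist_le subspace_mul Y b)
    also have "\<dots> = c * dist x b" using c by (simp add: dist_norm scaleR_diff_right[symmetric])
    also have "\<dots> \<le> a" using b(2) c by (simp add: field_simps)
    finally show "infdist (c *\<^sub>R x) Y \<le> a" .
  qed
qed auto

text \<open>Functionals \<open>f d\<close> norming the points of a countable dense set span a dense
  subspace. A functional on the dual that vanishes on them is evaluation at some \<open>z\<close> by
  reflexivity; every \<open>d\<close> in \<open>D\<close> then satisfies
  \<open>norm d \<le> norm (d - z)\<close>, which fails for \<open>d\<close> close to a nonzero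
  \<open>z\<close>.\<close>

lemma reflexive_dual_separable:
  assumes refl: "reflexive_space TYPE('z::{real_normed_vector, second_countable_topology})"
  obtains E :: "('z::{real_normed_vector, second_countable_topology} \<Rightarrow>\<^sub>L real) set" where "countable E" "closure E = UNIV"
proof -
  obtain D :: "'z set" where D: "countable D" "closure D = UNIV"
    using countable_dense_subgroup by metis
  have "\<exists>b :: 'z \<Rightarrow>\<^sub>L real. norm b \<le> 1 \<and> blinfun_apply b d = norm d" for d
    using norming_functional by metis
  then obtain f :: "'z \<Rightarrow> 'z \<Rightarrow>\<^sub>L real" where f: "\<And>d. norm (f d) \<le> 1" "\<And>d. blinfun_apply (f d) d = norm d"
    by metis
  define Y where "Y = span (f ` D)"
  have Y: "subspace Y" unfolding Y_def by simp
  have "b \<in> closure Y" for b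
  proof (rule ccontr)
    assume b: "b \<notin> closure Y"
    have "Y \<noteq> {}" using subspace_0[OF Y] by auto
    then have pos: "infdist b Y > 0"
      using b in_closure_iff_infdist_zero infdist_nonneg[of b Y] by (metis less_le)
    \<comment> \<open>The distance to \<open>Y\<close> as sublinear bound gives continuity and
      forces \<open>g\<close> to vanish on \<open>Y\<close> at the same time.\<close>
    obtain g where g: "linear_functional_on UNIV g" "\<And>v. g v \<le> infdist v Y" "g b = infdist b Y"
      using Hahn_Banach_point[OF sublinear_on_infdist_subspace[OF Y] subspace_UNIV, of b] by auto
    have "g v \<le> 1 * norm v" for v
      using g(2)[of v] infdist_le[OF subspace_0[OF Y], of v] by simp
    then obtain \<phi> where \<phi>: "\<And>v. blinfun_apply \<phi> v = g v"
      using linear_functional_on_blinfun[OF g(1)] by metis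
    obtain z where z: "\<And>v. blinfun_apply \<phi> v = blinfun_apply v z"
      using refl unfolding reflexive_space_def by blast
    have fz: "blinfun_apply (f d) z = 0" if "d \<in> D" for d
    proof -
      have "f d \<in> Y" unfolding Y_def using that by (simp add: span_base)
      moreover from this have "- f d \<in> Y" using Y by (rule subspace_neg[rotated])
      ultimately have "g (f d) \<le> 0" "g (- f d) \<le> 0" using g(2)[of "f d"] g(2)[of "- f d"] by auto
      then show ?thesis using linear_functional_on_minus[OF g(1), of "f d"] \<phi> z by simp
    qed
    have "z \<noteq> 0" using pos g(3) \<phi>[of b] z[of b] by auto
    then obtain d where d: "d \<in> D" "dist z d < norm z / 2"
      using D(2)[unfolded closure_eq_UNIV_iff_meets_open, rule_format, of "ball z (norm z / 2)"] by auto
    have "norm d = blinfun_apply (f d) (d - z)" using f(2)[of d] fz[OF d(1)] by (simp add: blinfun.diff_right)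
    also have "\<dots> \<le> norm (f d) * norm (d - z)"
      using norm_blinfun[of "f d" "d - z"] by simp
    also have "\<dots> \<le> norm (d - z)" using mult_right_mono[OF f(1)[of d] norm_ge_zero[of "d - z"]] by simp
    finally have "norm d \<le> dist z d" by (simp add: dist_norm norm_minus_commute)
    moreover have "norm z \<le> dist z d + norm d" using norm_triangle_ineq[of "z - d" d] by (simp add: dist_norm)
    ultimately show False using d(2) by linarith
  qed
  then have Y_dense: "closure Y = UNIV" by auto
  \<comment> \<open>Only rational multiples enter the countable set; real ones come from its
    closure.\<close>
  define A where "A = (\<lambda>(c, d). c *\<^sub>R f d) ` (\<rat> \<times> D)"
  have "countable A" unfolding A_def using D countable_rat by auto
  then obtain E where E: "countable E" "A \<subseteq> E" "0 \<in> E"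
    "\<And>x y. x \<in> E \<Longrightarrow> y \<in> E \<Longrightarrow> x + y \<in> E"
    using countable_additive_subgroup by metis
  have add: "x + y \<in> closure E" if "x \<in> closure E" "y \<in> closure E" for x y
  proof -
    obtain a where "\<And>n. a n \<in> E" "a \<longlonglongrightarrow> x" using \<open>x \<in> closure E\<close> unfolding closure_sequential by auto
    moreover obtain b where "\<And>n. b n \<in> E" "b \<longlonglongrightarrow> y" using \<open>y \<in> closure E\<close> unfolding closure_sequential by auto
    ultimately show ?thesis
      unfolding closure_sequential using E(4) by (intro exI[of _ "\<lambda>n. a n + b n"]) (auto intro: tendsto_add)
  qed
  \<comment> \<open>Quantifying over all multiples makes this set a subspace, whereas
    \<open>closure E\<close> is so far known only to be closed under sums.\<close>
  have "Y \<subseteq> {x. \<forall>c. c *\<^sub>R x \<in> closure E}"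
    unfolding Y_def
  proof (rule span_minimal)
    show "subspace {x. \<forall>c. c *\<^sub>R x \<in> closure E}"
      unfolding subspace_def using E(3) closure_subset[of E] add by (auto simp: scaleR_add_right)
    show "f ` D \<subseteq> {x. \<forall>c. c *\<^sub>R x \<in> closure E}"
    proof clarify
      fix d c assume d: "d \<in> D"
      have rat: "c *\<^sub>R f d \<in> closure E" if "c \<in> \<rat>" for c
        using that d E(2) closure_subset[of E] unfolding A_def by blast
      show "c *\<^sub>R f d \<in> closure E"
      proof (rule dense_closed_UNIV[OF Rats_closure_real])
        have "continuous_on UNIV (\<lambda>c. c *\<^sub>R f d)" by (intro continuous_intros)
        then have "closed ((\<lambda>c. c *\<^sub>R f d) -` closure E)" by (intro closed_vimage closed_closure)
        then show "closed {c. c *\<^sub>R f d \<in> closure E}" by (simp add: vimage_def)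
      qed (rule rat)
    qed
  qed
  then have "Y \<subseteq> closure E" by (metis (mono_tags, lifting) mem_Collect_eq scaleR_one subsetD subsetI)
  then have "closure E = UNIV" using Y_dense closure_minimal[of Y "closure E"] by auto
  with E(1) that show ?thesis by blast
qed

text \<open>An open set is a countable union of closed balls with centres in \<open>E\<close> and
  rational radii, and a closed ball of the dual is cut out by countably many evaluations at points
  of \<open>D\<close>.\<close>

lemma borel_measurable_dual:
  fixes \<xi> :: "'t \<Rightarrow> 'z::real_normed_vector \<Rightarrow>\<^sub>L real"
  assumes E: "countable E" "closure E = (UNIV :: ('z \<Rightarrow>\<^sub>L real) set)"
    and D: "countable D" "closure D = (UNIV :: 'z set)"
    and meas: "\<And>d. d \<in> D \<Longrightarrow> (\<lambda>t. blinfun_apply (\<xi> t) d) \<in> borel_measurable M"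
  shows "\<xi> \<in> borel_measurable M"
proof (rule borel_measurableI)
  fix U :: "('z \<Rightarrow>\<^sub>L real) set" assume U: "open U"
  have norm_iff: "norm (f - e) \<le> q \<longleftrightarrow> (\<forall>d\<in>D. \<bar>blinfun_apply f d - blinfun_apply e d\<bar> \<le> q * norm d)"
    if "q \<ge> 0" for q and f e :: "'z \<Rightarrow>\<^sub>L real"
  proof
    assume "norm (f - e) \<le> q"
    then show "\<forall>d\<in>D. \<bar>blinfun_apply f d - blinfun_apply e d\<bar> \<le> q * norm d"
      using order_trans[OF norm_blinfun[of "f - e"] mult_right_mono[OF _ norm_ge_zero]]
      by (auto simp: blinfun.diff_left)
  next
    assume *: "\<forall>d\<in>D. \<bar>blinfun_apply f d - blinfun_apply e d\<bar> \<le> q * norm d"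
    have "\<bar>blinfun_apply f d - blinfun_apply e d\<bar> \<le> q * norm d" for d
      by (rule dense_closed_UNIV[OF D(2)]) (use * in \<open>auto intro!: closed_Collect_le continuous_intros\<close>)
    then show "norm (f - e) \<le> q" using that by (intro norm_blinfun_bound) (auto simp: blinfun.diff_left)
  qed
  define I where "I = {(e, q). e \<in> E \<and> q \<in> \<rat> \<and> 0 \<le> q \<and> cball e q \<subseteq> U}"
  have "I \<subseteq> E \<times> \<rat>" unfolding I_def by auto
  then have I: "countable I" using E(1) countable_rat by (metis countable_SIGMA countable_subset)
  have "(\<xi> t \<in> U) \<longleftrightarrow> (\<exists>eq\<in>I. norm (\<xi> t - fst eq) \<le> snd eq)" for t
  proof
    assume "\<xi> t \<in> U"
    then obtain r where r: "r > 0" "ball (\<xi> t) r \<subseteq> U" using U by (metis open_contains_ball)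
    obtain e where e: "e \<in> E" "dist (\<xi> t) e < r / 3"
      using E(2)[unfolded closure_eq_UNIV_iff_meets_open, rule_format, of "ball (\<xi> t) (r / 3)"] r by auto
    \<comment> \<open>Above \<open>r / 3\<close> the ball around \<open>e\<close> reaches
      \<open>\<xi> t\<close>; below \<open>r / 2\<close> it stays inside \<open>U\<close>, as
      \<open>r / 3 + q < r\<close>.\<close>
    obtain q where q: "q \<in> \<rat>" "r / 3 < q" "q < r / 2" using Rats_dense_in_real[of "r / 3" "r / 2"] r by auto
    have "cball e q \<subseteq> ball (\<xi> t) r"
    proof
      fix y assume "y \<in> cball e q"
      then show "y \<in> ball (\<xi> t) r"
        using dist_triangle[of "\<xi> t" y e] e(2) q r(1) by simp
    qed
    with e q r show "\<exists>eq\<in>I. norm (\<xi> t - fst eq) \<le> snd eq"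
      by (intro bexI[of _ "(e, q)"]) (auto simp: I_def dist_norm)
  next
    assume "\<exists>eq\<in>I. norm (\<xi> t - fst eq) \<le> snd eq"
    then show "\<xi> t \<in> U" by (auto simp: I_def subset_iff dist_norm norm_minus_commute)
  qed
  then have "\<xi> -` U \<inter> space M = {t \<in> space M. \<exists>eq\<in>I. \<forall>d\<in>D. \<bar>blinfun_apply (\<xi> t) d - blinfun_apply (fst eq) d\<bar> \<le> snd eq * norm d}"
    using norm_iff unfolding I_def by fastforce
  also have "\<dots> \<in> sets M"
    using I D(1) meas[measurable] by measurable
  finally show "\<xi> -` U \<inter> space M \<in> sets M" .
qed

lemma additive_continuous_linear:
  fixes G :: "'z::real_normed_vector \<Rightarrow> real"
  assumes add: "\<And>x y. G (x + y) = G x + G y" and cont: "continuous_on UNIV G"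
  shows "linear G"
proof (rule linearI)
  fix c :: real and x
  have G0: "G 0 = 0" using add[of 0 0] by simp
  have neg: "G (- y) = - G y" for y using add[of y "- y"] G0 by simp
  have nat: "G (real n *\<^sub>R y) = real n * G y" for n y
    by (induction n) (auto simp: G0 add scaleR_add_left algebra_simps)
  have int: "G (of_int k *\<^sub>R y) = of_int k * G y" for k y
    using nat[of "nat k" y] nat[of "nat (- k)" y] neg[of "of_int (- k) *\<^sub>R y"] by (cases "k \<ge> 0") auto
  have rat: "G (q *\<^sub>R x) = q * G x" if "q \<in> \<rat>" for q
  proof -
    obtain a b where q: "q = of_int a / of_int b" "b > 0" using \<open>q \<in> \<rat>\<close> by (rule Rats_cases')
    have "of_int b * G (q *\<^sub>R x) = of_int a * G x"
      using int[of b "q *\<^sub>R x"] int[of a x] q by simp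
    then have "G (q *\<^sub>R x) = of_int a * G x / of_int b" using \<open>b > 0\<close> by (simp add: eq_divide_eq mult.commute)
    then show ?thesis using q(1) by simp
  qed
  show "G (c *\<^sub>R x) = c *\<^sub>R G x"
  proof (rule dense_closed_UNIV[OF Rats_closure_real, where P = "\<lambda>c. G (c *\<^sub>R x) = c *\<^sub>R G x"])
    have "continuous_on UNIV (\<lambda>c. G (c *\<^sub>R x))"
      by (rule continuous_on_compose2[OF cont]) (auto intro!: continuous_intros)
    then show "closed {c. G (c *\<^sub>R x) = c *\<^sub>R G x}"
      by (intro closed_Collect_eq continuous_intros)
  qed (simp add: rat)
qed (rule add)

text \<open>The subgroup property lets the bound act on differences, so \<open>g\<close> is
  Lipschitz on \<open>D\<close> and extends. Additivity passes to the closure one argument at a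
  time.\<close>

lemma additive_dense_extension:
  fixes g :: "'z::real_normed_vector \<Rightarrow> real"
  assumes D: "closure D = UNIV" "\<And>x y. x \<in> D \<Longrightarrow> y \<in> D \<Longrightarrow> x + y \<in> D" "\<And>x. x \<in> D \<Longrightarrow> - x \<in> D"
    and add: "\<And>x y. x \<in> D \<Longrightarrow> y \<in> D \<Longrightarrow> g (x + y) = g x + g y"
    and bound: "\<And>x. x \<in> D \<Longrightarrow> \<bar>g x\<bar> \<le> c * norm x" and c: "0 \<le> c"
  obtains b :: "'z \<Rightarrow>\<^sub>L real" where "\<And>d. d \<in> D \<Longrightarrow> blinfun_apply b d = g d"
proof -
  have diff: "\<bar>g x - g y\<bar> \<le> c * norm (x - y)" if "x \<in> D" "y \<in> D" for x y
  proof -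
    have "x - y \<in> D" using D(2)[OF that(1) D(3)[OF that(2)]] by simp
    then show ?thesis using add[of "x - y" y] bound[of "x - y"] that by simp
  qed
  have "c-lipschitz_on D g"
    using diff c by (auto intro!: lipschitz_onI simp: dist_norm)
  then have "uniformly_continuous_on D g" by (rule lipschitz_on_uniformly_continuous)
  then obtain G where G: "uniformly_continuous_on (closure D) G" "\<And>x. x \<in> D \<Longrightarrow> g x = G x"
    by (rule uniformly_continuous_on_extension_on_closure) (rule that)
  then have cont: "continuous_on UNIV G" using D(1) uniformly_continuous_imp_continuous by metis
  have cont' [continuous_intros]: "continuous_on A (\<lambda>x. G (h x))" if "continuous_on A h" for h :: "'b::topological_space \<Rightarrow> 'z" and A
    using continuous_on_compose2[OF cont that] by auto
  have addD: "G (x + d) = G x + G d" if d: "d \<in> D" for x d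
    by (rule dense_closed_UNIV[OF D(1)])
      (use add d D(2) G(2) in \<open>auto intro!: closed_Collect_eq continuous_intros\<close>)
  have G_add: "G (x + y) = G x + G y" for x y
    by (rule dense_closed_UNIV[OF D(1), where P = "\<lambda>y. G (x + y) = G x + G y"])
      (use addD in \<open>auto intro!: closed_Collect_eq continuous_intros\<close>)
  have G_bound: "\<bar>G x\<bar> \<le> c * norm x" for x
    by (rule dense_closed_UNIV[OF D(1)])
      (use bound G(2) in \<open>auto intro!: closed_Collect_le continuous_intros\<close>)
  have "linear G"
    by (rule additive_continuous_linear) (use G_add cont in auto)
  then have "bounded_linear G"
    using G_bound by (intro bounded_linear_intro[where K = c]) (auto simp: linear_add linear_scale mult.commute)
  then show ?thesis using that[of "Blinfun G"] G(2) by (simp add: bounded_linear_Blinfun_apply)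
qed

section \<open>Multipliers and their representation\<close>

context Lp_exponent
begin

text \<open>The norm acts on the positive part of \<open>f\<close>, which vanishes for
  \<open>f \<le> 0\<close>; this makes \<open>\<omega>\<close> positive. The constraint on all
  majorants of \<open>H v\<close>, taken at \<open>H v\<close> itself, is the bound on
  \<open>- \<phi> v\<close>.\<close>

lemma clarke_multipliers:
  fixes S :: "'t \<Rightarrow> 'z::{banach, second_countable_topology} set"
  assumes S: "measurable_multifunction M S" and ne: "\<And>t. t \<in> space M \<Longrightarrow> S t \<noteq> {}"
    and cl: "\<And>t. t \<in> space M \<Longrightarrow> closed (S t)"
    and F: "lipschitz_near (Lp M p) (Lp_norm M p) F x r0 K" and K: "0 \<le> K"
    and xS: "x \<in> Sel M p S" and min: "local_minimizer_Lp M p F (Sel M p S) x"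
  obtains \<phi> :: "('t \<Rightarrow> 'z) \<Rightarrow> real" and \<omega> :: "('t \<Rightarrow> real) \<Rightarrow> real"
  where "linear_functional_on (Lp M p) \<phi>" "linear_functional_on (Lp M p) \<omega>"
    and "\<And>v. v \<in> Lp M p \<Longrightarrow> \<phi> v \<le> clarke_dd (Lp M p) (Lp_norm M p) F x v"
    and "\<And>f. f \<in> Lp M p \<Longrightarrow> \<omega> f \<le> K * Lp_norm M p f"
    and "\<And>f. f \<in> Lp M p \<Longrightarrow> (\<And>t. 0 \<le> f t) \<Longrightarrow> 0 \<le> \<omega> f"
    and "\<And>v. v \<in> Lp M p \<Longrightarrow> - \<phi> v \<le> \<omega> (\<lambda>t. max 0 (dist_dd (S t) (x t) (v t)))"
proof -
  interpret F: lipschitz_near "Lp M p" "Lp_norm M p" F x r0 K by fact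
  let ?dd = "clarke_dd (Lp M p) (Lp_norm M p) F x"
  define H where "H = (\<lambda>v t. max 0 (dist_dd (S t) (x t) (v t)))"
  define pos where "pos = (\<lambda>(f :: 't \<Rightarrow> real) t. max (f t) 0)"
  have H_Lp: "H v \<in> Lp M p" if v: "v \<in> Lp M p" for v
  proof (rule Lp_dominated(1)[OF _ v])
    show "H v \<in> borel_measurable M"
      unfolding H_def using borel_measurable_dist_dd[OF S ne Lp_measurable[OF F.x] Lp_measurable[OF v]] by simp
    show "AE t in M. norm (H v t) \<le> norm (v t)"
      unfolding H_def using dist_dd_le_norm by (intro AE_I2) auto
  qed
  have H_add: "H (u + v) t \<le> H u t + H v t" for u v t
    using sublinear_onD(1)[OF sublinear_on_dist_dd, of "u t" "v t" "S t" "x t"] unfolding H_def by auto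
  have H_scale: "H (c *\<^sub>R v) t = c * H v t" if "c > 0" for c v t
    using sublinear_onD(2)[OF sublinear_on_dist_dd, of "v t" c "S t" "x t"] that
    unfolding H_def by (simp add: max_mult_distrib_left)
  have pos_Lp: "pos f \<in> Lp M p" and pos_le: "Lp_norm M p (pos f) \<le> Lp_norm M p f" if f: "f \<in> Lp M p" for f
    using Lp_measurable[OF f] unfolding pos_def by (auto intro!: Lp_dominated[OF _ f])
  \<comment> \<open>Sublinearity of the directional derivative in \<open>v\<close> makes these pairs
    a convex cone; the real component is 0 because the constraints are homogeneous.\<close>
  define W where "W = {((v, f), a :: real). v \<in> Lp M p \<and> f \<in> Lp M p \<and> (\<forall>t. H v t \<le> f t) \<and> a = 0}"
  let ?V = "(Lp M p :: ('t \<Rightarrow> 'z) set) \<times> (Lp M p :: ('t \<Rightarrow> real) set)"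
  have V: "subspace ?V"
    unfolding subspace_def by (auto simp: zero_prod_def)
  have dd0: "?dd 0 = 0" using sublinear_onD(2)[OF F.sublinear_on_clarke_dd, of 0 0] by simp
  have pos0: "pos 0 = 0" unfolding pos_def by (auto simp: fun_eq_iff)
  have sub: "sublinear_on ?V (\<lambda>(v, f). ?dd v + K * Lp_norm M p (pos f))"
  proof (rule sublinear_onI)
    fix a b assume "a \<in> ?V" "b \<in> ?V"
    then obtain u f v g where ab: "a = (u, f)" "b = (v, g)" "u \<in> Lp M p" "v \<in> Lp M p" "f \<in> Lp M p" "g \<in> Lp M p"
      by auto
    have "?dd (u + v) \<le> ?dd u + ?dd v" by (rule sublinear_onD(1)[OF F.sublinear_on_clarke_dd ab(3,4)])
    moreover have "Lp_norm M p (pos (f + g)) \<le> Lp_norm M p (pos f + pos g)"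
      using pos_Lp ab Lp_measurable[OF pos_Lp[of "f + g"]]
      by (intro Lp_dominated(2)) (auto simp: pos_def)
    then have "Lp_norm M p (pos (f + g)) \<le> Lp_norm M p (pos f) + Lp_norm M p (pos g)"
      using Lp.N_add[OF pos_Lp[OF ab(5)] pos_Lp[OF ab(6)]] by simp
    then have "K * Lp_norm M p (pos (f + g)) \<le> K * (Lp_norm M p (pos f) + Lp_norm M p (pos g))"
      using K by (rule mult_left_mono)
    ultimately show "(case a + b of (v, f) \<Rightarrow> ?dd v + K * Lp_norm M p (pos f)) \<le>
        (case a of (v, f) \<Rightarrow> ?dd v + K * Lp_norm M p (pos f)) + (case b of (v, f) \<Rightarrow> ?dd v + K * Lp_norm M p (pos f))"
      by (simp add: ab distrib_left)
  next
    fix a and c :: real assume a: "a \<in> ?V" and c: "c > 0"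
    then obtain u f where a: "a = (u, f)" "u \<in> Lp M p" "f \<in> Lp M p" by auto
    have "pos (c *\<^sub>R f) = c *\<^sub>R pos f"
      using c by (auto simp: pos_def fun_eq_iff max_mult_distrib_left)
    then show "(case c *\<^sub>R a of (v, f) \<Rightarrow> ?dd v + K * Lp_norm M p (pos f)) \<le>
        c * (case a of (v, f) \<Rightarrow> ?dd v + K * Lp_norm M p (pos f))"
      using sublinear_onD(2)[OF F.sublinear_on_clarke_dd a(2), of c] c by (simp add: a Lp_norm_scale distrib_left)
  qed (use V in \<open>auto simp: zero_prod_def dd0 pos0 subspace_mul\<close>)
  obtain \<Phi> where \<Phi>: "linear_functional_on ?V \<Phi>"
    and \<Phi>_le: "\<And>w. w \<in> ?V \<Longrightarrow> \<Phi> w \<le> (case w of (v, f) \<Rightarrow> ?dd v + K * Lp_norm M p (pos f))"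
    and \<Phi>_W: "\<And>w a. (w, a) \<in> W \<Longrightarrow> 0 \<le> \<Phi> w + a"
  proof (rule Hahn_Banach_cone[OF sub V, where W = W])
    show "u \<in> ?V" if "(u, a) \<in> W" for u a using that unfolding W_def by auto
    have "H 0 t = 0" for t
      using sublinear_onD(2)[OF sublinear_on_dist_dd, of 0 0 "S t" "x t"] unfolding H_def by simp
    then show "(0, 0) \<in> W" unfolding W_def by (auto simp: zero_prod_def)
    show "(u + v, a + b) \<in> W" if "(u, a) \<in> W" "(v, b) \<in> W" for u a v b
      using that order_trans[OF H_add add_mono] unfolding W_def by auto
    show "(c *\<^sub>R u, c * a) \<in> W" if "(u, a) \<in> W" "c > 0" for u a c
      using that H_scale unfolding W_def by auto
    show "0 \<le> (case u of (v, f) \<Rightarrow> ?dd v + K * Lp_norm M p (pos f)) + a" if uW: "(u, a) \<in> W" for u a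
    proof -
      obtain v f where u: "u = (v, f)" "v \<in> Lp M p" "f \<in> Lp M p" "\<And>t. H v t \<le> f t" "a = 0"
        using uW unfolding W_def by auto
      have "0 \<le> ?dd v + K * Lp_norm M p (pos f)"
        using u(4) by (intro clarke_derivative_penalized_nonneg[OF S ne cl F K xS min u(2) pos_Lp[OF u(3)]])
          (auto simp: H_def pos_def le_max_iff_disj)
      with u show ?thesis by simp
    qed
  qed (rule that)
  show ?thesis
  proof (rule that[of "\<lambda>v. \<Phi> (v, 0)" "\<lambda>f. \<Phi> (0, f)"])
    show "linear_functional_on (Lp M p) (\<lambda>v. \<Phi> (v, 0))"
      using linear_functional_onD(1)[OF \<Phi>, of "(_, 0)" "(_, 0)"] linear_functional_onD(2)[OF \<Phi>, of "(_, 0)"]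
      unfolding linear_functional_on_def by simp
    show "linear_functional_on (Lp M p) (\<lambda>f. \<Phi> (0, f))"
      using linear_functional_onD(1)[OF \<Phi>, of "(0, _)" "(0, _)"] linear_functional_onD(2)[OF \<Phi>, of "(0, _)"]
      unfolding linear_functional_on_def by simp
    show "\<Phi> (v, 0) \<le> ?dd v" if "v \<in> Lp M p" for v
      using \<Phi>_le[of "(v, 0)"] that by (simp add: pos0)
    show "\<Phi> (0, f) \<le> K * Lp_norm M p f" if "f \<in> Lp M p" for f
      using \<Phi>_le[of "(0, f)"] that mult_left_mono[OF pos_le[OF that] K] by (simp add: dd0)
    show "0 \<le> \<Phi> (0, f)" if f: "f \<in> Lp M p" and f0: "\<And>t. 0 \<le> f t" for f
    proof -
      have "pos (- f) = 0" using f0 by (auto simp: pos_def fun_eq_iff max_def)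
      then have "\<Phi> (- (0, f)) \<le> 0" using \<Phi>_le[of "(0, - f)"] f by (simp add: dd0)
      then show ?thesis using linear_functional_on_minus[OF \<Phi>, of "(0, f)"] f by simp
    qed
    show "- \<Phi> (v, 0) \<le> \<Phi> (0, \<lambda>t. max 0 (dist_dd (S t) (x t) (v t)))" if v: "v \<in> Lp M p" for v
    proof -
      have "((v, H v), 0) \<in> W" unfolding W_def using v H_Lp by simp
      then have "0 \<le> \<Phi> ((v, 0) + (0, H v))" using \<Phi>_W by fastforce
      also have "\<dots> = \<Phi> (v, 0) + \<Phi> (0, H v)" using v H_Lp[OF v] by (intro linear_functional_onD(1)[OF \<Phi>]) auto
      finally show ?thesis unfolding H_def by simp
    qed
  qed
qed

text \<open>Tested with a positive weight cut down to the set where the inequality fails, the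
  integral of a nonnegative function would be at most 0.\<close>

lemma AE_le_of_integrals_le:
  fixes a b :: "'t \<Rightarrow> real"
  assumes [measurable]: "a \<in> borel_measurable M" "b \<in> borel_measurable M"
    and a: "\<And>f. f \<in> Lp M p \<Longrightarrow> integrable M (\<lambda>t. a t * f t)"
    and b: "\<And>f. f \<in> Lp M p \<Longrightarrow> integrable M (\<lambda>t. b t * f t)"
    and le: "\<And>f. f \<in> Lp M p \<Longrightarrow> (\<And>t. 0 \<le> f t) \<Longrightarrow> (\<integral>t. a t * f t \<partial>M) \<le> (\<integral>t. b t * f t \<partial>M)"
  shows "AE t in M. a t \<le> b t"
proof -
  obtain \<rho> :: "'t \<Rightarrow> real" where \<rho>: "\<And>t. 0 < \<rho> t" "\<rho> \<in> Lp M p"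
    using obtain_positive_Lp_function by blast
  note [measurable] = Lp_measurable[OF \<rho>(2)]
  define f where "f = (\<lambda>t. if a t > b t then \<rho> t else 0)"
  have f: "f \<in> Lp M p" unfolding f_def by (rule Lp_dominated(1)[OF _ \<rho>(2)]) auto
  have f0: "0 \<le> f t" for t unfolding f_def using less_imp_le[OF \<rho>(1)] by simp
  have int: "integrable M (\<lambda>t. (a t - b t) * f t)" using a[OF f] b[OF f] by (simp add: left_diff_distrib)
  have nn: "AE t in M. 0 \<le> (a t - b t) * f t" unfolding f_def using less_imp_le[OF \<rho>(1)] by simp
  have "(\<integral>t. (a t - b t) * f t \<partial>M) \<le> 0"
    using le[OF f f0] a[OF f] b[OF f] by (simp add: left_diff_distrib)
  then have "(\<integral>t. (a t - b t) * f t \<partial>M) = 0" using integral_nonneg_AE[OF nn] by simp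
  then have "AE t in M. (a t - b t) * f t = 0" using integral_nonneg_eq_0_iff_AE[OF int nn] by simp
  then show ?thesis
    by eventually_elim (use less_imp_neq[OF \<rho>(1)] in \<open>auto simp: f_def split: if_splits\<close>)
qed

text \<open>Measurability of the evaluations at fixed points is enough: for simple \<open>v\<close>
  the pairing is patched from finitely many of them, and each \<open>\<xi> t\<close> is
  continuous.\<close>

lemma pairing_measurable:
  fixes \<xi> :: "'t \<Rightarrow> 'z::{real_normed_vector, second_countable_topology} \<Rightarrow>\<^sub>L real"
  assumes \<xi>: "\<And>z. (\<lambda>t. blinfun_apply (\<xi> t) z) \<in> borel_measurable M" and v: "v \<in> borel_measurable M"
  shows "(\<lambda>t. blinfun_apply (\<xi> t) (v t)) \<in> borel_measurable M"
proof -
  obtain s where s: "\<And>i. simple_function M (s i)" "\<And>t. t \<in> space M \<Longrightarrow> (\<lambda>i. s i t) \<longlonglongrightarrow> v t"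
    using borel_measurable_implies_sequence_metric[OF v, of 0] by blast
  show ?thesis
  proof (rule borel_measurable_LIMSEQ_real)
    show "(\<lambda>i. blinfun_apply (\<xi> t) (s i t)) \<longlonglongrightarrow> blinfun_apply (\<xi> t) (v t)" if "t \<in> space M" for t
      using s(2)[OF that] by (intro tendsto_intros)
    show "(\<lambda>t. blinfun_apply (\<xi> t) (s i t)) \<in> borel_measurable M" for i
    proof (rule measurable_compose_countable'[where I = "s i ` space M" and g = "s i"])
      have fin: "finite (s i ` space M)" using s(1)[of i] by (simp add: simple_function_def)
      then show "countable (s i ` space M)" by (rule countable_finite)
      show "s i \<in> measurable M (count_space (s i ` space M))"
        using s(1)[of i] fin by (subst measurable_count_space_eq2) (auto simp: simple_function_def)
    qed (rule \<xi>)
  qed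
qed

text \<open>The difference \<open>\<Delta>\<close> of the two sides is additive and bounded by twice
  the integral of \<open>w t * norm (v t)\<close>. It vanishes on products
  \<open>f t *\<^sub>R d\<close> with \<open>d\<close> in \<open>D\<close>, and approximation in
  this weighted integral carries the zero to products with any \<open>z\<close>, to simple functions
  and to \<open>v\<close>.\<close>

lemma functional_eq_pairing:
  fixes \<psi> :: "('t \<Rightarrow> 'z::{real_normed_vector, second_countable_topology}) \<Rightarrow> real"
    and \<xi> :: "'t \<Rightarrow> 'z \<Rightarrow>\<^sub>L real" and w :: "'t \<Rightarrow> real"
  assumes \<psi>: "linear_functional_on (Lp M p) \<psi>"
    and w [measurable]: "w \<in> borel_measurable M"
    and w_int: "\<And>f :: 't \<Rightarrow> real. f \<in> Lp M p \<Longrightarrow> integrable M (\<lambda>t. w t * f t)"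
    and \<psi>_bound: "\<And>v. v \<in> Lp M p \<Longrightarrow> \<psi> v \<le> (\<integral>t. w t * norm (v t) \<partial>M)"
    and \<xi>_meas: "\<And>z. (\<lambda>t. blinfun_apply (\<xi> t) z) \<in> borel_measurable M"
    and \<xi>_norm: "\<And>t. norm (\<xi> t) \<le> w t"
    and D: "closure D = (UNIV :: 'z set)"
    and eq: "\<And>d f. d \<in> D \<Longrightarrow> f \<in> Lp M p \<Longrightarrow> \<psi> (\<lambda>t. f t *\<^sub>R d) = (\<integral>t. f t * blinfun_apply (\<xi> t) d \<partial>M)"
    and v: "v \<in> Lp M p"
  shows "\<psi> v = (\<integral>t. blinfun_apply (\<xi> t) (v t) \<partial>M)"
proof -
  have w0: "0 \<le> w t" for t using \<xi>_norm[of t] norm_ge_zero order_trans by blast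
  have apply_le: "\<bar>blinfun_apply (\<xi> t) z\<bar> \<le> w t * norm z" for t z
    using order_trans[OF norm_blinfun[of "\<xi> t" z] mult_right_mono[OF \<xi>_norm norm_ge_zero]] by simp
  have norm_Lp: "(\<lambda>t. norm (u t)) \<in> Lp M p" if u: "u \<in> Lp M p" for u :: "'t \<Rightarrow> 'z"
    using Lp_measurable[OF u] by (intro Lp_dominated(1)[OF _ u]) auto
  have wn: "integrable M (\<lambda>t. w t * norm (u t))" if "u \<in> Lp M p" for u :: "'t \<Rightarrow> 'z"
    by (rule w_int[OF norm_Lp[OF that]])
  have int: "integrable M (\<lambda>t. blinfun_apply (\<xi> t) (u t))" if u: "u \<in> Lp M p" for u
    using Bochner_Integration.integrable_bound[OF wn[OF u] pairing_measurable[OF \<xi>_meas Lp_measurable[OF u]]]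
      apply_le w0 by auto
  define \<Delta> where "\<Delta> = (\<lambda>u. \<psi> u - (\<integral>t. blinfun_apply (\<xi> t) (u t) \<partial>M))"
  have \<Delta>_add: "\<Delta> (u + u') = \<Delta> u + \<Delta> u'" if "u \<in> Lp M p" "u' \<in> Lp M p" for u u'
    using linear_functional_onD(1)[OF \<psi> that] int[OF that(1)] int[OF that(2)]
    by (simp add: \<Delta>_def blinfun.add_right)
  have \<Delta>_le: "\<bar>\<Delta> u\<bar> \<le> 2 * (\<integral>t. w t * norm (u t) \<partial>M)" if u: "u \<in> Lp M p" for u
  proof -
    have "\<bar>\<psi> u\<bar> \<le> (\<integral>t. w t * norm (u t) \<partial>M)"
      using \<psi>_bound[OF u] \<psi>_bound[of "- u"] u linear_functional_on_minus[OF \<psi> u] by simp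
    moreover have "\<bar>\<integral>t. blinfun_apply (\<xi> t) (u t) \<partial>M\<bar> \<le> (\<integral>t. \<bar>blinfun_apply (\<xi> t) (u t)\<bar> \<partial>M)"
      by (rule integral_abs_bound)
    moreover have "(\<integral>t. \<bar>blinfun_apply (\<xi> t) (u t)\<bar> \<partial>M) \<le> (\<integral>t. w t * norm (u t) \<partial>M)"
      using int[OF u] wn[OF u] apply_le by (intro integral_mono) auto
    ultimately show ?thesis unfolding \<Delta>_def by linarith
  qed
  have scale_Lp: "(\<lambda>t. f t *\<^sub>R z) \<in> Lp M p" if f: "f \<in> Lp M p" for f and z :: 'z
  proof (rule Lp_dominated(1))
    show "norm z *\<^sub>R f \<in> Lp M p" using f by simp
  qed (use Lp_measurable[OF f] in \<open>auto simp: mult.commute\<close>)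
  have \<Delta>_const: "\<Delta> (\<lambda>t. f t *\<^sub>R z) = 0" if f: "f \<in> Lp M p" for f z
  proof -
    let ?I = "\<integral>t. w t * \<bar>f t\<bar> \<partial>M"
    have "(\<lambda>t. \<bar>f t\<bar>) \<in> Lp M p" using Lp_measurable[OF f] by (intro Lp_dominated(1)[OF _ f]) auto
    then have I: "0 \<le> ?I" using w0 by (intro integral_nonneg_AE) auto
    have close: "\<bar>\<Delta> (\<lambda>t. f t *\<^sub>R z)\<bar> \<le> 2 * (norm (z - d) * ?I)" if d: "d \<in> D" for d
    proof -
      have "\<Delta> (\<lambda>t. f t *\<^sub>R d) = 0"
        unfolding \<Delta>_def using eq[OF d f] by (simp add: blinfun.scaleR_right)
      moreover have "(\<lambda>t. f t *\<^sub>R (z - d)) + (\<lambda>t. f t *\<^sub>R d) = (\<lambda>t. f t *\<^sub>R z)"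
        by (simp add: plus_fun_def scaleR_add_right[symmetric])
      ultimately have "\<Delta> (\<lambda>t. f t *\<^sub>R z) = \<Delta> (\<lambda>t. f t *\<^sub>R (z - d))"
        using \<Delta>_add[OF scale_Lp[OF f, of "z - d"] scale_Lp[OF f, of d]] by simp
      also have "\<bar>\<dots>\<bar> \<le> 2 * (\<integral>t. norm (z - d) * (w t * \<bar>f t\<bar>) \<partial>M)"
        using \<Delta>_le[OF scale_Lp[OF f, of "z - d"]] by (simp add: mult_ac)
      finally show ?thesis by simp
    qed
    have "\<bar>\<Delta> (\<lambda>t. f t *\<^sub>R z)\<bar> \<le> 0 + e" if "e > 0" for e
    proof -
      have "0 < e / (2 * (?I + 1))" using that I by simp
      then obtain d where d: "d \<in> D" "dist z d < e / (2 * (?I + 1))"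
        using D[unfolded closure_eq_UNIV_iff_meets_open, rule_format, of "ball z (e / (2 * (?I + 1)))"] by auto
      have "norm (z - d) * ?I \<le> e / (2 * (?I + 1)) * (?I + 1)"
        using d(2) I that by (intro mult_mono) (auto simp: dist_norm)
      also have "\<dots> = e / 2" using I by (simp add: field_simps)
      finally show ?thesis using close[OF d(1)] by simp
    qed
    then have "\<bar>\<Delta> (\<lambda>t. f t *\<^sub>R z)\<bar> \<le> 0" by (rule field_le_epsilon)
    then show ?thesis by simp
  qed
  \<comment> \<open>Functions are total, and a simple function is unrestricted off
    \<open>space M\<close>; values there are thereby discarded.\<close>
  have \<Delta>_null: "\<Delta> u = 0" if u: "u \<in> Lp M p" and "\<And>t. t \<in> space M \<Longrightarrow> u t = 0" for u
  proof -
    have "(\<integral>t. w t * norm (u t) \<partial>M) = (\<integral>t. 0 \<partial>M)"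
      using that(2) by (intro Bochner_Integration.integral_cong) auto
    then show ?thesis using \<Delta>_le[OF u] by simp
  qed
  have \<Delta>_simple: "\<Delta> s = 0" if s: "simple_function M s" and sL: "s \<in> Lp M p" for s
  proof -
    note [measurable] = Lp_measurable[OF sL]
    define u where "u = (\<lambda>Y t. if t \<in> space M \<and> s t \<in> Y then s t else 0)"
    have meas: "{t \<in> space M. s t \<in> Y} \<in> sets M" if "finite Y" for Y
      using measurable_sets[OF Lp_measurable[OF sL] borel_closed[OF finite_imp_closed[OF that]]]
      by (simp add: vimage_def Int_def conj_commute)
    have u_Lp: "u Y \<in> Lp M p" if "finite Y" for Y
    proof (rule Lp_dominated(1)[OF _ sL])
      show "u Y \<in> borel_measurable M"
        unfolding u_def using meas[OF that] by (intro measurable_If) auto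
    qed (simp add: u_def)
    have "\<Delta> (u Y) = 0" if "finite Y" for Y
      using that
    proof (induction Y)
      case empty
      show ?case using u_Lp[of "{}"] by (intro \<Delta>_null) (auto simp: u_def)
    next
      case (insert y Y)
      \<comment> \<open>The value 0 is set apart because the set where \<open>s\<close> vanishes may
        have infinite measure; for other values the indicator is dominated by a multiple of
        \<open>norm (s t)\<close>.\<close>
      show ?case
      proof (cases "y = 0")
        case True
        then have "u (insert y Y) = u Y" by (auto simp: u_def fun_eq_iff)
        with insert show ?thesis by simp
      next
        case False
        define f where "f = (\<lambda>t. indicator {t \<in> space M. s t = y} t :: real)"
        have f: "f \<in> Lp M p"
        proof (rule Lp_dominated(1))
          show "inverse (norm y) *\<^sub>R s \<in> Lp M p" using sL by simp
          show "f \<in> borel_measurable M" unfolding f_def by measurable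
          show "AE t in M. norm (f t) \<le> norm ((inverse (norm y) *\<^sub>R s) t)"
            using False by (auto simp: f_def indicator_def)
        qed
        have "u (insert y Y) = u Y + (\<lambda>t. f t *\<^sub>R y)" (is "_ = ?s")
          using insert(2) by (auto simp: u_def f_def fun_eq_iff indicator_def)
        then have "\<Delta> (u (insert y Y)) = \<Delta> ?s" by (rule arg_cong)
        also have "\<dots> = \<Delta> (u Y) + \<Delta> (\<lambda>t. f t *\<^sub>R y)" by (rule \<Delta>_add[OF u_Lp[OF insert(1)] scale_Lp[OF f]])
        finally show ?thesis using insert(3) \<Delta>_const[OF f, of y] by simp
      qed
    qed
    moreover have fin: "finite (s ` space M)" using s by (simp add: simple_function_def)
    moreover have "s - u (s ` space M) \<in> Lp M p" using sL u_Lp[OF fin] by simp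
    moreover from this have "\<Delta> (s - u (s ` space M)) = 0"
      by (rule \<Delta>_null) (simp add: u_def)
    ultimately show ?thesis
      using \<Delta>_add[of "s - u (s ` space M)" "u (s ` space M)"] u_Lp[OF fin] by simp
  qed
  obtain s where s: "\<And>i. simple_function M (s i)" "\<And>t. t \<in> space M \<Longrightarrow> (\<lambda>i. s i t) \<longlonglongrightarrow> v t"
    and "\<And>i t. t \<in> space M \<Longrightarrow> dist (s i t) 0 \<le> 2 * dist (v t) 0"
    using borel_measurable_implies_sequence_metric[OF Lp_measurable[OF v], of 0] by blast
  then have s_le: "norm (s i t) \<le> 2 * norm (v t)" if "t \<in> space M" for i t using that by simp
  have s_Lp: "s i \<in> Lp M p" for i
  proof (rule Lp_dominated(1))
    show "2 *\<^sub>R v \<in> Lp M p" using v by simp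
    show "s i \<in> borel_measurable M" using s(1) by (rule borel_measurable_simple_function)
  qed (use s_le in auto)
  note [measurable] = Lp_measurable[OF v] Lp_measurable[OF s_Lp]
  have "(\<lambda>i. \<integral>t. w t * norm ((v - s i) t) \<partial>M) \<longlonglongrightarrow> (\<integral>t. 0 \<partial>M)"
  proof (rule integral_dominated_convergence)
    \<comment> \<open>The factor 3 comes from
      \<open>norm (s i t) \<le> 2 * norm (v t)\<close>.\<close>
    show "integrable M (\<lambda>t. 3 * (w t * norm (v t)))" using wn[OF v] by simp
    show "AE t in M. (\<lambda>i. w t * norm ((v - s i) t)) \<longlonglongrightarrow> 0"
    proof (rule AE_I2)
      fix t assume "t \<in> space M"
      then have "(\<lambda>i. w t * norm (v t - s i t)) \<longlonglongrightarrow> w t * norm (v t - v t)"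
        by (intro tendsto_intros s(2))
      then show "(\<lambda>i. w t * norm ((v - s i) t)) \<longlonglongrightarrow> 0" by simp
    qed
    show "AE t in M. norm (w t * norm ((v - s i) t)) \<le> 3 * (w t * norm (v t))" for i
    proof (rule AE_I2)
      fix t assume "t \<in> space M"
      then have "norm (v t - s i t) \<le> 3 * norm (v t)"
        using norm_triangle_ineq4[of "v t" "s i t"] s_le[of t i] by simp
      then have "w t * norm (v t - s i t) \<le> w t * (3 * norm (v t))" using w0 by (rule mult_left_mono)
      then show "norm (w t * norm ((v - s i) t)) \<le> 3 * (w t * norm (v t))" using w0[of t] by simp
    qed
  qed (auto simp: fun_diff_def)
  then have lim: "(\<lambda>i. 2 * (\<integral>t. w t * norm ((v - s i) t) \<partial>M)) \<longlonglongrightarrow> 2 * 0"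
    by (intro tendsto_mult tendsto_const) simp
  have le: "\<bar>\<Delta> v\<bar> \<le> 2 * (\<integral>t. w t * norm ((v - s i) t) \<partial>M)" for i
  proof -
    have "v - s i \<in> Lp M p" using v s_Lp by simp
    then have "\<Delta> v = \<Delta> (v - s i)"
      using \<Delta>_add[of "v - s i" "s i"] \<Delta>_simple[OF s(1) s_Lp] s_Lp by simp
    then show ?thesis using \<Delta>_le[OF \<open>v - s i \<in> Lp M p\<close>] by simp
  qed
  have "\<bar>\<Delta> v\<bar> \<le> 2 * 0" by (rule LIMSEQ_le_const[OF lim]) (use le in blast)
  then show ?thesis by (simp add: \<Delta>_def)
qed

text \<open>The functions \<open>h t\<close> stand for the positive parts of the Clarke directional derivatives of the
  distances to the sets \<open>S t\<close>. Adding \<open>norm z * \<omega>\<close> makes the functional \<open>f \<mapsto> \<psi> (f z)\<close> positive, so that it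
  has a density; on a countable dense subgroup the densities are additive in \<open>z\<close> almost everywhere.\<close>

lemma dominated_functional_representation:
  fixes \<psi> :: "('t \<Rightarrow> 'z::{real_normed_vector, second_countable_topology}) \<Rightarrow> real"
    and \<omega> :: "('t \<Rightarrow> real) \<Rightarrow> real" and h :: "'t \<Rightarrow> 'z \<Rightarrow> real"
  assumes refl: "reflexive_space TYPE('z)"
    and q: "if p = 1 then q = \<infinity> else 1 / p + 1 / q = 1"
    and \<psi>: "linear_functional_on (Lp M p) \<psi>" and \<omega>: "linear_functional_on (Lp M p) \<omega>"
    and \<omega>_bound: "\<And>f. f \<in> Lp M p \<Longrightarrow> \<omega> f \<le> K * Lp_norm M p f"
    and \<omega>_pos: "\<And>f. f \<in> Lp M p \<Longrightarrow> (\<And>t. 0 \<le> f t) \<Longrightarrow> 0 \<le> \<omega> f"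
    and h: "\<And>t. sublinear_on UNIV (h t)" and h_nonneg: "\<And>t z. 0 \<le> h t z" and h_norm: "\<And>t z. h t z \<le> norm z"
    and h_meas: "\<And>v. v \<in> borel_measurable M \<Longrightarrow> (\<lambda>t. h t (v t)) \<in> borel_measurable M"
    and \<psi>_le: "\<And>v. v \<in> Lp M p \<Longrightarrow> \<psi> v \<le> \<omega> (\<lambda>t. h t (v t))"
  obtains \<xi> :: "'t \<Rightarrow> 'z \<Rightarrow>\<^sub>L real" and w :: "'t \<Rightarrow> real"
  where "\<xi> \<in> Lp M q" "\<And>t z. blinfun_apply (\<xi> t) z \<le> w t * h t z"
    and "\<And>v. v \<in> Lp M p \<Longrightarrow> \<psi> v = (\<integral>t. blinfun_apply (\<xi> t) (v t) \<partial>M)"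
proof -
  obtain w where w [measurable]: "w \<in> borel_measurable M" and w0: "\<And>t. 0 \<le> w t"
    and w_int: "\<And>f. f \<in> Lp M p \<Longrightarrow> integrable M (\<lambda>t. w t * f t)"
    and w_eq: "\<And>f. f \<in> Lp M p \<Longrightarrow> \<omega> f = (\<integral>t. w t * f t \<partial>M)"
    by (rule positive_functional_density[OF \<omega> \<omega>_pos \<omega>_bound]) (assumption | rule that)+
  have w_Lq: "w \<in> Lp M q"
    by (rule density_in_conjugate_Lp[OF q w w0 w_int]) (use w_eq \<omega>_bound in auto)
  have \<omega>_mono: "\<omega> f \<le> \<omega> g" if "f \<in> Lp M p" "g \<in> Lp M p" "\<And>t. f t \<le> g t" for f g
    using linear_functional_on_diff[OF \<omega> Lp.V that(2,1)] \<omega>_pos[of "g - f"] that by simp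
  have h_Lp: "(\<lambda>t. h t (v t)) \<in> Lp M p" if v: "v \<in> Lp M p" for v
    using h_meas[OF Lp_measurable[OF v]] h_nonneg h_norm by (intro Lp_dominated(1)[OF _ v]) auto
  have norm_Lp: "(\<lambda>t. norm (u t)) \<in> Lp M p" if u: "u \<in> Lp M p" for u :: "'t \<Rightarrow> 'z"
    using Lp_measurable[OF u] by (intro Lp_dominated(1)[OF _ u]) auto
  have scale_Lp: "(\<lambda>t. f t *\<^sub>R z) \<in> Lp M p" if f: "f \<in> Lp M p" for f and z :: 'z
  proof (rule Lp_dominated(1))
    show "norm z *\<^sub>R f \<in> Lp M p" using f by simp
  qed (use Lp_measurable[OF f] in \<open>auto simp: mult.commute\<close>)
  have h_scale: "h t (c *\<^sub>R z) = c * h t z" if "0 \<le> c" for c t z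
    using sublinear_onD(2)[OF h] that by simp
  have \<psi>_norm: "\<psi> v \<le> \<omega> (\<lambda>t. norm (v t))" if v: "v \<in> Lp M p" for v
    using \<psi>_le[OF v] \<omega>_mono[OF h_Lp[OF v] norm_Lp[OF v]] h_norm by fastforce
  have \<psi>_add: "\<psi> (\<lambda>t. u t + v t) = \<psi> u + \<psi> v" if "u \<in> Lp M p" "v \<in> Lp M p" for u v
    using linear_functional_onD(1)[OF \<psi> that] by (simp add: plus_fun_def)
  have "\<exists>g. g \<in> borel_measurable M \<and> (\<forall>f\<in>Lp M p. integrable M (\<lambda>t. g t * f t) \<and>
      \<psi> (\<lambda>t. f t *\<^sub>R z) = (\<integral>t. g t * f t \<partial>M))" for z
  proof -
    define \<Lambda> where "\<Lambda> = (\<lambda>f. \<psi> (\<lambda>t. f t *\<^sub>R z) + norm z * \<omega> f)"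
    have \<Lambda>: "linear_functional_on (Lp M p) \<Lambda>"
      unfolding linear_functional_on_def
    proof (intro conjI ballI allI)
      fix f g :: "'t \<Rightarrow> real" and c :: real assume f: "f \<in> Lp M p"
      have "(\<lambda>t. (c *\<^sub>R f) t *\<^sub>R z) = c *\<^sub>R (\<lambda>t. f t *\<^sub>R z)" by (simp add: scaleR_fun_def)
      then show "\<Lambda> (c *\<^sub>R f) = c * \<Lambda> f"
        unfolding \<Lambda>_def using linear_functional_onD(2)[OF \<psi> scale_Lp[OF f, of z], of c]
          linear_functional_onD(2)[OF \<omega> f, of c] by (simp add: distrib_left)
      assume g: "g \<in> Lp M p"
      show "\<Lambda> (f + g) = \<Lambda> f + \<Lambda> g"
        unfolding \<Lambda>_def using \<psi>_add[OF scale_Lp[OF f, of z] scale_Lp[OF g, of z]]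
          linear_functional_onD(1)[OF \<omega> f g] by (simp add: distrib_left scaleR_add_left)
    qed
    have abs_Lp: "(\<lambda>t. \<bar>f t\<bar>) \<in> Lp M p" if f: "f \<in> Lp M p" for f :: "'t \<Rightarrow> real"
      using Lp_measurable[OF f] by (intro Lp_dominated(1)[OF _ f]) auto
    have bound: "\<psi> (\<lambda>t. f t *\<^sub>R y) \<le> norm y * \<omega> (\<lambda>t. \<bar>f t\<bar>)" if f: "f \<in> Lp M p" for f y
    proof -
      have "\<psi> (\<lambda>t. f t *\<^sub>R y) \<le> \<omega> (norm y *\<^sub>R (\<lambda>t. \<bar>f t\<bar>))"
        using \<psi>_norm[OF scale_Lp[OF f, of y]] by (simp add: scaleR_fun_def mult.commute)
      also have "\<dots> = norm y * \<omega> (\<lambda>t. \<bar>f t\<bar>)" by (rule linear_functional_onD(2)[OF \<omega> abs_Lp[OF f]])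
      finally show ?thesis .
    qed
    obtain G where G: "G \<in> borel_measurable M" "\<And>t. 0 \<le> G t"
      "\<And>f. f \<in> Lp M p \<Longrightarrow> integrable M (\<lambda>t. G t * f t)"
      "\<And>f. f \<in> Lp M p \<Longrightarrow> \<Lambda> f = (\<integral>t. G t * f t \<partial>M)"
    proof (rule positive_functional_density[OF \<Lambda>])
      show "0 \<le> \<Lambda> f" if f: "f \<in> Lp M p" and f0: "\<And>t. 0 \<le> f t" for f
      proof -
        have "- \<psi> (\<lambda>t. f t *\<^sub>R z) = \<psi> (- (\<lambda>t. f t *\<^sub>R z))"
          using linear_functional_on_minus[OF \<psi> scale_Lp[OF f, of z]] by simp
        also have "- (\<lambda>t. f t *\<^sub>R z) = (\<lambda>t. f t *\<^sub>R (- z))" by (simp add: fun_eq_iff)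
        also have "\<psi> \<dots> \<le> norm z * \<omega> f" using bound[OF f, of "- z"] f0 by simp
        finally show ?thesis unfolding \<Lambda>_def by simp
      qed
      \<comment> \<open>One \<open>norm z * K\<close> for each summand of
        \<open>\<Lambda>\<close>.\<close>
      show "\<Lambda> f \<le> (2 * norm z * K) * Lp_norm M p f" if f: "f \<in> Lp M p" for f
      proof -
        have "Lp_norm M p (\<lambda>t. \<bar>f t\<bar>) = Lp_norm M p f" by (simp add: Lp_norm_eq)
        then have "\<omega> (\<lambda>t. \<bar>f t\<bar>) \<le> K * Lp_norm M p f" using \<omega>_bound[OF abs_Lp[OF f]] by simp
        then have "norm z * \<omega> (\<lambda>t. \<bar>f t\<bar>) \<le> norm z * (K * Lp_norm M p f)" by (rule mult_left_mono) simp
        moreover have "norm z * \<omega> f \<le> norm z * (K * Lp_norm M p f)" by (rule mult_left_mono[OF \<omega>_bound[OF f]]) simp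
        ultimately show ?thesis unfolding \<Lambda>_def using bound[OF f, of z] by (simp add: algebra_simps)
      qed
    qed (rule that)
    show ?thesis
    proof (intro exI[of _ "\<lambda>t. G t - norm z * w t"] conjI ballI)
      fix f :: "'t \<Rightarrow> real" assume f: "f \<in> Lp M p"
      have "integrable M (\<lambda>t. norm z * (w t * f t))" using w_int[OF f] by simp
      then show "integrable M (\<lambda>t. (G t - norm z * w t) * f t)"
        "\<psi> (\<lambda>t. f t *\<^sub>R z) = (\<integral>t. (G t - norm z * w t) * f t \<partial>M)"
        using G(3,4)[OF f] w_eq[OF f] by (auto simp: \<Lambda>_def left_diff_distrib mult.assoc)
    qed (use G(1) in measurable)
  qed
  then obtain g where g [measurable]: "\<And>z. g z \<in> borel_measurable M"
    and g_int: "\<And>z f. f \<in> Lp M p \<Longrightarrow> integrable M (\<lambda>t. g z t * f t)"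
    and g_eq: "\<And>z f. f \<in> Lp M p \<Longrightarrow> \<psi> (\<lambda>t. f t *\<^sub>R z) = (\<integral>t. g z t * f t \<partial>M)"
    by metis
  obtain D :: "'z set" where D: "countable D" "closure D = UNIV" "0 \<in> D"
    and D_add: "\<And>x y. x \<in> D \<Longrightarrow> y \<in> D \<Longrightarrow> x + y \<in> D" and D_neg: "\<And>x. x \<in> D \<Longrightarrow> - x \<in> D"
    by (rule countable_dense_subgroup) (rule that)
  have [measurable]: "(\<lambda>t. h t z) \<in> borel_measurable M" for z by (rule h_meas) simp
  have fh_Lp: "(\<lambda>t. f t * h t z) \<in> Lp M p" if f: "f \<in> Lp M p" for f z
    using scale_Lp[OF f, of z] Lp_measurable[OF f] h_nonneg h_norm
    by (intro Lp_dominated(1)[OF _ scale_Lp[OF f, of z]]) (auto simp: abs_mult mult_left_mono)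
  \<comment> \<open>For nonnegative \<open>f\<close> homogeneity takes \<open>f t\<close> out of
    \<open>h t\<close>, so the bound by \<open>\<omega>\<close> becomes a comparison of two
    integrals against an arbitrary test function.\<close>
  have AE_h: "AE t in M. g z t \<le> w t * h t z" for z
  proof (rule AE_le_of_integrals_le)
    fix f :: "'t \<Rightarrow> real" assume f: "f \<in> Lp M p"
    show "integrable M (\<lambda>t. g z t * f t)" by (rule g_int[OF f])
    show "integrable M (\<lambda>t. w t * h t z * f t)" using w_int[OF fh_Lp[OF f, of z]] by (simp add: mult_ac)
    assume f0: "\<And>t. 0 \<le> f t"
    have "(\<integral>t. g z t * f t \<partial>M) \<le> \<omega> (\<lambda>t. h t (f t *\<^sub>R z))"
      using g_eq[OF f, of z] \<psi>_le[OF scale_Lp[OF f, of z]] by simp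
    also have "\<dots> = (\<integral>t. w t * h t z * f t \<partial>M)"
      using w_eq[OF fh_Lp[OF f, of z]] h_scale f0 by (simp add: mult_ac)
    finally show "(\<integral>t. g z t * f t \<partial>M) \<le> (\<integral>t. w t * h t z * f t \<partial>M)" .
  qed measurable
  have eq_add: "(\<integral>t. g (y + z) t * f t \<partial>M) = (\<integral>t. (g y t + g z t) * f t \<partial>M)" if f: "f \<in> Lp M p" for y z f
    using \<psi>_add[OF scale_Lp[OF f, of y] scale_Lp[OF f, of z]] g_eq[OF f, of y] g_eq[OF f, of z] g_eq[OF f, of "y + z"] g_int[OF f]
    by (simp add: scaleR_add_right distrib_right)
  have int_add: "integrable M (\<lambda>t. (g y t + g z t) * f t)" if f: "f \<in> Lp M p" for y z f
    using g_int[OF f] by (simp add: distrib_right)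
  have AE_add: "AE t in M. g (y + z) t = g y t + g z t" for y z
  proof -
    have "AE t in M. g (y + z) t \<le> g y t + g z t"
      by (rule AE_le_of_integrals_le) (auto simp: g_int int_add eq_add)
    moreover have "AE t in M. g y t + g z t \<le> g (y + z) t"
      by (rule AE_le_of_integrals_le) (auto simp: g_int int_add eq_add)
    ultimately show ?thesis by eventually_elim simp
  qed
  \<comment> \<open>Both conditions range over the countable \<open>D\<close>, so a single null set
    is discarded for all of them.\<close>
  define good where "good = (\<lambda>t. \<forall>y\<in>D. g y t \<le> w t * h t y \<and> (\<forall>z\<in>D. g (y + z) t = g y t + g z t))"
  have [measurable]: "Measurable.pred M good" unfolding good_def using D(1) by measurable
  have AE_good: "AE t in M. good t"
    unfolding good_def using AE_h AE_add by (simp add: AE_ball_countable[OF D(1)])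
  have "\<exists>b :: 'z \<Rightarrow>\<^sub>L real. \<forall>d\<in>D. blinfun_apply b d = g d t" if t: "good t" for t
  proof -
    have g0: "g 0 t = 0" using t D(3) unfolding good_def by fastforce
    have neg: "g (- d) t = - g d t" if d: "d \<in> D" for d
      using t d D_neg[OF d] g0 unfolding good_def by (metis add.right_inverse add_eq_0_iff)
    have le: "g d t \<le> w t * norm d" if d: "d \<in> D" for d
      using t d mult_left_mono[OF h_norm[of t d] w0[of t]] unfolding good_def by fastforce
    have "\<bar>g d t\<bar> \<le> w t * norm d" if d: "d \<in> D" for d
      using le[OF d] le[OF D_neg[OF d]] neg[OF d] by simp
    then obtain b :: "'z \<Rightarrow>\<^sub>L real" where "\<And>d. d \<in> D \<Longrightarrow> blinfun_apply b d = g d t"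
      using additive_dense_extension[OF D(2) D_add D_neg, where g = "\<lambda>d. g d t" and c = "w t"] t w0
      unfolding good_def by metis
    then show ?thesis by blast
  qed
  then obtain b where b: "\<And>t d. good t \<Longrightarrow> d \<in> D \<Longrightarrow> blinfun_apply (b t :: 'z \<Rightarrow>\<^sub>L real) d = g d t"
    by metis
  \<comment> \<open>The value 0 off the good set keeps the bound by \<open>w t * h t z\<close> valid
    at every \<open>t\<close>, as \<open>w\<close> and \<open>h\<close> are nonnegative.\<close>
  define \<xi> where "\<xi> = (\<lambda>t. if good t then b t else 0)"
  have \<xi>_D: "blinfun_apply (\<xi> t) d = (if good t then g d t else 0)" if "d \<in> D" for t d
    using b that by (simp add: \<xi>_def)
  \<comment> \<open>A sublinear function below the norm is 1-Lipschitz; this carries the bound on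
    \<open>\<xi> t\<close> from \<open>D\<close> to all \<open>z\<close>.\<close>
  have h_cont: "continuous_on UNIV (h t)" for t
  proof -
    have "h t y - h t z \<le> norm (y - z)" for y z
      using sublinear_onD(1)[OF h, of z "y - z" t] h_norm[of t "y - z"] by simp
    then have "dist (h t y) (h t z) \<le> dist y z" for y z
      by (smt (verit) dist_norm norm_minus_commute real_norm_def)
    then have "1-lipschitz_on UNIV (h t)" by (auto intro!: lipschitz_onI)
    then show ?thesis by (rule lipschitz_on_continuous_on)
  qed
  have \<xi>_h: "blinfun_apply (\<xi> t) z \<le> w t * h t z" for t z
  proof (rule dense_closed_UNIV[OF D(2), where P = "\<lambda>z. blinfun_apply (\<xi> t) z \<le> w t * h t z"])
    show "closed {z. blinfun_apply (\<xi> t) z \<le> w t * h t z}"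
      by (intro closed_Collect_le continuous_intros h_cont)
    show "blinfun_apply (\<xi> t) d \<le> w t * h t d" if "d \<in> D" for d
      using that w0[of t] h_nonneg[of t d] by (auto simp: \<xi>_D good_def)
  qed
  have \<xi>_norm: "norm (\<xi> t) \<le> w t" for t
  proof (rule norm_blinfun_bound[OF w0])
    have le: "blinfun_apply (\<xi> t) z \<le> w t * norm z" for z
      using \<xi>_h[of t z] mult_left_mono[OF h_norm[of t z] w0[of t]] by linarith
    show "norm (blinfun_apply (\<xi> t) z) \<le> w t * norm z" for z
      using le[of z] le[of "- z"] by (simp add: blinfun.minus_right)
  qed
  obtain E :: "('z \<Rightarrow>\<^sub>L real) set" where E: "countable E" "closure E = UNIV"
    using reflexive_dual_separable[OF refl] by metis
  have \<xi> [measurable]: "\<xi> \<in> borel_measurable M"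
    by (rule borel_measurable_dual[OF E D(1,2)]) (simp add: \<xi>_D)
  have \<xi>_meas: "(\<lambda>t. blinfun_apply (\<xi> t) z) \<in> borel_measurable M" for z
    by (rule measurable_compose[OF \<xi> borel_measurable_continuous_onI]) (intro continuous_intros)
  have "\<psi> v = (\<integral>t. blinfun_apply (\<xi> t) (v t) \<partial>M)" if v: "v \<in> Lp M p" for v
  proof (rule functional_eq_pairing[OF \<psi> w w_int _ \<xi>_meas \<xi>_norm D(2) _ v])
    show "\<psi> u \<le> (\<integral>t. w t * norm (u t) \<partial>M)" if "u \<in> Lp M p" for u
      using \<psi>_norm[OF that] w_eq[OF norm_Lp[OF that]] by simp
    fix d and f :: "'t \<Rightarrow> real" assume d: "d \<in> D" and f: "f \<in> Lp M p"
    note [measurable] = Lp_measurable[OF f] \<xi>_meas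
    have "\<psi> (\<lambda>t. f t *\<^sub>R d) = (\<integral>t. g d t * f t \<partial>M)" by (rule g_eq[OF f])
    also have "\<dots> = (\<integral>t. f t * blinfun_apply (\<xi> t) d \<partial>M)"
      using AE_good by (intro integral_cong_AE) (auto elim!: eventually_mono simp: \<xi>_D[OF d])
    finally show "\<psi> (\<lambda>t. f t *\<^sub>R d) = (\<integral>t. f t * blinfun_apply (\<xi> t) d \<partial>M)" .
  qed
  moreover have "\<xi> \<in> Lp M q"
  proof (cases "q = \<infinity>")
    case True
    then obtain C where "AE t in M. norm (w t) \<le> C" using w_Lq unfolding Lp_def by auto
    then have "AE t in M. norm (\<xi> t) \<le> C" using \<xi>_norm w0 by (auto elim!: eventually_mono intro: order_trans)
    with True show ?thesis unfolding Lp_def by auto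
  next
    case False
    then have "integrable M (\<lambda>t. norm (w t) powr enn2real q)" using w_Lq unfolding Lp_def by auto
    then have "integrable M (\<lambda>t. norm (\<xi> t) powr enn2real q)"
      by (rule Bochner_Integration.integrable_bound)
        (use \<xi>_norm w0 in \<open>auto intro!: powr_mono2 simp: enn2real_nonneg\<close>)
    with False show ?thesis unfolding Lp_def by auto
  qed
  ultimately show ?thesis using \<xi>_h that by blast
qed

end

theorem corollary5p2:
  fixes M :: "'t measure"
    and S :: "'t \<Rightarrow> 'z::{banach, second_countable_topology} set"
    and F :: "('t \<Rightarrow> 'z) \<Rightarrow> real"
    and xbar :: "'t \<Rightarrow> 'z"
    and p q :: ennreal
  assumes "complete_measure M" and "sigma_finite_measure M"
    and "reflexive_space TYPE('z)"
    and "1 \<le> p" and "p < \<infinity>"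
    and "if p = 1 then q = \<infinity> else 1 / p + 1 / q = 1"
    and "measurable_multifunction M S"
    and "\<And>t. t \<in> space M \<Longrightarrow> S t \<noteq> {} \<and> closed (S t)"
    and "locally_lipschitz_Lp M p F"
    and "xbar \<in> Sel M p S"
    and "local_minimizer_Lp M p F (Sel M p S) xbar"
  shows "0 \<in> clarke_subdifferential M p F xbar
           + Lp_pairing M p ` {\<xi> \<in> Lp M q. AE t in M. \<xi> t \<in> clarke_normal_cone (S t) (xbar t)}"
proof -
  interpret Lp_exponent M p
    using assms(2,4,5) by (simp add: Lp_exponent_def Lp_exponent_axioms_def)
  have x: "xbar \<in> Lp M p" and AE_x: "AE t in M. xbar t \<in> S t"
    using assms(10) unfolding Sel_def by auto
  obtain r0 L where "r0 > 0" and L: "\<And>y z. y \<in> Lp M p \<Longrightarrow> z \<in> Lp M p \<Longrightarrow> Lp_dist M p y xbar < r0 \<Longrightarrow>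
      Lp_dist M p z xbar < r0 \<Longrightarrow> \<bar>F y - F z\<bar> \<le> L * Lp_dist M p y z"
    using assms(9) x unfolding locally_lipschitz_Lp_def by blast
  \<comment> \<open>The constant \<open>L\<close> may be negative when all distances concerned are
    0, while a penalty factor must be nonnegative.\<close>
  define K where "K = max L 0"
  have K: "0 \<le> K" unfolding K_def by simp
  have F: "lipschitz_near (Lp M p) (Lp_norm M p) F xbar r0 K"
  proof
    show "xbar \<in> Lp M p" "0 < r0" by fact+
    fix y z assume yz: "y \<in> Lp M p" "z \<in> Lp M p" "Lp_norm M p (y - xbar) < r0" "Lp_norm M p (z - xbar) < r0"
    have "\<bar>F y - F z\<bar> \<le> L * Lp_norm M p (y - z)"
      using L[OF yz(1,2)] yz(3,4) by (simp add: Lp_dist_def fun_diff_def)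
    also have "\<dots> \<le> K * Lp_norm M p (y - z)" unfolding K_def by (intro mult_right_mono) auto
    finally show "\<bar>F y - F z\<bar> \<le> K * Lp_norm M p (y - z)" .
  qed
  then interpret F: lipschitz_near "Lp M p" "Lp_norm M p" F xbar r0 K .
  define h where "h = (\<lambda>t z. max 0 (dist_dd (S t) (xbar t) z))"
  obtain \<phi> \<omega> where \<phi>: "linear_functional_on (Lp M p) \<phi>" and \<omega>: "linear_functional_on (Lp M p) \<omega>"
    and \<phi>_le: "\<And>v. v \<in> Lp M p \<Longrightarrow> \<phi> v \<le> clarke_dd (Lp M p) (Lp_norm M p) F xbar v"
    and \<omega>_bound: "\<And>f. f \<in> Lp M p \<Longrightarrow> \<omega> f \<le> K * Lp_norm M p f"
    and \<omega>_pos: "\<And>f. f \<in> Lp M p \<Longrightarrow> (\<And>t. 0 \<le> f t) \<Longrightarrow> 0 \<le> \<omega> f"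
    and \<phi>_h: "\<And>v. v \<in> Lp M p \<Longrightarrow> - \<phi> v \<le> \<omega> (\<lambda>t. h t (v t))"
  proof (rule clarke_multipliers[OF assms(7) _ _ F K assms(10,11)], goal_cases)
    case (3 \<phi> \<omega>)
    show thesis by (rule that) (fact 3 | (unfold h_def, fact 3))+
  qed (use assms(8) in blast)+
  \<comment> \<open>The functional to be represented is \<open>- \<phi>\<close>: it is the one
    dominated through \<open>h\<close>, and its density cancels \<open>\<phi>\<close> in the
    sum.\<close>
  have neg: "linear_functional_on (Lp M p) (\<lambda>v. - \<phi> v)"
    using \<phi> unfolding linear_functional_on_def by simp
  have h_meas: "(\<lambda>t. h t (v t)) \<in> borel_measurable M" if "v \<in> borel_measurable M" for v
    using borel_measurable_dist_dd[OF assms(7) _ Lp_measurable[OF x] that] assms(8) unfolding h_def by simp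
  have h_sub: "sublinear_on UNIV (h t)" for t
  proof (rule sublinear_onI)
    note sub = sublinear_on_dist_dd[of "S t" "xbar t"]
    show "h t (u + v) \<le> h t u + h t v" for u v
      using sublinear_onD(1)[OF sub, of u v] unfolding h_def by auto
    show "h t 0 = 0" using sublinear_onD(2)[OF sub, of 0 0] unfolding h_def by simp
    show "h t (c *\<^sub>R u) \<le> c * h t u" if "c > 0" for u c
      using sublinear_onD(2)[OF sub, of u c] that unfolding h_def by (simp add: max_mult_distrib_left)
  qed auto
  have h_norm: "h t z \<le> norm z" and h_nonneg: "0 \<le> h t z" for t z
    using dist_dd_le_norm[of "S t" "xbar t" z] unfolding h_def by auto
  obtain \<xi> w where \<xi>: "\<xi> \<in> Lp M q" and \<xi>_h: "\<And>t z. blinfun_apply (\<xi> t) z \<le> w t * h t z"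
    and \<xi>_eq: "\<And>v. v \<in> Lp M p \<Longrightarrow> - \<phi> v = (\<integral>t. blinfun_apply (\<xi> t) (v t) \<partial>M)"
    by (rule dominated_functional_representation[OF assms(3,6) neg \<omega> \<omega>_bound \<omega>_pos h_sub h_nonneg h_norm h_meas \<phi>_h])
      (assumption | rule that)+
  have normal: "AE t in M. \<xi> t \<in> clarke_normal_cone (S t) (xbar t)"
    using AE_x
  proof eventually_elim
    case (elim t)
    show ?case
      unfolding clarke_normal_cone_def
    proof (rule CollectI, rule ballI)
      fix v assume "v \<in> clarke_tangent_cone (S t) (xbar t)"
      then have "h t v = 0" unfolding h_def using clarke_tangent_cone_dist_dd[OF elim] by simp
      then show "blinfun_apply (\<xi> t) v \<le> 0" using \<xi>_h[of t v] by simp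
    qed
  qed
  \<comment> \<open>Elements of \<open>Lp_dual\<close> and values of \<open>Lp_pairing\<close> are 0
    off \<open>Lp M p\<close>, whereas the Hahn-Banach functional is unrestricted there; the final
    identity is one between total functions.\<close>
  define \<phi>' where "\<phi>' = (\<lambda>v. if v \<in> Lp M p then \<phi> v else 0)"
  have "\<phi>' \<in> Lp_dual M p"
    unfolding Lp_dual_def
  proof (intro CollectI conjI ballI allI impI exI[of _ K])
    fix v :: "'t \<Rightarrow> 'z" assume v: "v \<in> Lp M p"
    show "\<phi>' (\<lambda>t. c *\<^sub>R v t) = c * \<phi>' v" for c
      using linear_functional_onD(2)[OF \<phi> v, of c] v Lp_scale[OF v, of c] by (simp add: \<phi>'_def scaleR_fun_def)
    show "\<bar>\<phi>' v\<bar> \<le> K * Lp_norm M p v"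
      using \<phi>_le[OF v] \<phi>_le[of "- v"] F.clarke_dd_le_norm[OF v] F.clarke_dd_le_norm[of "- v"] v
        linear_functional_on_minus[OF \<phi> v] Lp.N_minus[OF v] by (simp add: \<phi>'_def)
    fix u :: "'t \<Rightarrow> 'z" assume u: "u \<in> Lp M p"
    show "\<phi>' (\<lambda>t. v t + u t) = \<phi>' v + \<phi>' u"
      using linear_functional_onD(1)[OF \<phi> v u] v u Lp.V_simps(2)[OF v u] by (simp add: \<phi>'_def plus_fun_def)
  qed (simp add: \<phi>'_def)
  moreover have "ereal (\<phi>' v) \<le> clarke_derivative M p F xbar v" if v: "v \<in> Lp M p" for v
    using order_trans[OF _ clarke_dd_le_clarke_derivative[OF F v]] \<phi>_le[OF v] v by (simp add: \<phi>'_def)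
  ultimately have "\<phi>' \<in> clarke_subdifferential M p F xbar"
    unfolding clarke_subdifferential_def by blast
  moreover have "0 = \<phi>' + Lp_pairing M p \<xi>"
    by (auto simp: fun_eq_iff \<phi>'_def Lp_pairing_def \<xi>_eq[symmetric])
  ultimately show ?thesis
    using \<xi> normal by (metis (mono_tags, lifting) imageI mem_Collect_eq set_plus_intro)
qed

end
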